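(* Let $1<p<\infty$, let $p'$ be its conjugate index ($\frac1p+\frac1{p'}=1$), and let $g\in H^\infty$ be such that $\widehat g(n)\ge 0$ for all $n\in\mathbb N\cup\{0\}$. Let $X_p\in\{H^p,\,D^p_{p-1},\,HL_p\}$. Then the following three conditions are equivalent: $T_g:X_p\to H^\infty$ is bounded; $T_g:X_p\to H^\infty$ is compact; $$\sum_{k=0}^{\infty}(k+1)^{p'-2}\left(\sum_{n=0}^{\infty}\frac{(n+1)\widehat g(n+1)}{n+k+1}\right)^{p'}<\infty .$$ Moreover, $$\|T_g\|_{X_p\to H^\infty}^{p'}\asymp\sum_{k=0}^{\infty}(k+1)^{p'-2}\left(\sum_{n=0}^{\infty}\frac{(n+1)\widehat g(n+1)}{n+k+1}\right)^{p'},$$ where the comparison constants are independent of $g$.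
   Context: $\mathbb D=\{z\in\mathbb C:|z|<1\}$ and $\mathcal H(\mathbb D)$ is the space of analytic functions in $\mathbb D$. For $f\in\mathcal H(\mathbb D)$, $\widehat f(n)$ denotes the $n$-th Maclaurin coefficient, $f(z)=\sum_{n=0}^\infty\widehat f(n)z^n$. For $g\in\mathcal H(\mathbb D)$, $T_g(f)(z)=\int_0^z f(\zeta)g'(\zeta)\,d\zeta$, $z\in\mathbb D$. $H^p$ ($0<p\le\infty$) is the Hardy space with $\|f\|_{H^p}=\sup_{0<r<1}M_p(r,f)$, where $M_p(r,f)=\left(\frac1{2\pi}\int_0^{2\pi}|f(re^{i\theta})|^p\,d\theta\right)^{1/p}$ for $p<\infty$ and $M_\infty(r,f)=\max_\theta|f(re^{i\theta})|$. $D^p_{p-1}$ is the space of $f\in\mathcal H(\mathbb D)$ with $\|f\|_{D^p_{p-1}}^p=\int_{\mathbb D}|f'(z)|^p(1-|z|)^{p-1}\,dA(z)+|f(0)|^p<\infty$, where $dA=\frac{dx\,dy}{\pi}$. $HL_p$ is the space of $f\in\mathcal H(\mathbb D)$ with $\|f\|_{HL_p}^p=\sum_{n=0}^\infty|\widehat f(n)|^p(n+1)^{p-2}<\infty$. $\|T_g\|_{X\to H^\infty}$ is the operator norm ($+\infty$ if $T_g:X\to H^\infty$ is not bounded). $a\asymp b$ means $C^{-1}b\le a\le Cb$ for a constant $C>0$, here depending only on $p$ and the choice of space. *)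

theory Defs
  imports "HOL-Complex_Analysis.Complex_Analysis"
begin

text \<open>
  Analytic functions on the unit disc are total functions on \<^typ>\<open>complex\<close> that are holomorphic on
  \<open>ball 0 1\<close>; their values outside the disc never matter. A function space on the disc is given by
  its norm, an \<^typ>\<open>ennreal\<close>-valued functional, as the set of holomorphic functions of finite norm.
\<close>

type_synonym fnorm = "(complex \<Rightarrow> complex) \<Rightarrow> ennreal"

definition fspace :: "fnorm \<Rightarrow> (complex \<Rightarrow> complex) set" where
  "fspace N = {f. f holomorphic_on ball 0 1 \<and> N f < \<infinity>}"

text \<open>Powers with a positive real exponent, with value \<open>\<infinity>\<close> at \<open>\<infinity>\<close>.\<close>

definition epowr :: "ennreal \<Rightarrow> real \<Rightarrow> ennreal" where
  "epowr x a = (if x = \<infinity> then \<infinity> else ennreal (enn2real x powr a))"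

definition maclaurin_coeff :: "(complex \<Rightarrow> complex) \<Rightarrow> nat \<Rightarrow> complex" where
  "maclaurin_coeff f n = (deriv ^^ n) f 0 / fact n"

definition integral_mean :: "real \<Rightarrow> real \<Rightarrow> (complex \<Rightarrow> complex) \<Rightarrow> real" where
  "integral_mean p r f =
     (1 / (2 * pi) * integral {0..2 * pi} (\<lambda>\<theta>. norm (f (rcis r \<theta>)) powr p)) powr (1 / p)"

definition Hardy_norm :: "real \<Rightarrow> fnorm" where
  "Hardy_norm p f = (SUP r\<in>{0<..<1}. ennreal (integral_mean p r f))"

definition Hardy_inf_norm :: fnorm where
  "Hardy_inf_norm f = (SUP r\<in>{0<..<1}. SUP \<theta>\<in>{0..2 * pi}. ennreal (norm (f (rcis r \<theta>))))"

text \<open>The area measure is normalised, \<open>dA = dx dy / \<pi>\<close>.\<close>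

definition Dirichlet_norm :: "real \<Rightarrow> fnorm" where
  "Dirichlet_norm p f = epowr
     ((\<integral>\<^sup>+ z\<in>ball 0 1. ennreal (norm (deriv f z) powr p * (1 - norm z) powr (p - 1) / pi) \<partial>lborel)
        + ennreal (norm (f 0) powr p)) (1 / p)"

definition HL_norm :: "real \<Rightarrow> fnorm" where
  "HL_norm p f = epowr
     (\<Sum>n. ennreal (norm (maclaurin_coeff f n) powr p * real (n + 1) powr (p - 2))) (1 / p)"

definition T_op :: "(complex \<Rightarrow> complex) \<Rightarrow> (complex \<Rightarrow> complex) \<Rightarrow> complex \<Rightarrow> complex" where
  "T_op g f z = contour_integral (linepath 0 z) (\<lambda>\<zeta>. f \<zeta> * deriv g \<zeta>)"

text \<open>
  The following notions are meant for linear operators \<open>T\<close> from \<open>fspace X\<close> to \<open>fspace Y\<close>.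
\<close>

definition bounded_op :: "fnorm \<Rightarrow> fnorm \<Rightarrow> ((complex \<Rightarrow> complex) \<Rightarrow> (complex \<Rightarrow> complex)) \<Rightarrow> bool" where
  "bounded_op X Y T \<longleftrightarrow> (\<forall>f\<in>fspace X. T f \<in> fspace Y) \<and>
     (\<exists>C::real. \<forall>f\<in>fspace X. Y (T f) \<le> ennreal C * X f)"

definition compact_op :: "fnorm \<Rightarrow> fnorm \<Rightarrow> ((complex \<Rightarrow> complex) \<Rightarrow> (complex \<Rightarrow> complex)) \<Rightarrow> bool" where
  "compact_op X Y T \<longleftrightarrow> (\<forall>f\<in>fspace X. T f \<in> fspace Y) \<and>
     (\<forall>F M. (\<forall>n::nat. F n \<in> fspace X \<and> X (F n) \<le> ennreal M) \<longrightarrow>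
        (\<exists>s h. strict_mono s \<and> h \<in> fspace Y \<and>
           (\<lambda>n. Y (\<lambda>z. T (F (s n)) z - h z)) \<longlonglongrightarrow> 0))"

definition op_norm :: "fnorm \<Rightarrow> fnorm \<Rightarrow> ((complex \<Rightarrow> complex) \<Rightarrow> (complex \<Rightarrow> complex)) \<Rightarrow> ennreal" where
  "op_norm X Y T =
     (if bounded_op X Y T then SUP f\<in>{f \<in> fspace X. X f \<le> 1}. Y (T f) else \<infinity>)"

text \<open>
  Only used for \<open>g\<close> with nonnegative real coefficients, so that \<^const>\<open>Re\<close> loses nothing; both
  series have nonnegative terms and may be infinite.
\<close>

definition coeff_series :: "real \<Rightarrow> (complex \<Rightarrow> complex) \<Rightarrow> ennreal" where
  "coeff_series q g = (\<Sum>k. ennreal (real (k + 1) powr (q - 2)) *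
     epowr (\<Sum>n. ennreal (real (n + 1) * Re (maclaurin_coeff g (n + 1)) / real (n + k + 1))) q)"

end

theory Submission
  imports Defs
begin

text \<open>
  Write \<open>h t = g' t\<close> for \<open>0 \<le> t < 1\<close> and let \<open>q\<close> be conjugate to \<open>p\<close>. As \<open>g\<close> has nonnegative coefficients,
  \<open>|g'|\<close> is at most \<open>h t\<close> on the circle of radius \<open>t\<close>, so \<open>|T\<^sub>g f|\<close> is at most the integral of \<open>|f| h\<close>
  along a ray. By Hoelder's inequality the norm of \<open>T\<^sub>g\<close> is bounded by the \<open>L\<^sup>q\<close> norm of \<open>h\<close> as soon as the
  \<open>L\<^sup>p\<close> norm of \<open>f\<close> along rays is bounded by the norm of \<open>f\<close> (for \<open>H\<^sup>p\<close> this is the Fejer-Riesz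
  inequality). Conversely, the Cauchy transform \<open>f z = \<integral> \<phi> t / (1 - t z) dt\<close> of an increasing \<open>\<phi> \<ge> 0\<close> satisfies
  \<open>f \<ge> \<phi> / 2\<close> on \<open>[0, 1)\<close>, and its norm in each of the spaces is bounded by the \<open>L\<^sup>p\<close> norm of \<open>\<phi>\<close>;
  dilates of \<open>h\<close> to the power \<open>q - 1\<close> are the test functions. The inner sums of the coefficient series
  are the moments of \<open>h\<close>, and the same estimates show that the series is comparable to the integral
  of \<open>h\<close> to the power \<open>q\<close>.

  All these estimates are instances of a single one: the kernel \<open>1 / max (X x) (Y y)\<close> is bounded on \<open>L\<^sup>p\<close> for
  measures under which \<open>X \<le> r\<close> and \<open>Y \<le> r\<close> have measure \<open>O(r)\<close>. For compactness, Montel's theorem gives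
  uniform convergence on smaller discs, and the tail of the integral of \<open>h\<close> to the power \<open>q\<close> is small.
\<close>

section \<open>Powers of extended reals and Hoelder's inequality\<close>

text \<open>The three norms enter only through two constants, one from \<open>ray_bounded\<close>
  for the upper estimate and one from \<open>test_bounded\<close> for the lower, so the operator
  part is argued once for all spaces. Values are kept in \<open>ennreal\<close>, so that two
  quantities can be compared before either is known to be finite.

  The max kernel is homogeneous of degree -1 and every size function has exponent 1. This common
  scaling is why [0, 1), the circle, the weighted disc and the weighted integers can be paired with
  each other by one lemma.

  The exponent q - 1 is the equality case of Hoelder's inequality: the norm of the test function and
  its pairing with h are powers of the same integral, which can then be cancelled. Cancelling needs
  a finite integral, and for h itself finiteness is what has to be proved. Dilates have finite
  integrals and are continuous up to 1; a bound uniform in the dilation passes to the limit. No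
  duality of the spaces is invoked: nonnegative coefficients make h increasing, so that positivity
  on the radius replaces it.\<close>

abbreviation enorm :: "'a::real_normed_vector \<Rightarrow> ennreal" where
  "enorm x \<equiv> ennreal (norm x)"

lemma epowr_ennreal: "0 \<le> x \<Longrightarrow> epowr (ennreal x) a = ennreal (x powr a)"
  by (simp add: epowr_def)

lemma epowr_top [simp]: "epowr \<infinity> a = \<infinity>" "epowr top a = \<infinity>"
  by (simp_all add: epowr_def)

lemma epowr_0 [simp]: "epowr 0 a = 0"
  by (simp add: epowr_def)

lemma epowr_one [simp]: "epowr x 1 = x"
  by (cases x) (simp_all add: epowr_ennreal)

lemma epowr_one_left [simp]: "epowr 1 a = 1"
  by (simp add: epowr_def)

lemma epowr_mono: "0 \<le> a \<Longrightarrow> x \<le> y \<Longrightarrow> epowr x a \<le> epowr y a"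
  by (cases x; cases y) (auto simp: epowr_ennreal top_unique intro!: ennreal_leI powr_mono2)

lemma epowr_epowr: "epowr (epowr x a) b = epowr x (a * b)"
  by (cases x) (simp_all add: epowr_ennreal powr_powr)

lemma epowr_eq_0_iff [simp]: "epowr x a = 0 \<longleftrightarrow> x = 0"
proof (cases x)
  case (real r)
  then show ?thesis
    by (auto simp: epowr_ennreal)
qed simp

lemma epowr_eq_top_iff [simp]: "epowr x a = top \<longleftrightarrow> x = top"
  by (cases x) (auto simp: epowr_ennreal)

lemma epowr_mult: "epowr (x * y) a = epowr x a * epowr y a"
proof (cases "x = 0 \<or> y = 0 \<or> x = top \<or> y = top")
  case True
  then show ?thesis by (auto simp: ennreal_mult_top ennreal_top_mult)
next
  case False
  then obtain r s where "x = ennreal r" "y = ennreal s" "0 \<le> r" "0 \<le> s"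
    by (metis ennreal_cases)
  then show ?thesis
    by (simp add: epowr_ennreal powr_mult ennreal_mult[symmetric])
qed

lemma measurable_epowr [measurable]:
  assumes [measurable]: "f \<in> borel_measurable M"
  shows "(\<lambda>x. epowr (f x) a) \<in> borel_measurable M"
  unfolding epowr_def by measurable

lemma conjugate_gt_1:
  fixes p q :: real
  assumes "1 < p" "1 / p + 1 / q = 1"
  shows "1 < q"
proof -
  have "1 / q = 1 - 1 / p" "0 < 1 / p" "1 / p < 1" using assms by (simp_all add: field_simps)
  then have "0 < 1 / q" "1 / q < 1" by linarith+
  then show ?thesis by (simp add: field_simps split: if_splits)
qed

lemma ennreal_Young:
  fixes p q :: real
  assumes "1 < p" "1 / p + 1 / q = 1"
  shows "a * b \<le> ennreal (1 / q) * epowr a q + ennreal (1 / p) * epowr b p"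
proof -
  have q: "1 < q" using conjugate_gt_1 assms by blast
  show ?thesis
  proof (cases "a = top \<or> b = top")
    case True
    then show ?thesis using assms q by (auto simp: ennreal_mult_top)
  next
    case False
    then obtain x y where xy: "a = ennreal x" "b = ennreal y" "0 \<le> x" "0 \<le> y"
      by (metis ennreal_cases)
    have "x * y \<le> x powr q / q + y powr p / p"
      by (rule Youngs_inequality) (use assms q xy in auto)
    then show ?thesis using xy assms q
      by (simp add: epowr_ennreal flip: ennreal_mult'' ennreal_plus) 
  qed
qed

text \<open>Young's inequality, applied to \<open>f\<close> and \<open>g\<close> divided by their
  norms. Integrals equal to 0 or infinity are treated apart because that division fails for them; in
  return no integrability is assumed.\<close>

lemma nn_integral_Holder:
  fixes p q :: real
  assumes pq: "1 < p" "1 / p + 1 / q = 1"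
    and [measurable]: "f \<in> borel_measurable M" "g \<in> borel_measurable M"
  shows "(\<integral>\<^sup>+x. f x * g x \<partial>M) \<le>
           epowr (\<integral>\<^sup>+x. epowr (f x) q \<partial>M) (1 / q) * epowr (\<integral>\<^sup>+x. epowr (g x) p \<partial>M) (1 / p)"
    (is "?L \<le> epowr ?A _ * epowr ?B _")
proof -
  have q: "1 < q" using conjugate_gt_1 pq by blast
  consider "?A = 0 \<or> ?B = 0" | "?A \<noteq> 0" "?B \<noteq> 0" "?A = top \<or> ?B = top"
    | "?A \<noteq> 0" "?B \<noteq> 0" "?A \<noteq> top" "?B \<noteq> top" by blast
  then show ?thesis
  proof cases
    case 1
    then have "AE x in M. f x * g x = 0"
      by (auto simp: nn_integral_0_iff_AE)
    then have "?L = 0" by (simp add: nn_integral_0_iff_AE)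
    then show ?thesis by simp
  next
    case 2
    \<comment> \<open>Neither factor is 0 in this case, so one infinite factor makes the product
      infinite.\<close>
    then have "epowr ?A (1 / q) * epowr ?B (1 / p) = top"
      by (auto simp: ennreal_mult_eq_top_iff)
    then show ?thesis by simp
  next
    case 3
    then obtain a b where ab: "?A = ennreal a" "?B = ennreal b" "0 < a" "0 < b"
      by (metis ennreal_cases ennreal_0 order_le_less)
    define s where "s = a powr (1 / q)"
    define t where "t = b powr (1 / p)"
    have st: "s > 0" "t > 0" "s powr q = a" "t powr p = b"
      using ab q pq by (auto simp: s_def t_def powr_powr)
    have pt: "f x * g x \<le> ennreal (s * t) * (ennreal (1 / q / a) * epowr (f x) q + ennreal (1 / p / b) * epowr (g x) p)" for x
    proof -
      have "f x * g x = ennreal (s * t) * ((ennreal (1/s) * f x) * (ennreal (1/t) * g x))"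
      proof -
        have "ennreal (s * t) * ennreal (1/s) * ennreal (1/t) = 1"
          using st by (simp flip: ennreal_mult'')
        then show ?thesis by (metis (no_types, lifting) mult.assoc mult.commute mult_1)
      qed
      also have "(ennreal (1/s) * f x) * (ennreal (1/t) * g x) \<le>
          ennreal (1 / q) * epowr (ennreal (1/s) * f x) q + ennreal (1 / p) * epowr (ennreal (1/t) * g x) p"
        by (rule ennreal_Young[OF pq])
      also have "\<dots> = ennreal (1 / q / a) * epowr (f x) q + ennreal (1 / p / b) * epowr (g x) p"
        using st ab q pq
        by (simp add: epowr_mult epowr_ennreal powr_divide mult.assoc[symmetric] flip: ennreal_mult'')
      finally show ?thesis by (simp add: mult_left_mono)
    qed
    have "?L \<le> (\<integral>\<^sup>+x. ennreal (s * t) * (ennreal (1 / q / a) * epowr (f x) q + ennreal (1 / p / b) * epowr (g x) p) \<partial>M)"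
      by (intro nn_integral_mono pt)
    also have "\<dots> = ennreal (s * t) * (ennreal (1 / q / a) * ?A + ennreal (1 / p / b) * ?B)"
      by (simp add: nn_integral_cmult nn_integral_add)
    also have "\<dots> = ennreal (s * t)"
    proof -
      have "1 / q / a * a + 1 / p / b * b = 1" using ab pq by (simp add: add.commute)
      then have "ennreal (1 / q / a) * ?A + ennreal (1 / p / b) * ?B = 1"
        using ab q pq by (simp flip: ennreal_mult'' ennreal_plus)
      then show ?thesis by simp
    qed
    also have "\<dots> = epowr ?A (1 / q) * epowr ?B (1 / p)"
      using ab by (simp add: epowr_ennreal s_def t_def flip: ennreal_mult'')
    finally show ?thesis .
  qed
qed

section \<open>The kernel 1 / max (X x) (Y y)\<close>

text \<open>
  For \<open>a > 0\<close> the set where \<open>X\<close> vanishes is null, so the junk value of negative powers at \<open>0\<close> is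
  harmless below.
\<close>

definition regular_measure :: "real \<Rightarrow> real \<Rightarrow> 'a measure \<Rightarrow> ('a \<Rightarrow> real) \<Rightarrow> bool" where
  "regular_measure a C M X \<longleftrightarrow> sigma_finite_measure M \<and> X \<in> borel_measurable M \<and> (\<forall>x\<in>space M. 0 \<le> X x) \<and>
     0 \<le> C \<and> (\<forall>r>0. emeasure M {x \<in> space M. X x \<le> r} \<le> ennreal (C * r powr a))"

lemma regular_measureD:
  assumes "regular_measure a C M X"
  shows "sigma_finite_measure M" "X \<in> borel_measurable M" "\<And>x. x \<in> space M \<Longrightarrow> 0 \<le> X x" "0 \<le> C"
    "\<And>r. r > 0 \<Longrightarrow> emeasure M {x \<in> space M. X x \<le> r} \<le> ennreal (C * r powr a)"
  using assms by (auto simp: regular_measure_def)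

text \<open>Let \<open>r\<close> tend to 0 in the growth bound. Since powers of 0 are 0, cancelling
  a power of \<open>X\<close> against its inverse is only possible off this null set.\<close>

lemma regular_measure_AE_pos:
  assumes R: "regular_measure a C M X" and a: "0 < a"
  shows "AE x in M. 0 < X x"
proof -
  note [measurable] = regular_measureD(2)[OF R]
  have le: "emeasure M {x \<in> space M. X x \<le> 0} \<le> ennreal (C * r powr a)" if "r > 0" for r
  proof -
    have "emeasure M {x \<in> space M. X x \<le> 0} \<le> emeasure M {x \<in> space M. X x \<le> r}"
      using that by (intro emeasure_mono) auto
    then show ?thesis using regular_measureD(5)[OF R that] by (rule order_trans)
  qed
  have lim: "(\<lambda>n. ennreal (C * (1 / real (Suc n)) powr a)) \<longlonglongrightarrow> ennreal (C * 0)"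
  proof (intro tendsto_ennrealI tendsto_mult tendsto_const)
    have "(\<lambda>n. (1 / real (Suc n)) powr a) \<longlonglongrightarrow> 0 powr a"
      using a LIMSEQ_Suc[OF lim_1_over_n[where 'a=real]]
      by (intro tendsto_powr2 tendsto_const always_eventually) auto
    then show "(\<lambda>n. (1 / real (Suc n)) powr a) \<longlonglongrightarrow> 0" using a by simp
  qed
  have "emeasure M {x \<in> space M. X x \<le> 0} \<le> ennreal (C * 0)"
    by (rule LIMSEQ_le_const[OF lim]) (auto intro!: exI[of _ 0] le)
  then have "emeasure M {x \<in> space M. X x \<le> 0} = 0" by simp
  then show ?thesis
    by (intro AE_I[where N="{x \<in> space M. X x \<le> 0}"]) auto
qed

lemma dyadic_bracket:
  fixes y :: real
  assumes "1 \<le> y"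
  obtains j :: nat where "2 ^ j \<le> y" "y < 2 ^ Suc j"
proof -
  have ex: "\<exists>n::nat. y < 2 ^ n" by (rule real_arch_pow) simp
  define n where "n = (LEAST n::nat. y < 2 ^ n)"
  have n: "y < 2 ^ n" unfolding n_def by (rule LeastI_ex[OF ex])
  have "n \<noteq> 0" using n assms by (cases n) auto
  then obtain j where j: "n = Suc j" by (cases n) auto
  have "\<not> y < 2 ^ j" using not_less_Least[of j "\<lambda>n. y < 2 ^ n"] j unfolding n_def by simp
  then show ?thesis using that[of j] n j by auto
qed

lemma suminf_ennreal_geometric:
  fixes A c :: real
  assumes "0 \<le> A" "0 \<le> c" "c < 1"
  shows "(\<Sum>j. ennreal (A * c ^ j)) = ennreal (A / (1 - c))"
proof -
  have "(\<lambda>j. A * c ^ j) sums (A * (1 / (1 - c)))"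
    using assms by (intro sums_mult geometric_sums) auto
  then show ?thesis using assms by (intro suminf_ennreal_eq) auto
qed

lemma ennreal_le_suminf:
  fixes f :: "nat \<Rightarrow> ennreal"
  shows "f j \<le> suminf f"
  using sum_le_suminf[of f "{j}"] by simp

text \<open>This constant and the next are sums of geometric series over dyadic shells: ratio
  \<open>2 powr (s - a)\<close> for shells shrinking towards \<open>X = 0\<close>, ratio
  \<open>2 powr (a - s)\<close> for growing ones.\<close>

definition near_const :: "real \<Rightarrow> real \<Rightarrow> real" where
  "near_const a s = 2 powr s / (1 - 2 powr (s - a))"

definition far_const :: "real \<Rightarrow> real \<Rightarrow> real" where
  "far_const a s = 2 powr a / (1 - 2 powr (a - s))"

lemma two_powr_less_1: "x < 0 \<Longrightarrow> 2 powr x < (1::real)"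
  using powr_less_mono[of x 0 2] by simp

lemma near_const_pos: "s < a \<Longrightarrow> 0 < near_const a s"
  using two_powr_less_1[of "s - a"] by (simp add: near_const_def)

lemma far_const_pos: "a < s \<Longrightarrow> 0 < far_const a s"
  using two_powr_less_1[of "a - s"] by (simp add: far_const_def)

text \<open>The value of \<open>X powr (-s)\<close> at the inner edge of a dyadic shell times the
  growth bound at its outer edge is geometric in \<open>j\<close>. The first identity is for shells
  below \<open>x\<close>, the second for shells above.\<close>

lemma powr_neg_dyadic:
  fixes x :: real
  assumes "x > 0"
  shows "(x / 2 ^ Suc j) powr (-s) * (C * (x / 2 ^ j) powr a) = C * 2 powr s * x powr (a - s) * (2 powr (s - a)) ^ j"
    "(x * 2 ^ j) powr (-s) * (C * (x * 2 ^ Suc j) powr a) = C * 2 powr a * x powr (a - s) * (2 powr (a - s)) ^ j"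
proof -
  have pw: "(2::real) ^ k = 2 powr real k" for k by (simp add: powr_realpow)
  have pp: "(2 powr u) ^ k = 2 powr (u * real k)" for u :: real and k by (simp add: powr_realpow[symmetric] powr_powr)
  show "(x / 2 ^ Suc j) powr (-s) * (C * (x / 2 ^ j) powr a) = C * 2 powr s * x powr (a - s) * (2 powr (s - a)) ^ j"
    using assms unfolding pw pp
    by (simp add: powr_divide powr_mult powr_powr powr_minus powr_diff powr_add ring_distribs divide_simps mult_ac)
  show "(x * 2 ^ j) powr (-s) * (C * (x * 2 ^ Suc j) powr a) = C * 2 powr a * x powr (a - s) * (2 powr (a - s)) ^ j"
    using assms unfolding pw pp
    by (simp add: powr_mult powr_powr powr_minus powr_diff powr_add ring_distribs divide_simps mult_ac)
qed

text \<open>Each shell is enlarged to the sublevel set of its outer radius \<open>\<rho> j\<close>,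
  because only sublevel sets have a known measure. The geometric decay makes this overcounting
  affordable.\<close>

lemma dyadic_sum_bound:
  assumes R: "regular_measure a C M X" and c: "\<And>j. 0 \<le> c j" and \<rho>: "\<And>j. 0 < \<rho> j"
    and F: "\<And>\<omega>. \<omega> \<in> space M \<Longrightarrow> F \<omega> \<le> (\<Sum>j. ennreal (c j) * indicator {\<omega> \<in> space M. X \<omega> \<le> \<rho> j} \<omega>)"
    and geom: "\<And>j. c j * (C * \<rho> j powr a) = A * \<kappa> ^ j" "0 \<le> A" "0 \<le> \<kappa>" "\<kappa> < 1"
  shows "(\<integral>\<^sup>+\<omega>. F \<omega> \<partial>M) \<le> ennreal (A / (1 - \<kappa>))"
proof -
  note [measurable] = regular_measureD(2)[OF R]
  have "(\<integral>\<^sup>+\<omega>. F \<omega> \<partial>M) \<le> (\<integral>\<^sup>+\<omega>. (\<Sum>j. ennreal (c j) * indicator {\<omega> \<in> space M. X \<omega> \<le> \<rho> j} \<omega>) \<partial>M)"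
    by (intro nn_integral_mono F)
  also have "\<dots> = (\<Sum>j. \<integral>\<^sup>+\<omega>. ennreal (c j) * indicator {\<omega> \<in> space M. X \<omega> \<le> \<rho> j} \<omega> \<partial>M)"
    by (intro nn_integral_suminf) measurable
  also have "\<dots> = (\<Sum>j. ennreal (c j) * emeasure M {\<omega> \<in> space M. X \<omega> \<le> \<rho> j})"
    by (simp add: nn_integral_cmult)
  also have "\<dots> \<le> (\<Sum>j. ennreal (A * \<kappa> ^ j))"
  proof (intro suminf_le summableI)
    fix j
    have "ennreal (c j) * emeasure M {\<omega> \<in> space M. X \<omega> \<le> \<rho> j} \<le> ennreal (c j) * ennreal (C * \<rho> j powr a)"
      using \<rho> by (intro mult_left_mono regular_measureD(5)[OF R]) auto
    also have "\<dots> = ennreal (A * \<kappa> ^ j)"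
      unfolding geom(1)[symmetric] using c regular_measureD(4)[OF R] by (intro ennreal_mult[symmetric]) auto
    finally show "ennreal (c j) * emeasure M {\<omega> \<in> space M. X \<omega> \<le> \<rho> j} \<le> ennreal (A * \<kappa> ^ j)" .
  qed
  also have "\<dots> = ennreal (A / (1 - \<kappa>))" by (rule suminf_ennreal_geometric[OF geom(2-4)])
  finally show ?thesis .
qed

text \<open>Cut \<open>X \<le> x\<close> into the shells between \<open>x / 2 ^ Suc j\<close> and
  \<open>x / 2 ^ j\<close>. The integrand grows towards \<open>X = 0\<close> while the measure
  shrinks, and \<open>s < a\<close> lets the measure win.\<close>

lemma regular_measure_near:
  assumes R: "regular_measure a C M X" and s: "0 \<le> s" "s < a" and x: "0 < x"
  shows "(\<integral>\<^sup>+\<omega>. ennreal (X \<omega> powr (-s)) * indicator {\<omega>\<in>space M. X \<omega> \<le> x} \<omega> \<partial>M) \<le>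
           ennreal (C * near_const a s * x powr (a - s))"
proof -
  let ?g = "\<lambda>j \<omega>. ennreal ((x / 2 ^ Suc j) powr (-s)) * indicator {\<omega>\<in>space M. X \<omega> \<le> x / 2 ^ j} \<omega>"
  have "ennreal (X \<omega> powr (-s)) * indicator {\<omega>\<in>space M. X \<omega> \<le> x} \<omega> \<le> (\<Sum>j. ?g j \<omega>)" if "\<omega> \<in> space M" for \<omega>
  proof (cases "0 < X \<omega> \<and> X \<omega> \<le> x")
    case True
    then have "1 \<le> x / X \<omega>" by simp
    then obtain j where j: "2 ^ j \<le> x / X \<omega>" "x / X \<omega> < 2 ^ Suc j" by (rule dyadic_bracket)
    have 1: "X \<omega> \<le> x / 2 ^ j" "x / 2 ^ Suc j \<le> X \<omega>" using j True by (simp_all add: field_simps)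
    have "X \<omega> powr (-s) \<le> (x / 2 ^ Suc j) powr (-s)"
      using 1(2) s x by (intro powr_mono2') auto
    then have "ennreal (X \<omega> powr (-s)) * indicator {\<omega>\<in>space M. X \<omega> \<le> x} \<omega> \<le> ?g j \<omega>"
      using 1 that by (auto intro!: ennreal_leI split: split_indicator)
    also have "\<dots> \<le> (\<Sum>j. ?g j \<omega>)" by (rule ennreal_le_suminf)
    finally show ?thesis .
  next
    case False
    \<comment> \<open>At \<open>X = 0\<close> the power is 0 by convention; beyond \<open>x\<close>
      the indicator is 0.\<close>
    then show ?thesis using regular_measureD(3)[OF R that] by (cases "X \<omega> = 0") (auto split: split_indicator)
  qed
  from dyadic_sum_bound[OF R _ _ this powr_neg_dyadic(1)[OF x]] show ?thesis
    using s x regular_measureD(4)[OF R] two_powr_less_1[of "s - a"] by (simp add: near_const_def mult_ac)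
qed

text \<open>The same decomposition upwards, into shells between \<open>x * 2 ^ j\<close> and
  \<open>x * 2 ^ Suc j\<close>; now \<open>a < s\<close> makes the series converge.\<close>

lemma regular_measure_far:
  assumes R: "regular_measure a C M X" and s: "0 < a" "a < s" and x: "0 < x"
  shows "(\<integral>\<^sup>+\<omega>. ennreal (X \<omega> powr (-s)) * indicator {\<omega>\<in>space M. x < X \<omega>} \<omega> \<partial>M) \<le>
           ennreal (C * far_const a s * x powr (a - s))"
proof -
  let ?g = "\<lambda>j \<omega>. ennreal ((x * 2 ^ j) powr (-s)) * indicator {\<omega>\<in>space M. X \<omega> \<le> x * 2 ^ Suc j} \<omega>"
  have "ennreal (X \<omega> powr (-s)) * indicator {\<omega>\<in>space M. x < X \<omega>} \<omega> \<le> (\<Sum>j. ?g j \<omega>)" if "\<omega> \<in> space M" for \<omega>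
  proof (cases "x < X \<omega>")
    case True
    then have "1 \<le> X \<omega> / x" using x by simp
    then obtain j where j: "2 ^ j \<le> X \<omega> / x" "X \<omega> / x < 2 ^ Suc j" by (rule dyadic_bracket)
    have 1: "X \<omega> \<le> x * 2 ^ Suc j" "x * 2 ^ j \<le> X \<omega>" using j x by (simp_all add: field_simps)
    have "X \<omega> powr (-s) \<le> (x * 2 ^ j) powr (-s)"
      using 1(2) s x by (intro powr_mono2') auto
    then have "ennreal (X \<omega> powr (-s)) * indicator {\<omega>\<in>space M. x < X \<omega>} \<omega> \<le> ?g j \<omega>"
      using 1 that by (auto intro!: ennreal_leI split: split_indicator)
    also have "\<dots> \<le> (\<Sum>j. ?g j \<omega>)" by (rule ennreal_le_suminf)
    finally show ?thesis .
  qed auto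
  from dyadic_sum_bound[OF R _ _ this powr_neg_dyadic(2)[OF x]] show ?thesis
    using s x regular_measureD(4)[OF R] two_powr_less_1[of "a - s"] by (simp add: far_const_def mult_ac)
qed

definition test_const :: "real \<Rightarrow> real" where
  "test_const s = near_const 1 s + far_const 1 (s + 1)"

lemma test_const_pos: "0 < s \<Longrightarrow> s < 1 \<Longrightarrow> 0 < test_const s"
  by (simp add: test_const_def near_const_pos far_const_pos add_pos_pos)

text \<open>Below \<open>x\<close> the kernel is \<open>1 / x\<close>, and \<open>s < 1\<close>
  makes the power integrable near 0. Above \<open>x\<close> the kernel adds one to the exponent, and
  \<open>s + 1 > 1\<close> makes it integrable at infinity. Homogeneity returns the same power of
  \<open>x\<close>, as Schur's test requires.\<close>

lemma max_kernel_test: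
  assumes R: "regular_measure 1 C M X" and s: "0 < s" "s < 1" and x: "0 < x"
  shows "(\<integral>\<^sup>+\<omega>. ennreal (1 / max x (X \<omega>) * X \<omega> powr (-s)) \<partial>M) \<le> ennreal (C * test_const s * x powr (-s))"
proof -
  note [measurable] = regular_measureD(2)[OF R]
  have "(\<integral>\<^sup>+\<omega>. ennreal (1 / max x (X \<omega>) * X \<omega> powr (-s)) \<partial>M) \<le>
     (\<integral>\<^sup>+\<omega>. ennreal (1 / x) * (ennreal (X \<omega> powr (-s)) * indicator {\<omega>\<in>space M. X \<omega> \<le> x} \<omega>) +
        ennreal (X \<omega> powr (-(s+1))) * indicator {\<omega>\<in>space M. x < X \<omega>} \<omega> \<partial>M)"
  proof (intro nn_integral_mono)
    fix \<omega> assume w: "\<omega> \<in> space M"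
    show "ennreal (1 / max x (X \<omega>) * X \<omega> powr (-s)) \<le>
       ennreal (1 / x) * (ennreal (X \<omega> powr (-s)) * indicator {\<omega>\<in>space M. X \<omega> \<le> x} \<omega>) +
        ennreal (X \<omega> powr (-(s+1))) * indicator {\<omega>\<in>space M. x < X \<omega>} \<omega>"
    proof (cases "X \<omega> \<le> x")
      case True
      then show ?thesis using w x by (simp add: ennreal_mult[symmetric])
    next
      case False
      then have "1 / X \<omega> * X \<omega> powr (-s) = X \<omega> powr (-(s+1))"
        using x False powr_add[of "X \<omega>" "- s" "-1"] by (simp add: powr_minus_divide add.commute)
      then show ?thesis using False w x by simp
    qed
  qed
  also have "\<dots> = ennreal (1 / x) * (\<integral>\<^sup>+\<omega>. ennreal (X \<omega> powr (-s)) * indicator {\<omega>\<in>space M. X \<omega> \<le> x} \<omega> \<partial>M) +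
      (\<integral>\<^sup>+\<omega>. ennreal (X \<omega> powr (-(s+1))) * indicator {\<omega>\<in>space M. x < X \<omega>} \<omega> \<partial>M)"
    by (subst nn_integral_add; (subst nn_integral_cmult)?) measurable
  also have "\<dots> \<le> ennreal (1 / x) * ennreal (C * near_const 1 s * x powr (1 - s)) +
      ennreal (C * far_const 1 (s+1) * x powr (1 - (s+1)))"
    using s x by (intro add_mono mult_left_mono regular_measure_near[OF R] regular_measure_far[OF R]) auto
  also have "\<dots> = ennreal (C * test_const s * x powr (-s))"
  proof -
    have "1 / x * x powr (1 - s) = x powr (-s)" using x by (simp add: powr_diff powr_minus field_simps)
    moreover have "1 / x * (C * near_const 1 s * x powr (1 - s)) = C * near_const 1 s * (1 / x * x powr (1 - s))"
      by (simp only: mult_ac)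
    ultimately have "1 / x * (C * near_const 1 s * x powr (1 - s)) = C * near_const 1 s * x powr (-s)" by (simp only:)
    moreover have "x powr (1 - (s+1)) = x powr (-s)" by simp
    ultimately show ?thesis
      using s x regular_measureD(4)[OF R] near_const_pos[of s 1] far_const_pos[of 1 "s+1"]
      by (simp add: test_const_def ennreal_mult''[symmetric] ennreal_plus[symmetric] ring_distribs del: ennreal_plus)
  qed
  finally show ?thesis .
qed

text \<open>The two integrals of Schur's test: the inner one, with exponent \<open>1 / p\<close>,
  enters through Hoelder's inequality and is raised to \<open>p / q = p - 1\<close>; the outer one
  has exponent \<open>1 / q = 1 - 1 / p\<close>.\<close>

definition max_kernel_const :: "real \<Rightarrow> real \<Rightarrow> real" where
  "max_kernel_const p C = (C * test_const (1 / p)) powr (p - 1) * (C * test_const (1 - 1 / p))"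

lemma max_kernel_const_pos: "1 < p \<Longrightarrow> 0 < C \<Longrightarrow> 0 < max_kernel_const p C"
  using test_const_pos[of "1 / p"] test_const_pos[of "1 - 1 / p"] by (simp add: max_kernel_const_def)

text \<open>
  Schur's test with the weights \<open>X\<close> and \<open>Y\<close> to the power \<open>-1 / (p q)\<close>, where \<open>q\<close> is conjugate to \<open>p\<close>.
\<close>

lemma max_kernel_bounded:
  fixes F :: "'b \<Rightarrow> ennreal"
  assumes p: "1 < p" and RM: "regular_measure 1 C M X" and RN: "regular_measure 1 C N Y"
    and F[measurable]: "F \<in> borel_measurable N"
  shows "(\<integral>\<^sup>+x. epowr (\<integral>\<^sup>+y. ennreal (1 / max (X x) (Y y)) * F y \<partial>N) p \<partial>M) \<le>
           ennreal (max_kernel_const p C) * (\<integral>\<^sup>+y. epowr (F y) p \<partial>N)"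
proof -
  note [measurable] = regular_measureD(2)[OF RM] regular_measureD(2)[OF RN]
  interpret M: sigma_finite_measure M by (rule regular_measureD(1)[OF RM])
  interpret N: sigma_finite_measure N by (rule regular_measureD(1)[OF RN])
  interpret pair_sigma_finite M N ..
  define q where "q = p / (p - 1)"
  have q: "1 / p + 1 / q = 1" "1 < q" "p / q = p - 1" "1 / q = 1 - 1 / p"
    using p by (auto simp: q_def field_simps)
  define k where "k x y = 1 / max (X x) (Y y)" for x y
  have k0: "0 \<le> k x y" if "x \<in> space M" for x y
    using regular_measureD(3)[OF RM that] by (simp add: k_def)
  define A where "A = C * test_const (1 / p)"
  define B where "B = C * test_const (1 - 1 / p)"
  have AB: "0 \<le> A" "0 \<le> B"
    using p regular_measureD(4)[OF RM] test_const_pos[of "1 / p"] test_const_pos[of "1 - 1 / p"] by (auto simp: A_def B_def)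
  have k_m [measurable]: "(\<lambda>(x,y). k x y) \<in> borel_measurable (M \<Otimes>\<^sub>M N)"
    unfolding k_def by measurable
  have km2 [measurable]: "(\<lambda>y. k x y) \<in> borel_measurable N" if "x \<in> space M" for x
    using k_m that by simp
  have Mpos: "AE x in M. 0 < X x" and Npos: "AE y in N. 0 < Y y"
    using regular_measure_AE_pos[OF RM] regular_measure_AE_pos[OF RN] by auto
  let ?J = "\<lambda>x. \<integral>\<^sup>+y. ennreal (k x y * Y y powr (1 / q)) * epowr (F y) p \<partial>N"
  have step: "epowr (\<integral>\<^sup>+y. ennreal (k x y) * F y \<partial>N) p \<le> ennreal (A powr (p - 1) * X x powr (- (1 / q))) * ?J x"
    if x: "x \<in> space M" "0 < X x" for x
  proof -
    note [measurable] = km2[OF x(1)]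
    \<comment> \<open>The kernel is shared out as \<open>k powr (1/q)\<close> and
      \<open>k powr (1/p)\<close>, and a power of \<open>Y\<close> is inserted together with its
      inverse, chosen so that the first Hoelder factor becomes the test integral of exponent
      \<open>1 / p\<close>.\<close>
    have "(\<integral>\<^sup>+y. ennreal (k x y) * F y \<partial>N) =
        (\<integral>\<^sup>+y. ennreal (k x y powr (1/q) * Y y powr (-(1/(p*q)))) * (ennreal (k x y powr (1/p) * Y y powr (1/(p*q))) * F y) \<partial>N)"
    proof (intro nn_integral_cong_AE, use Npos in eventually_elim)
      case (elim y)
      have "k x y powr (1/q) * Y y powr (-(1/(p*q))) * (k x y powr (1/p) * Y y powr (1/(p*q))) = k x y"
      proof -
        have kp: "0 < k x y" using x elim by (simp add: k_def)
        have "k x y powr (1/q) * k x y powr (1/p) = k x y"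
          using kp q by (simp add: powr_add[symmetric] add.commute)
        moreover have "Y y powr (-(1/(p*q))) * Y y powr (1/(p*q)) = 1"
          using elim by (simp add: powr_add[symmetric])
        ultimately show ?thesis by (metis (no_types, lifting) mult.assoc mult.commute mult.right_neutral)
      qed
      then show ?case
        by (simp add: mult.assoc[symmetric] ennreal_mult[symmetric])
    qed
    also have "\<dots> \<le> epowr (\<integral>\<^sup>+y. epowr (ennreal (k x y powr (1/q) * Y y powr (-(1/(p*q))))) q \<partial>N) (1/q) *
        epowr (\<integral>\<^sup>+y. epowr (ennreal (k x y powr (1/p) * Y y powr (1/(p*q))) * F y) p \<partial>N) (1/p)"
      by (rule nn_integral_Holder[OF p q(1)]) measurable
    also have "(\<integral>\<^sup>+y. epowr (ennreal (k x y powr (1/q) * Y y powr (-(1/(p*q))))) q \<partial>N) =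
        (\<integral>\<^sup>+y. ennreal (1 / max (X x) (Y y) * Y y powr (-(1/p))) \<partial>N)"
      using q(2) k0[OF x(1)] by (simp add: epowr_ennreal powr_mult powr_powr k_def[symmetric])
    also have "(\<integral>\<^sup>+y. epowr (ennreal (k x y powr (1/p) * Y y powr (1/(p*q))) * F y) p \<partial>N) = ?J x"
      using p q k0[OF x(1)] by (simp add: epowr_mult epowr_ennreal powr_mult powr_powr)
    finally have "epowr (\<integral>\<^sup>+y. ennreal (k x y) * F y \<partial>N) p \<le>
        epowr (epowr (\<integral>\<^sup>+y. ennreal (1 / max (X x) (Y y) * Y y powr (-(1/p))) \<partial>N) (1/q) * epowr (?J x) (1/p)) p"
      using p by (intro epowr_mono) auto
    also have "\<dots> = epowr (\<integral>\<^sup>+y. ennreal (1 / max (X x) (Y y) * Y y powr (-(1/p))) \<partial>N) (p - 1) * ?J x"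
      using p q(3) by (simp add: epowr_mult epowr_epowr)
    also have "\<dots> \<le> epowr (ennreal (A * X x powr (-(1/p)))) (p - 1) * ?J x"
      using p x unfolding A_def by (intro mult_right_mono epowr_mono max_kernel_test[OF RN]) auto
    also have "epowr (ennreal (A * X x powr (-(1/p)))) (p - 1) = ennreal (A powr (p - 1) * X x powr (- (1 / q)))"
    proof -
      have "- (1 / p) * (p - 1) = - (1 / q)" using p q(4) by (simp add: field_simps)
      then show ?thesis using AB by (simp add: epowr_ennreal powr_mult powr_powr)
    qed
    finally show ?thesis .
  qed
  have "(\<integral>\<^sup>+x. epowr (\<integral>\<^sup>+y. ennreal (k x y) * F y \<partial>N) p \<partial>M) \<le>
      (\<integral>\<^sup>+x. ennreal (A powr (p - 1) * X x powr (- (1 / q))) * ?J x \<partial>M)"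
    by (intro nn_integral_mono_AE) (use Mpos AE_space in eventually_elim, simp add: step)
  also have "\<dots> = (\<integral>\<^sup>+x. \<integral>\<^sup>+y. ennreal (A powr (p - 1) * X x powr (- (1 / q))) * (ennreal (k x y * Y y powr (1 / q)) * epowr (F y) p) \<partial>N \<partial>M)"
    by (intro nn_integral_cong nn_integral_cmult[symmetric]) measurable
  \<comment> \<open>After the exchange the inner integral is again a test integral, now in
    \<open>x\<close> with exponent \<open>1 / q\<close>, and its value cancels the factor
    \<open>Y y powr (1 / q)\<close>.\<close>
  also have "\<dots> = (\<integral>\<^sup>+y. \<integral>\<^sup>+x. ennreal (A powr (p - 1) * X x powr (- (1 / q))) * (ennreal (k x y * Y y powr (1 / q)) * epowr (F y) p) \<partial>M \<partial>N)"
    by (rule Fubini'[symmetric]) measurable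
  also have "\<dots> \<le> (\<integral>\<^sup>+y. ennreal (A powr (p - 1) * B) * epowr (F y) p \<partial>N)"
  proof (intro nn_integral_mono_AE, use Npos AE_space in eventually_elim)
    case (elim y)
    have "(\<integral>\<^sup>+x. ennreal (A powr (p - 1) * X x powr (- (1 / q))) * (ennreal (k x y * Y y powr (1 / q)) * epowr (F y) p) \<partial>M)
      = (\<integral>\<^sup>+x. (ennreal (A powr (p - 1) * Y y powr (1 / q)) * epowr (F y) p) * ennreal (1 / max (Y y) (X x) * X x powr (- (1 / q))) \<partial>M)"
    proof (intro nn_integral_cong)
      fix x assume "x \<in> space M"
      then have e: "ennreal (A powr (p - 1) * X x powr (- (1 / q))) * ennreal (k x y * Y y powr (1 / q)) =
          ennreal (A powr (p - 1) * Y y powr (1 / q)) * ennreal (1 / max (Y y) (X x) * X x powr (- (1 / q)))"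
        using elim regular_measureD(3)[OF RM] by (simp add: k_def ennreal_mult[symmetric] max.commute mult_ac)
      have "a * (b * f) = c * f * d" if "a * b = c * d" for a b c d f :: ennreal
        using that by (metis mult.assoc mult.commute)
      from this[OF e] show "ennreal (A powr (p - 1) * X x powr (- (1 / q))) * (ennreal (k x y * Y y powr (1 / q)) * epowr (F y) p) =
        (ennreal (A powr (p - 1) * Y y powr (1 / q)) * epowr (F y) p) * ennreal (1 / max (Y y) (X x) * X x powr (- (1 / q)))" .
    qed
    also have "\<dots> = (ennreal (A powr (p - 1) * Y y powr (1 / q)) * epowr (F y) p) * (\<integral>\<^sup>+x. ennreal (1 / max (Y y) (X x) * X x powr (- (1 / q))) \<partial>M)"
      by (intro nn_integral_cmult) measurable
    also have "\<dots> \<le> (ennreal (A powr (p - 1) * Y y powr (1 / q)) * epowr (F y) p) * ennreal (B * Y y powr (- (1 / q)))"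
      unfolding B_def q(4)[symmetric] using elim p q by (intro mult_left_mono max_kernel_test[OF RM]) auto
    also have "\<dots> = ennreal (A powr (p - 1) * B) * epowr (F y) p"
    proof -
      have "A powr (p - 1) * Y y powr (1 / q) * (B * Y y powr (- (1 / q))) = A powr (p - 1) * B * (Y y powr (1/q) * Y y powr (- (1/q)))"
        by (simp only: mult_ac)
      also have "Y y powr (1/q) * Y y powr (- (1/q)) = 1" using elim by (simp add: powr_add[symmetric])
      finally have e: "ennreal (A powr (p - 1) * Y y powr (1 / q)) * ennreal (B * Y y powr (- (1 / q))) = ennreal (A powr (p - 1) * B)"
        using AB by (simp add: ennreal_mult[symmetric])
      then show ?thesis by (metis mult.assoc mult.commute)
    qed
    finally show ?case .
  qed
  also have "\<dots> = ennreal (A powr (p - 1) * B) * (\<integral>\<^sup>+y. epowr (F y) p \<partial>N)"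
    by (intro nn_integral_cmult) measurable
  finally show ?thesis by (simp add: k_def max_kernel_const_def A_def B_def)
qed

section \<open>Four regular measures\<close>

abbreviation unit_interval :: "real measure" where
  "unit_interval \<equiv> restrict_space lborel {0..<1}"

abbreviation full_turn :: "real measure" where
  "full_turn \<equiv> restrict_space lborel {0..2 * pi}"

abbreviation unit_integral :: "(real \<Rightarrow> ennreal) \<Rightarrow> ennreal" (binder "\<integral>\<^sub>I" 10) where
  "unit_integral f \<equiv> nn_integral unit_interval f"

abbreviation turn_integral :: "(real \<Rightarrow> ennreal) \<Rightarrow> ennreal" (binder "\<integral>\<^sub>T" 10) where
  "turn_integral f \<equiv> nn_integral full_turn f"

lemma sigma_finite_restrict_lborel:
  "A \<in> sets borel \<Longrightarrow> sigma_finite_measure (restrict_space lborel A)"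
  by (rule sigma_finite_measure_restrict_space) (auto intro: lborel.sigma_finite_measure_axioms)

lemma regular_unit_interval: "regular_measure 1 1 unit_interval (\<lambda>t. 1 - t)"
  unfolding regular_measure_def
proof (intro conjI allI impI ballI sigma_finite_restrict_lborel)
  fix r :: real assume r: "r > 0"
  have "emeasure unit_interval {x \<in> space unit_interval. 1 - x \<le> r} = emeasure lborel {x \<in> space unit_interval. 1 - x \<le> r}"
    by (rule emeasure_restrict_space) (auto simp: space_restrict_space)
  also have "\<dots> \<le> emeasure lborel {1 - r..1}"
    by (intro emeasure_mono) (auto simp: space_restrict_space)
  finally show "emeasure unit_interval {x \<in> space unit_interval. 1 - x \<le> r} \<le> ennreal (1 * r powr 1)"
    using r by simp
qed (auto simp: space_restrict_space intro!: measurable_restrict_space1)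

text \<open>With this density the tail \<open>k + 1 \<ge> 1 / r\<close> has mass of order
  \<open>r\<close>, so that \<open>1 / (k + 1)\<close> is a size function of exponent 1. The weight
  \<open>(k + 1) powr (p - 2)\<close> of \<open>HL_norm\<close> is this density times
  \<open>(k + 1) powr p\<close>.\<close>

definition inv_square_weight :: "nat measure" where
  "inv_square_weight = density (count_space UNIV) (\<lambda>k. ennreal (1 / (real (k + 1))\<^sup>2))"

lemma sets_inv_square_weight [simp, measurable_cong]: "sets inv_square_weight = sets (count_space UNIV)"
  by (simp add: inv_square_weight_def)

lemma space_inv_square_weight [simp]: "space inv_square_weight = UNIV"
  by (simp add: inv_square_weight_def)

lemma nn_integral_inv_square_weight:
  "(\<integral>\<^sup>+k. f k \<partial>inv_square_weight) = (\<Sum>k. ennreal (1 / (real (k + 1))\<^sup>2) * f k)"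
  by (simp add: inv_square_weight_def nn_integral_density nn_integral_count_space_nat)

text \<open>The sublevel set lies in a tail \<open>k \<ge> m\<close>, and the tail of the inverse
  squares telescopes after the comparison \<open>1 / a ^ 2 \<le> 2 / (a * (a + 1))\<close> for
  \<open>a \<ge> 1\<close>, which is the origin of the constant 2.\<close>

lemma regular_inv_square_weight: "regular_measure 1 2 inv_square_weight (\<lambda>k. 1 / real (k + 1))"
  unfolding regular_measure_def
proof (intro conjI allI impI ballI)
  interpret c: sigma_finite_measure "count_space (UNIV :: nat set)"
    by (rule sigma_finite_measure_count_space_countable) auto
  show "sigma_finite_measure inv_square_weight"
    unfolding inv_square_weight_def by (subst c.sigma_finite_iff_density_finite) auto
  show "(\<lambda>k. 1 / real (k + 1)) \<in> borel_measurable inv_square_weight" by simp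
  fix r :: real assume r: "r > 0"
  have ex: "\<exists>n. 1 / real (n + 1) \<le> r"
    using reals_Archimedean[OF r] by (auto simp: inverse_eq_divide intro!: less_imp_le)
  define m where "m = (LEAST n. 1 / real (n + 1) \<le> r)"
  have m: "1 / real (m + 1) \<le> r" unfolding m_def by (rule LeastI_ex[OF ex])
  have mle: "m \<le> n" if "1 / real (n + 1) \<le> r" for n unfolding m_def using that by (rule Least_le)
  have "emeasure inv_square_weight {x \<in> space inv_square_weight. 1 / real (x + 1) \<le> r} =
      (\<Sum>k. ennreal (1 / (real (k + 1))\<^sup>2) * indicator {x. 1 / real (x + 1) \<le> r} k)"
    by (subst nn_integral_indicator[symmetric], simp) (simp add: nn_integral_inv_square_weight)
  also have "\<dots> = (\<Sum>k. ennreal (1 / (real (k + m + 1))\<^sup>2) * indicator {x. 1 / real (x + 1) \<le> r} (k + m))"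
  proof -
    have "(\<Sum>k<m. ennreal (1 / (real (k + 1))\<^sup>2) * indicator {x. 1 / real (x + 1) \<le> r} k) = 0"
      using mle by (intro sum.neutral) (force split: split_indicator)
    then show ?thesis by (subst suminf_offset[where i=m]) (simp_all add: summableI)
  qed
  also have "\<dots> \<le> (\<Sum>k. ennreal (2 / real (k + m + 1) - 2 / real (Suc k + m + 1)))"
  proof (intro suminf_le summableI)
    fix k
    have "1 / (real (k + m + 1))\<^sup>2 \<le> 2 / real (k + m + 1) - 2 / real (Suc k + m + 1)"
    proof -
      define a where "a = real (k + m + 1)"
      have "1 \<le> a" by (simp add: a_def)
      then have "1 / a\<^sup>2 \<le> 2 / (a * (a + 1))"
        by (simp add: divide_simps power2_eq_square)
      also have "\<dots> = 2 / a - 2 / (a + 1)" using \<open>1 \<le> a\<close> by (simp add: field_simps)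
      finally show ?thesis by (simp add: a_def add_ac)
    qed
    then show "ennreal (1 / (real (k + m + 1))\<^sup>2) * indicator {x. 1 / real (x + 1) \<le> r} (k + m) \<le>
        ennreal (2 / real (k + m + 1) - 2 / real (Suc k + m + 1))"
      by (auto split: split_indicator intro!: ennreal_leI)
  qed
  also have "\<dots> = ennreal (2 / real (m + 1))"
  proof (rule suminf_ennreal_eq)
    have "(\<lambda>k. 2 / real (k + m + 1) - 2 / real (Suc k + m + 1)) sums (2 / real (0 + m + 1) - 0)"
    proof (rule telescope_sums')
      have "(\<lambda>n. 2 * (1 / real (n + (m + 1)))) \<longlonglongrightarrow> 2 * 0"
        by (intro tendsto_mult tendsto_const LIMSEQ_ignore_initial_segment lim_1_over_n)
      then show "(\<lambda>k. 2 / real (k + m + 1)) \<longlonglongrightarrow> 0" by (simp add: add.assoc)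
    qed
    then show "(\<lambda>k. 2 / real (k + m + 1) - 2 / real (Suc k + m + 1)) sums (2 / real (m + 1))" by simp
  qed (simp add: field_simps)
  also have "\<dots> \<le> ennreal (2 * r powr 1)" using m r by (intro ennreal_leI) simp
  finally show "emeasure inv_square_weight {x \<in> space inv_square_weight. 1 / real (x + 1) \<le> r} \<le> ennreal (2 * r powr 1)" .
qed auto

text \<open>With \<open>u = x / 2\<close> the right-hand side is
  \<open>2 * \<bar>sin u\<bar>\<close>. As \<open>\<bar>u\<bar> \<le> 2\<close>, the Taylor error
  \<open>\<bar>u\<bar> ^ 3 / 6\<close> is at most two thirds of \<open>\<bar>u\<bar>\<close>, so a
  third of \<open>\<bar>u\<bar>\<close> survives.\<close>

lemma norm_1_minus_cis_ge:
  assumes "\<bar>x\<bar> \<le> pi"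
  shows "\<bar>x\<bar> / 3 \<le> norm (1 - cis x)"
proof -
  define u where "u = x / 2"
  have u: "\<bar>u\<bar> \<le> 2" using assms pi_less_4 by (simp add: u_def)
  have "\<bar>sin u - (\<Sum>m<3. sin_coeff m * u ^ m)\<bar> \<le> inverse (fact 3) * \<bar>u\<bar> ^ 3"
    by (rule Maclaurin_sin_bound)
  then have "\<bar>sin u - u\<bar> \<le> \<bar>u\<bar> ^ 3 / 6"
    by (simp add: eval_nat_numeral sin_coeff_def field_simps)
  moreover have "\<bar>u\<bar> ^ 3 \<le> \<bar>u\<bar> * 4"
  proof -
    have "\<bar>u\<bar>\<^sup>2 \<le> 2\<^sup>2" using u by (intro power_mono) auto
    then have "\<bar>u\<bar> * \<bar>u\<bar>\<^sup>2 \<le> \<bar>u\<bar> * 4" by (intro mult_left_mono) auto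
    then show ?thesis by (simp add: eval_nat_numeral)
  qed
  ultimately have "\<bar>u\<bar> / 3 \<le> \<bar>sin u\<bar>" by linarith
  moreover have "norm (1 - cis x) = 2 * \<bar>sin u\<bar>"
    using dist_exp_i_1[of x] by (simp add: cis_conv_exp u_def norm_minus_commute)
  ultimately show ?thesis by (simp add: u_def)
qed

lemma unimodular_cis:
  assumes "norm \<zeta> = 1"
  obtains \<beta> where "0 \<le> \<beta>" "\<beta> < 2 * pi" "\<zeta> = cis (- \<beta>)"
proof -
  have "norm (inverse \<zeta>) = 1" using assms by (simp add: norm_inverse)
  then have e: "inverse \<zeta> = exp (\<i> * of_real (Arg2pi (inverse \<zeta>)))" using Arg2pi_eq[of "inverse \<zeta>"] by simp
  then have "\<zeta> = inverse (cis (Arg2pi (inverse \<zeta>)))"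
    by (metis cis_conv_exp inverse_inverse_eq)
  then show ?thesis using that[of "Arg2pi (inverse \<zeta>)"] Arg2pi[of "inverse \<zeta>"] by simp
qed

lemma regular_full_turn:
  assumes z: "norm \<zeta> = 1"
  shows "regular_measure 1 18 full_turn (\<lambda>\<theta>. norm (1 - cis \<theta> * \<zeta>))"
  unfolding regular_measure_def
proof (intro conjI allI impI ballI sigma_finite_restrict_lborel)
  have "(\<lambda>\<theta>. norm (1 - cis \<theta> * \<zeta>)) \<in> borel_measurable borel"
    by (intro borel_measurable_continuous_onI continuous_intros)
  then show "(\<lambda>\<theta>. norm (1 - cis \<theta> * \<zeta>)) \<in> borel_measurable full_turn"
    by (simp add: measurable_restrict_space1)
  obtain \<beta> where b: "0 \<le> \<beta>" "\<beta> < 2 * pi" "\<zeta> = cis (- \<beta>)" using unimodular_cis[OF z] .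
  fix r :: real assume r: "r > 0"
  \<comment> \<open>The distance on the circle may be realised across an end of
    \<open>{0..2 * pi}\<close>, hence three translates of one interval. Each has length
    \<open>6 * r\<close>, which gives the constant 18.\<close>
  let ?I = "\<lambda>j. {\<beta> + 2 * pi * j - 3 * r..\<beta> + 2 * pi * j + 3 * r}"
  have sub: "{x \<in> space full_turn. norm (1 - cis x * \<zeta>) \<le> r} \<subseteq> ?I 0 \<union> ?I 1 \<union> ?I (-1)"
  proof
    fix x assume "x \<in> {x \<in> space full_turn. norm (1 - cis x * \<zeta>) \<le> r}"
    then have x: "0 \<le> x" "x \<le> 2 * pi" "norm (1 - cis (x - \<beta>)) \<le> r"
      by (auto simp: space_restrict_space b cis_mult)
    have per: "cis (x - \<beta> - 2 * pi * j) = cis (x - \<beta>)" if "j \<in> {0, 1, -1}" for j :: real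
      using that by (auto simp: complex_eq_iff cos_diff sin_diff cos_add sin_add)
    have "\<exists>j\<in>{0, 1, -1::real}. \<bar>x - \<beta> - 2 * pi * j\<bar> \<le> pi"
      using x b by (auto simp: abs_le_iff)
    then obtain j where j: "j \<in> {0, 1, -1::real}" "\<bar>x - \<beta> - 2 * pi * j\<bar> \<le> pi" by blast
    have "\<bar>x - \<beta> - 2 * pi * j\<bar> / 3 \<le> r"
      using norm_1_minus_cis_ge[OF j(2)] per[OF j(1)] x(3) by simp
    then have "x \<in> ?I j" by (simp add: abs_le_iff)
    then show "x \<in> ?I 0 \<union> ?I 1 \<union> ?I (-1)" using j(1) by auto
  qed
  have "emeasure full_turn {x \<in> space full_turn. norm (1 - cis x * \<zeta>) \<le> r} = emeasure lborel {x \<in> space full_turn. norm (1 - cis x * \<zeta>) \<le> r}"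
    by (rule emeasure_restrict_space) (auto simp: space_restrict_space)
  also have "\<dots> \<le> emeasure lborel (?I 0 \<union> ?I 1 \<union> ?I (-1))"
    using sub by (intro emeasure_mono) auto
  also have "\<dots> \<le> emeasure lborel (?I 0) + emeasure lborel (?I 1) + emeasure lborel (?I (-1))"
    by (intro order_trans[OF emeasure_subadditive] add_mono) auto
  also have "\<dots> = ennreal (18 * r powr 1)"
    using r by (simp flip: ennreal_plus)
  finally show "emeasure full_turn {x \<in> space full_turn. norm (1 - cis x * \<zeta>) \<le> r} \<le> ennreal (18 * r powr 1)" .
qed auto

text \<open>The new mass of a sublevel set is the integral estimated in
  \<open>regular_measure_near\<close>. This is how the exponent 2 of the disc is lowered to
  1.\<close>

lemma regular_measure_density:
  assumes R: "regular_measure a C M X" and s: "0 \<le> s" "s < a"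
  shows "regular_measure (a - s) (C * near_const a s) (density M (\<lambda>x. ennreal (X x powr (- s)))) X"
proof -
  note [measurable] = regular_measureD(2)[OF R]
  interpret sigma_finite_measure M by (rule regular_measureD(1)[OF R])
  show ?thesis
    unfolding regular_measure_def
  proof (intro conjI allI impI ballI)
    show "sigma_finite_measure (density M (\<lambda>x. ennreal (X x powr (- s))))"
      by (subst sigma_finite_iff_density_finite) auto
    fix r :: real assume r: "r > 0"
    have "emeasure (density M (\<lambda>x. ennreal (X x powr (- s)))) {x \<in> space M. X x \<le> r} =
        (\<integral>\<^sup>+x. ennreal (X x powr (- s)) * indicator {x \<in> space M. X x \<le> r} x \<partial>M)"
      by (rule emeasure_density) measurable
    also have "\<dots> \<le> ennreal (C * near_const a s * r powr (a - s))"
      by (rule regular_measure_near[OF R s r])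
    finally show "emeasure (density M (\<lambda>x. ennreal (X x powr (- s)))) {x \<in> space (density M (\<lambda>x. ennreal (X x powr (- s)))). X x \<le> r}
       \<le> ennreal (C * near_const a s * r powr (a - s))" by simp
  qed (use s regular_measureD(3,4)[OF R] near_const_pos[of s a] in auto)
qed

abbreviation unit_disc :: "complex measure" where
  "unit_disc \<equiv> restrict_space lborel (ball 0 1)"

lemma regular_unit_disc: "regular_measure 2 pi unit_disc (\<lambda>z. norm (1 - z))"
  unfolding regular_measure_def
proof (intro conjI allI impI ballI sigma_finite_restrict_lborel)
  show "(\<lambda>z. norm (1 - z)) \<in> borel_measurable unit_disc"
    by (simp add: measurable_restrict_space1)
  fix r :: real assume r: "r > 0"
  have "emeasure unit_disc {x \<in> space unit_disc. norm (1 - x) \<le> r} = emeasure lborel {x \<in> space unit_disc. norm (1 - x) \<le> r}"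
    by (rule emeasure_restrict_space) (auto simp: space_restrict_space)
  also have "\<dots> \<le> emeasure lborel (cball (1::complex) r)"
    by (intro emeasure_mono) (auto simp: space_restrict_space dist_norm)
  also have "\<dots> = ennreal (pi * r powr 2)"
    using r by (subst emeasure_cball) (auto simp: unit_ball_vol_2)
  finally show "emeasure unit_disc {x \<in> space unit_disc. norm (1 - x) \<le> r} \<le> ennreal (pi * r powr 2)" .
qed auto

text \<open>The bound by \<open>1 - t\<close> is the reverse triangle inequality. Moving from
  \<open>t * \<zeta>\<close> back to \<open>\<zeta>\<close> costs at most \<open>1 - t\<close>,
  which is already controlled. This puts Cauchy kernels under the max kernel.\<close>

lemma norm_1_minus_scaled_ge:
  fixes \<zeta> :: complex
  assumes "0 \<le> t" "t \<le> 1" "norm \<zeta> \<le> 1"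
  shows "max (1 - t) (norm (1 - \<zeta>)) \<le> 2 * norm (1 - of_real t * \<zeta>)"
proof -
  have "t * norm \<zeta> \<le> t" using assms by (simp add: mult_left_le)
  then have 1: "1 - t \<le> norm (1 - of_real t * \<zeta>)"
    using norm_triangle_ineq2[of 1 "of_real t * \<zeta>"] assms by (simp add: norm_mult)
  have "norm (1 - \<zeta>) \<le> norm (1 - of_real t * \<zeta>) + norm ((1 - of_real t) * \<zeta>)"
    using norm_triangle_ineq4[of "1 - of_real t * \<zeta>" "(1 - of_real t) * \<zeta>"] by (simp add: algebra_simps)
  also have "norm ((1 - of_real t) * \<zeta>) \<le> 1 - t"
  proof -
    have "norm (1 - of_real t :: complex) = 1 - t"
      using assms(2) by (metis abs_of_nonneg diff_ge_0_iff_ge norm_of_real of_real_1 of_real_diff)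
    then show ?thesis using assms by (simp add: norm_mult mult_left_le)
  qed
  finally show ?thesis using 1 norm_ge_zero[of "1 - of_real t * \<zeta>"] by linarith
qed

text \<open>Powers of \<open>t\<close> decrease, so the left-hand side is at most the geometric sum
  up to \<open>k\<close>, hence at most \<open>1 / (1 - t)\<close>; the bound by
  \<open>k + 1\<close> is immediate. This puts moments and power series under the max
  kernel.\<close>

lemma power_kernel_le:
  fixes t :: real
  assumes "0 \<le> t" "t < 1"
  shows "real (k + 1) * t ^ k \<le> 1 / max (1 / real (k + 1)) (1 - t)"
proof -
  have 1: "real (k + 1) * t ^ k * (1 / real (k + 1)) \<le> 1"
    using assms by (simp add: power_le_one)
  have "real (k + 1) * t ^ k \<le> (\<Sum>j\<le>k. t ^ j)"
  proof -
    have "(\<Sum>j\<le>k. t ^ k) \<le> (\<Sum>j\<le>k. t ^ j)"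
      using assms by (intro sum_mono power_decreasing) auto
    then show ?thesis by simp
  qed
  then have "real (k + 1) * t ^ k * (1 - t) \<le> (1 - t) * (\<Sum>j\<le>k. t ^ j)"
    using assms by (simp add: mult.commute mult_left_mono)
  also have "\<dots> = 1 - t ^ Suc k" using sum_gp_basic[of t k] by simp
  also have "\<dots> \<le> 1" using assms by simp
  finally have "real (k + 1) * t ^ k * max (1 / real (k + 1)) (1 - t) \<le> 1"
    using 1 by (auto simp: max_def)
  moreover have "0 < max (1 / real (k + 1)) (1 - t)" using assms by simp
  ultimately show ?thesis by (simp add: pos_le_divide_eq)
qed

section \<open>Cauchy's formula and the operator along rays\<close>

lemma nn_integral_restrict_eq_integral:
  fixes f :: "'a::euclidean_space \<Rightarrow> real"
  assumes "A \<in> sets borel" "\<And>x. x \<in> A \<Longrightarrow> 0 \<le> f x" "(f has_integral I) A"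
  shows "(\<integral>\<^sup>+x. ennreal (f x) \<partial>restrict_space lborel A) = ennreal I"
  using nn_integral_has_integral_lebesgue'[OF assms(2,3)] assms(1)
  by (subst nn_integral_restrict_space) auto

lemma nn_integral_restrict_mono:
  assumes "A \<in> sets borel" "B \<in> sets borel" "A \<subseteq> B" "\<And>x. x \<in> A \<Longrightarrow> f x \<le> g x"
  shows "(\<integral>\<^sup>+x. f x \<partial>restrict_space lborel A) \<le> (\<integral>\<^sup>+x. g x \<partial>restrict_space lborel B)"
proof -
  have "(\<integral>\<^sup>+x. f x * indicator A x \<partial>lborel) \<le> (\<integral>\<^sup>+x. g x * indicator B x \<partial>lborel)"
    using assms(3,4) by (intro nn_integral_mono) (auto split: split_indicator)
  then show ?thesis using assms(1,2) by (simp add: nn_integral_restrict_space)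
qed

text \<open>Fatou's lemma. It passes bounds for dilates, truncations and locally convergent
  sequences to the limit without a dominating function.\<close>

lemma nn_integral_limit_le:
  fixes u :: "nat \<Rightarrow> 'a \<Rightarrow> ennreal"
  assumes "\<And>n. u n \<in> borel_measurable M" "\<And>x. x \<in> space M \<Longrightarrow> (\<lambda>n. u n x) \<longlonglongrightarrow> F x"
    "\<And>n. (\<integral>\<^sup>+x. u n x \<partial>M) \<le> K"
  shows "(\<integral>\<^sup>+x. F x \<partial>M) \<le> K"
proof -
  have "(\<integral>\<^sup>+x. F x \<partial>M) = (\<integral>\<^sup>+x. liminf (\<lambda>n. u n x) \<partial>M)"
    by (intro nn_integral_cong lim_imp_Liminf[OF trivial_limit_sequentially, symmetric] assms(2))
  also have "\<dots> \<le> liminf (\<lambda>n. \<integral>\<^sup>+x. u n x \<partial>M)" by (rule nn_integral_liminf[OF assms(1)])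
  also have "\<dots> \<le> K" by (rule Liminf_le) (auto intro!: always_eventually assms(3))
  finally show ?thesis .
qed

lemma nn_integral_Icc_continuous:
  fixes f :: "real \<Rightarrow> real"
  assumes "continuous_on {a..b} f" "\<And>x. x \<in> {a..b} \<Longrightarrow> 0 \<le> f x"
  shows "(\<integral>\<^sup>+x. ennreal (f x) \<partial>restrict_space lborel {a..b}) = ennreal (integral {a..b} f)"
  using assms by (intro nn_integral_restrict_eq_integral integrable_integral integrable_continuous_real) auto

lemma nn_integral_unit_interval_continuous:
  fixes f :: "real \<Rightarrow> real"
  assumes "continuous_on {0..1} f" "\<And>x. x \<in> {0..1} \<Longrightarrow> 0 \<le> f x"
  shows "(\<integral>\<^sub>I x. ennreal (f x)) = ennreal (integral {0..1} f)"
proof (intro nn_integral_restrict_eq_integral)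
  have "(f has_integral integral {0..1} f) {0..1}"
    using assms by (intro integrable_integral integrable_continuous_real) auto
  moreover have "(f has_integral I) {0..1} \<longleftrightarrow> (f has_integral I) {0..<1}" for I
  proof (rule has_integral_spike_set_eq)
    show "negligible {x \<in> {0..1} - {0..<1}. f x \<noteq> 0}"
      by (rule negligible_subset[of "{1}"]) auto
    show "negligible {x \<in> {0..<1} - {0..1}. f x \<noteq> 0}"
      by (rule negligible_subset[of "{1}"]) auto
  qed
  ultimately show "(f has_integral integral {0..1} f) {0..<1}" by blast
qed (use assms in auto)

lemma ennreal_norm_has_integral_le:
  fixes f :: "real \<Rightarrow> complex"
  assumes c: "continuous_on {a..b} f" and I: "(f has_integral I) {a..b}"
  shows "enorm I \<le> (\<integral>\<^sup>+x. enorm (f x) \<partial>restrict_space lborel {a..b})"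
proof -
  have "norm I \<le> integral {a..b} (\<lambda>x. norm (f x))"
    unfolding integral_unique[OF I, symmetric]
    by (intro integral_norm_bound_integral integrable_continuous_real continuous_intros c order_refl)
  then show ?thesis
    by (subst nn_integral_Icc_continuous) (auto intro!: continuous_intros c ennreal_leI)
qed

text \<open>The modulus is taken inside Cauchy's formula, but the distance from \<open>z\<close> to
  the circle stays in the integrand, because each application estimates it differently.\<close>

lemma Cauchy_formula_bound:
  assumes f: "f holomorphic_on ball c R" and r: "0 < r" "r < R" and z: "norm (z - c) < r"
  shows "enorm (f z) \<le> ennreal (1 / (2 * pi)) *
           (\<integral>\<^sub>T \<theta>. ennreal (norm (f (c + rcis r \<theta>)) * (r / norm (c + rcis r \<theta> - z))))"
proof -
  have hol: "f holomorphic_on cball c r" using f by (rule holomorphic_on_subset) (use r in auto)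
  have "((\<lambda>u. f u / (u - z)) has_contour_integral (2 * of_real pi * \<i> * f z)) (circlepath c r)"
    by (rule Cauchy_integral_circlepath_simple[OF hol]) (use z in \<open>simp_all add: norm_minus_commute\<close>)
  then have I: "((\<lambda>\<theta>. f (c + r * cis \<theta>) / (c + r * cis \<theta> - z) * r * \<i> * cis \<theta>) has_integral (2 * of_real pi * \<i> * f z)) {0..2 * pi}"
    unfolding circlepath_def by (subst (asm) has_contour_integral_part_circlepath_iff) auto
  have nz: "c + r * cis \<theta> - z \<noteq> 0" for \<theta>
  proof
    assume "c + r * cis \<theta> - z = 0"
    then have "z - c = r * cis \<theta>" by (simp add: algebra_simps)
    then have "norm (z - c) = r" using r by (simp add: norm_mult)
    then show False using z by simp
  qed
  have co: "continuous_on {0..2*pi} (\<lambda>\<theta>. f (c + r * cis \<theta>))"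
    by (rule continuous_on_compose2[OF holomorphic_on_imp_continuous_on[OF hol]])
       (use r in \<open>auto intro!: continuous_intros simp: dist_norm norm_mult\<close>)
  have cc: "continuous_on {0..2*pi} cis" by (intro continuous_intros)
  have cI: "continuous_on {0..2*pi} (\<lambda>\<theta>. f (c + r * cis \<theta>) / (c + r * cis \<theta> - z) * r * \<i> * cis \<theta>)"
    by (intro continuous_on_mult continuous_on_divide co continuous_on_add continuous_on_diff continuous_on_const cc ballI nz)
  have "enorm (2 * of_real pi * \<i> * f z) \<le>
      (\<integral>\<^sub>T \<theta>. enorm (f (c + r * cis \<theta>) / (c + r * cis \<theta> - z) * r * \<i> * cis \<theta>))"
    by (rule ennreal_norm_has_integral_le[OF cI I])
  also have "\<dots> = (\<integral>\<^sub>T \<theta>. ennreal (norm (f (c + rcis r \<theta>)) * (r / norm (c + rcis r \<theta> - z))))"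
  proof (rule nn_integral_cong)
    fix \<theta>
    have "norm (f (c + r * cis \<theta>) / (c + r * cis \<theta> - z) * r * \<i> * cis \<theta>) =
        norm (f (c + rcis r \<theta>)) * (r / norm (c + rcis r \<theta> - z))"
      unfolding rcis_def norm_mult norm_divide using r by simp
    then show "enorm (f (c + r * cis \<theta>) / (c + r * cis \<theta> - z) * r * \<i> * cis \<theta>) =
        ennreal (norm (f (c + rcis r \<theta>)) * (r / norm (c + rcis r \<theta> - z)))" by simp
  qed
  finally have le: "enorm (2 * of_real pi * \<i> * f z) \<le>
      (\<integral>\<^sub>T \<theta>. ennreal (norm (f (c + rcis r \<theta>)) * (r / norm (c + rcis r \<theta> - z))))" (is "_ \<le> ?I") .
  have "norm (f z) = 1 / (2 * pi) * norm (2 * of_real pi * \<i> * f z)"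
    by (simp add: norm_mult)
  then have "enorm (f z) = ennreal (1 / (2 * pi) * norm (2 * of_real pi * \<i> * f z))"
    by (rule arg_cong[where f=ennreal])
  also have "\<dots> = ennreal (1 / (2 * pi)) * enorm (2 * of_real pi * \<i> * f z)"
    by (rule ennreal_mult'') (rule norm_ge_zero)
  also have "\<dots> \<le> ennreal (1 / (2 * pi)) * ?I"
    by (rule mult_left_mono[OF le]) simp
  finally show ?thesis .
qed

text \<open>The disc is convex, so the integrand has a primitive there and the segment integral is a
  difference of its values. Holomorphy of \<open>T_op g f\<close> and its formula along rays are
  both read off from this.\<close>

lemma T_op_primitive:
  assumes f: "f holomorphic_on ball 0 1" and g: "g holomorphic_on ball 0 1"
  obtains P where "\<And>z. z \<in> ball 0 1 \<Longrightarrow> (P has_field_derivative f z * deriv g z) (at z)"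
    "\<And>z. z \<in> ball 0 1 \<Longrightarrow> T_op g f z = P z - P 0"
proof -
  have "(\<lambda>z. f z * deriv g z) holomorphic_on ball 0 1"
    by (intro holomorphic_intros f holomorphic_deriv[OF g]) auto
  from holomorphic_convex_primitive'[OF _ _ this] obtain P where
    P: "\<And>z. z \<in> ball 0 1 \<Longrightarrow> (P has_field_derivative f z * deriv g z) (at z within ball 0 1)"
    by (auto simp: convex_ball)
  have "T_op g f z = P z - P 0" if z: "z \<in> ball 0 1" for z
  proof -
    have "path_image (linepath 0 z) \<subseteq> ball 0 1"
      using z by (simp only: path_image_linepath) (rule closed_segment_subset[OF _ _ convex_ball], auto)
    then have "((\<lambda>\<zeta>. f \<zeta> * deriv g \<zeta>) has_contour_integral (P (pathfinish (linepath 0 z)) - P (pathstart (linepath 0 z)))) (linepath 0 z)"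
      by (intro contour_integral_primitive[OF P]) auto
    then show ?thesis by (simp add: T_op_def contour_integral_unique)
  qed
  then show ?thesis using that[of P] P by (metis at_within_open open_ball)
qed

lemma T_op_holomorphic:
  assumes "f holomorphic_on ball 0 1" "g holomorphic_on ball 0 1"
  shows "T_op g f holomorphic_on ball 0 1"
proof -
  obtain P where P: "\<And>z. z \<in> ball 0 1 \<Longrightarrow> (P has_field_derivative f z * deriv g z) (at z)"
    "\<And>z. z \<in> ball 0 1 \<Longrightarrow> T_op g f z = P z - P 0"
    using T_op_primitive[OF assms] by blast
  have "(\<lambda>z. P z - P 0) holomorphic_on ball 0 1"
  proof -
    have "P holomorphic_on ball 0 1" unfolding holomorphic_on_open[OF open_ball] using P(1) by blast
    then show ?thesis by (intro holomorphic_intros)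
  qed
  then show ?thesis by (rule holomorphic_transform) (simp add: P(2))
qed

lemma rcis_in_ball: "0 \<le> r \<Longrightarrow> r < R \<Longrightarrow> rcis r \<alpha> \<in> ball 0 R"
  by (simp add: rcis_def norm_mult)

lemma radial_fundamental_theorem:
  assumes P: "\<And>z. z \<in> ball 0 1 \<Longrightarrow> (P has_field_derivative P' z) (at z)" and r: "0 \<le> r" "r < 1"
  shows "((\<lambda>s. cis \<alpha> * P' (rcis s \<alpha>)) has_integral P (rcis r \<alpha>) - P 0) {0..r}"
proof -
  have "((\<lambda>s. cis \<alpha> * P' (rcis s \<alpha>)) has_integral P (rcis r \<alpha>) - P (rcis 0 \<alpha>)) {0..r}"
  proof (rule fundamental_theorem_of_calculus)
    fix x assume x: "x \<in> {0..r}"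
    have 1: "((\<lambda>s. rcis s \<alpha>) has_vector_derivative cis \<alpha>) (at x within {0..r})"
      unfolding rcis_def by (auto intro!: derivative_eq_intros)
    have 2: "(P has_field_derivative P' (rcis x \<alpha>)) (at (rcis x \<alpha>))"
      by (rule P, rule rcis_in_ball) (use x r in auto)
    show "((\<lambda>s. P (rcis s \<alpha>)) has_vector_derivative cis \<alpha> * P' (rcis x \<alpha>)) (at x within {0..r})"
      using field_vector_diff_chain_within[OF 1 has_field_derivative_at_within[OF 2]] by (simp add: o_def)
  qed (use r in auto)
  then show ?thesis by simp
qed

lemma T_op_radial:
  assumes f: "f holomorphic_on ball 0 1" and g: "g holomorphic_on ball 0 1" and r: "0 \<le> r" "r < 1"
  shows "((\<lambda>s. cis \<alpha> * (f (rcis s \<alpha>) * deriv g (rcis s \<alpha>))) has_integral T_op g f (rcis r \<alpha>)) {0..r}"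
proof -
  obtain P where P: "\<And>z. z \<in> ball 0 1 \<Longrightarrow> (P has_field_derivative f z * deriv g z) (at z)"
    "\<And>z. z \<in> ball 0 1 \<Longrightarrow> T_op g f z = P z - P 0"
    using T_op_primitive[OF f g] by blast
  show ?thesis
    using radial_fundamental_theorem[OF P(1) r, of \<alpha>] P(2)[OF rcis_in_ball[of r 1 \<alpha>]] r by simp
qed

lemma continuous_on_rcis [continuous_intros]:
  "continuous_on A f \<Longrightarrow> continuous_on A g \<Longrightarrow> continuous_on A (\<lambda>x. rcis (f x) (g x))"
  unfolding rcis_def by (intro continuous_intros)

lemma continuous_on_ray:
  assumes f: "f holomorphic_on ball 0 1"
  shows "continuous_on {0..<1} (\<lambda>s. f (rcis s \<alpha>))"
proof (rule continuous_on_compose2[OF holomorphic_on_imp_continuous_on[OF f]])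
  show "continuous_on {0..<1} (\<lambda>s. rcis s \<alpha>)" by (intro continuous_on_rcis continuous_on_id continuous_on_const)
  show "(\<lambda>s. rcis s \<alpha>) ` {0..<1} \<subseteq> ball 0 1" by (intro image_subsetI rcis_in_ball) auto
qed

lemma continuous_on_ray_segment:
  assumes "f holomorphic_on ball 0 1" "r < 1"
  shows "continuous_on {0..r} (\<lambda>s. f (rcis s \<alpha>))"
  by (rule continuous_on_subset[OF continuous_on_ray[OF assms(1)]]) (use assms in auto)

section \<open>Area mean values\<close>

text \<open>Identifies \<open>real ^ 2\<close> with the plane. Linear maps of
  \<open>real ^ 2\<close> have matrices and determinants, through which rotation invariance of area
  is obtained.\<close>

definition vec_complex :: "real ^ 2 \<Rightarrow> complex" where
  "vec_complex v = Complex (v $ 1) (v $ 2)"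

lemma Basis_real_2: "(Basis :: (real ^ 2) set) = {axis 1 1, axis 2 1}"
  by (auto simp: Basis_vec_def UNIV_2)

lemma vec_complex_measurable [measurable]: "vec_complex \<in> borel_measurable borel"
proof -
  have "continuous_on UNIV vec_complex"
    unfolding vec_complex_def Complex_eq by (intro continuous_intros)
  then show ?thesis by (rule borel_measurable_continuous_onI)
qed

lemma vec_complex_box:
  "vec_complex -` box l u = box (vector [Re l, Im l]) (vector [Re u, Im u])"
  by (auto simp: vec_complex_def mem_box_cart in_box_complex_iff forall_2)

text \<open>Boxes determine Lebesgue measure, and a box of the plane corresponds to a box of
  \<open>real ^ 2\<close> with the same side lengths.\<close>

lemma lborel_complex_eq_distr: "(lborel :: complex measure) = distr lborel borel vec_complex"
proof (rule lborel_eqI)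
  fix l u :: complex assume b: "\<And>b. b \<in> Basis \<Longrightarrow> l \<bullet> b \<le> u \<bullet> b"
  have le: "Re l \<le> Re u" "Im l \<le> Im u" using b[of 1] b[of \<i>] by (auto simp: Basis_complex_def)
  have ne: "(axis 1 1 :: real ^ 2) \<noteq> axis 2 1" by (simp add: axis_eq_axis)
  have "emeasure (distr lborel borel vec_complex) (box l u) = emeasure lborel (vec_complex -` box l u)"
    by (subst emeasure_distr) auto
  also have "\<dots> = (\<Prod>b\<in>Basis. (vector [Re u, Im u] - vector [Re l, Im l] :: real ^ 2) \<bullet> b)"
    unfolding vec_complex_box
    by (rule emeasure_lborel_box) (use le in \<open>auto simp: Basis_real_2 inner_axis\<close>)
  also have "\<dots> = ennreal (\<Prod>b\<in>Basis. (u - l) \<bullet> b)"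
    using ne by (simp add: Basis_real_2 inner_axis Basis_complex_def)
  finally show "emeasure (distr lborel borel vec_complex) (box l u) = ennreal (\<Prod>b\<in>Basis. (u - l) \<bullet> b)" .
qed simp

text \<open>It suffices to measure the preimage of a box. In coordinates this preimage is the image
  of a box under a linear map of determinant
  \<open>(cos \<theta>)^2 + (sin \<theta>)^2 = 1\<close>.\<close>

lemma lborel_distr_rotation: "distr lborel borel (\<lambda>z. cis \<theta> * z) = lborel"
proof (rule lborel_eqI[symmetric])
  fix l u :: complex assume le: "\<And>b. b \<in> Basis \<Longrightarrow> l \<bullet> b \<le> u \<bullet> b"
  define B where "B = vec_complex -` box l u"
  \<comment> \<open>Rotation by \<open>- \<theta>\<close>: taking the inverse turns the preimage of
    \<open>B\<close> into an image, to which the determinant formula applies.\<close>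
  define \<rho> :: "real ^ 2 \<Rightarrow> real ^ 2" where
    "\<rho> v = vector [cos \<theta> * v $ 1 + sin \<theta> * v $ 2, cos \<theta> * v $ 2 - sin \<theta> * v $ 1]" for v
  have cm: "(\<lambda>z. cis \<theta> * z) \<in> borel_measurable borel"
    by (intro borel_measurable_continuous_onI continuous_intros)
  have rot: "cis \<theta> * vec_complex (\<rho> v) = vec_complex v" for v
  proof -
    have "c * (c * a + s * b) - s * (c * b - s * a) = (c\<^sup>2 + s\<^sup>2) * a"
         "c * (c * b - s * a) + s * (c * a + s * b) = (c\<^sup>2 + s\<^sup>2) * b" for a b c s :: real
      by (simp_all add: algebra_simps power2_eq_square)
    then show ?thesis
      by (simp add: complex_eq_iff vec_complex_def \<rho>_def)
  qed
  have inj: "vec_complex v = vec_complex w \<longleftrightarrow> v = w" for v w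
    by (auto simp: vec_complex_def vec_eq_iff forall_2)
  have lin: "linear \<rho>"
    unfolding linear_iff by (auto simp: \<rho>_def vec_eq_iff forall_2 algebra_simps)
  have "det (matrix \<rho>) = (cos \<theta>)\<^sup>2 + (sin \<theta>)\<^sup>2"
    by (simp add: det_2 matrix_def \<rho>_def axis_def power2_eq_square)
  then have det: "det (matrix \<rho>) = 1" by simp
  have surj: "\<exists>v. w = \<rho> v" for w
  proof -
    have "cis \<theta> * vec_complex (\<rho> (vector [Re (cis \<theta> * vec_complex w), Im (cis \<theta> * vec_complex w)])) = cis \<theta> * vec_complex w"
      unfolding rot by (simp add: vec_complex_def complex_eq_iff)
    then show ?thesis using inj by (metis cis_neq_zero mult_left_cancel)
  qed
  have pre: "vec_complex -` ((\<lambda>z. cis \<theta> * z) -` box l u) = \<rho> ` B"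
  proof (intro equalityI subsetI)
    fix w assume "w \<in> vec_complex -` ((\<lambda>z. cis \<theta> * z) -` box l u)"
    moreover obtain v where "w = \<rho> v" using surj by blast
    ultimately show "w \<in> \<rho> ` B" using rot by (auto simp: B_def)
  qed (auto simp: B_def rot)
  have Bbox: "B = box (vector [Re l, Im l]) (vector [Re u, Im u])" by (simp add: B_def vec_complex_box)
  have Bl: "B \<in> lmeasurable" unfolding Bbox by simp
  have "emeasure (distr lborel borel (\<lambda>z. cis \<theta> * z)) (box l u) = emeasure lborel ((\<lambda>z. cis \<theta> * z) -` box l u)"
    using cm by (subst emeasure_distr) auto
  also have "\<dots> = emeasure lborel (vec_complex -` ((\<lambda>z. cis \<theta> * z) -` box l u))"
    using measurable_sets[OF cm, of "box l u"] by (subst lborel_complex_eq_distr, subst emeasure_distr) auto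
  also have "\<dots> = emeasure lebesgue (\<rho> ` B)"
  proof -
    have "vec_complex -` ((\<lambda>z. cis \<theta> * z) -` box l u) \<in> sets borel"
      using measurable_sets[OF vec_complex_measurable measurable_sets[OF cm, of "box l u", simplified]] by simp
    then show ?thesis by (simp add: pre)
  qed
  also have "\<dots> = ennreal (measure lebesgue (\<rho> ` B))"
    using measurable_linear_image[OF lin Bl] by (simp add: emeasure_eq_measure2)
  also have "\<dots> = ennreal (measure lebesgue B)"
    using measure_linear_image[OF lin Bl] det by simp
  also have "\<dots> = emeasure lborel B"
    using Bl by (simp add: Bbox emeasure_eq_measure2[symmetric])
  also have "\<dots> = emeasure lborel (box l u)"
    using emeasure_distr[of vec_complex lborel borel "box l u"]
    by (simp add: B_def lborel_complex_eq_distr[symmetric])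
  also have "\<dots> = (\<Prod>b\<in>Basis. (u - l) \<bullet> b)"
    using le by (rule emeasure_lborel_box)
  finally show "emeasure (distr lborel borel (\<lambda>z. cis \<theta> * z)) (box l u) = (\<Prod>b\<in>Basis. (u - l) \<bullet> b)" .
qed simp

lemma nn_integral_rotate:
  assumes [measurable]: "f \<in> borel_measurable borel"
  shows "(\<integral>\<^sup>+w. f (cis \<theta> * w) \<partial>lborel) = (\<integral>\<^sup>+w. f w \<partial>lborel)"
  by (subst (2) lborel_distr_rotation[of \<theta>, symmetric], subst nn_integral_distr) auto

lemma nn_integral_translate:
  fixes c :: "'a::euclidean_space"
  assumes [measurable]: "f \<in> borel_measurable borel"
  shows "(\<integral>\<^sup>+w. f (c + w) \<partial>lborel) = (\<integral>\<^sup>+w. f w \<partial>lborel)"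
  by (subst (2) lborel_distr_plus[of c, symmetric], subst nn_integral_distr) auto

lemma borel_measurable_norm_indicator:
  fixes f :: "'a::euclidean_space \<Rightarrow> 'b::euclidean_space"
  assumes "continuous_on A f" "A \<in> sets borel"
  shows "(\<lambda>w. enorm (f w) * indicator A w) \<in> borel_measurable borel"
proof -
  have [measurable]: "(\<lambda>w. indicator A w *\<^sub>R f w) \<in> borel_measurable borel"
    using assms by (intro borel_measurable_continuous_on_indicator)
  have eq: "(\<lambda>w. enorm (f w) * indicator A w) = (\<lambda>w. enorm (indicator A w *\<^sub>R f w))"
    by (auto simp: fun_eq_iff split: split_indicator)
  show ?thesis unfolding eq by measurable
qed

text \<open>The circle means about \<open>c\<close> are averaged over all \<open>w\<close> in the
  disc, not just over radii. After Fubini's theorem every angle contributes the full disc integral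
  by rotation and translation invariance, which takes the place of polar coordinates.\<close>

lemma area_mean_value:
  assumes f: "f holomorphic_on ball c R" and R: "0 < R"
  shows "ennreal (pi * R\<^sup>2 * norm (f c)) \<le> (\<integral>\<^sup>+w. enorm (f w) * indicator (ball c R) w \<partial>lborel)"
proof -
  define G where "G w = enorm (f w) * indicator (ball c R) w" for w
  have Gm [measurable]: "G \<in> borel_measurable borel"
    unfolding G_def[abs_def] by (intro borel_measurable_norm_indicator holomorphic_on_imp_continuous_on[OF f]) simp
  have circ: "enorm (f c) \<le> ennreal (1 / (2 * pi)) * (\<integral>\<^sub>T \<theta>. G (c + cis \<theta> * w))"
    if w: "norm w < R" for w
  proof (cases "w = 0")
    case True
    have "emeasure full_turn (space full_turn) = ennreal (2 * pi)"
      by (simp add: emeasure_restrict_space space_restrict_space)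
    then have "(\<integral>\<^sub>T \<theta>. G (c + cis \<theta> * w)) = enorm (f c) * ennreal (2 * pi)"
      using True R by (simp add: G_def)
    moreover have "ennreal (1 / (2 * pi)) * (enorm (f c) * ennreal (2 * pi)) = enorm (f c)"
      by (simp add: ennreal_mult[symmetric])
    ultimately show ?thesis by simp
  next
    case False
    \<comment> \<open>Rescaling carries the circle through \<open>c + w\<close> to the unit circle.
      The rescaled function is holomorphic on a disc of radius \<open>R / norm w\<close>, which
      exceeds 1.\<close>
    define h where "h \<zeta> = f (c + \<zeta> * w)" for \<zeta>
    have hol: "h holomorphic_on ball 0 (R / norm w)"
    proof -
      have "(\<lambda>\<zeta>. c + \<zeta> * w) ` ball 0 (R / norm w) \<subseteq> ball c R"
        using False by (auto simp: dist_norm norm_mult field_simps)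
      moreover have "(\<lambda>\<zeta>. c + \<zeta> * w) holomorphic_on ball 0 (R / norm w)" by (intro holomorphic_intros)
      ultimately have "(f \<circ> (\<lambda>\<zeta>. c + \<zeta> * w)) holomorphic_on ball 0 (R / norm w)"
        using f holomorphic_on_compose_gen by blast
      then show ?thesis unfolding h_def[abs_def] o_def .
    qed
    have "enorm (h 0) \<le> ennreal (1 / (2 * pi)) *
           (\<integral>\<^sub>T \<theta>. ennreal (norm (h (0 + rcis 1 \<theta>)) * (1 / norm (0 + rcis 1 \<theta> - 0))))"
      by (rule Cauchy_formula_bound[OF hol]) (use w False in \<open>auto simp: field_simps\<close>)
    also have "\<dots> = ennreal (1 / (2 * pi)) * (\<integral>\<^sub>T \<theta>. G (c + cis \<theta> * w))"
      using w by (simp add: h_def G_def rcis_def dist_norm norm_mult)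
    finally show ?thesis by (simp add: h_def)
  qed
  interpret T: sigma_finite_measure full_turn by (rule sigma_finite_restrict_lborel) simp
  interpret P: pair_sigma_finite full_turn "lborel :: complex measure" ..
  \<comment> \<open>Fubini's theorem needs joint measurability: continuity gives it on the whole
    product, and the angle is restricted to one turn afterwards.\<close>
  have c1: "(\<lambda>x :: real \<times> complex. c + cis (fst x) * snd x) \<in> borel_measurable (lborel \<Otimes>\<^sub>M lborel)"
  proof -
    have "(\<lambda>x :: real \<times> complex. c + cis (fst x) * snd x) \<in> borel_measurable borel"
      by (intro borel_measurable_continuous_onI continuous_intros)
    moreover have eq: "sets (lborel \<Otimes>\<^sub>M lborel) = sets (borel :: (real \<times> complex) measure)"
      by (simp only: lborel_prod sets_lborel)
    ultimately show ?thesis by (subst measurable_cong_sets[OF eq refl])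
  qed
  have c2: "(\<lambda>x. (fst x, snd x)) \<in> full_turn \<Otimes>\<^sub>M lborel \<rightarrow>\<^sub>M (lborel \<Otimes>\<^sub>M (lborel :: complex measure))"
    by (intro measurable_Pair measurable_snd measurable_compose[OF measurable_fst]) (simp add: measurable_restrict_space1)
  have c3: "(\<lambda>x. c + cis (fst x) * snd x) \<in> borel_measurable (full_turn \<Otimes>\<^sub>M (lborel :: complex measure))"
    using measurable_compose[OF c2 c1] by (simp only: fst_conv snd_conv)
  have c4: "(\<lambda>x. indicator (ball 0 R) (snd x) :: ennreal) \<in> borel_measurable (full_turn \<Otimes>\<^sub>M (lborel :: complex measure))"
    by (rule measurable_compose[OF measurable_snd borel_measurable_indicator]) simp
  have c5: "(\<lambda>x. G (c + cis (fst x) * snd x) * indicator (ball 0 R) (snd x)) \<in> borel_measurable (full_turn \<Otimes>\<^sub>M lborel)"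
    by (rule borel_measurable_times_ennreal[OF measurable_compose[OF c3 Gm] c4])
  have Gm2: "(\<lambda>(\<theta>, w). G (c + cis \<theta> * w) * indicator (ball 0 R) w) \<in> borel_measurable (full_turn \<Otimes>\<^sub>M lborel)"
    using c5 by (simp only: split_beta')
  have Gm3: "(\<lambda>w. \<integral>\<^sub>T \<theta>. G (c + cis \<theta> * w) * indicator (ball 0 R) w) \<in> borel_measurable lborel"
    using measurable_compose[OF measurable_pair_swap' c5]
    by (intro T.borel_measurable_nn_integral) (simp only: split_beta' fst_conv snd_conv)
  have "enorm (f c) * emeasure lborel (ball (0::complex) R) = (\<integral>\<^sup>+w. enorm (f c) * indicator (ball (0::complex) R) w \<partial>lborel)"
    by (simp add: nn_integral_cmult_indicator)
  also have "\<dots> \<le> (\<integral>\<^sup>+w. ennreal (1 / (2 * pi)) * (\<integral>\<^sub>T \<theta>. G (c + cis \<theta> * w) * indicator (ball 0 R) w) \<partial>lborel)"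
    by (intro nn_integral_mono) (use circ in \<open>auto simp: dist_norm split: split_indicator\<close>)
  also have "\<dots> = ennreal (1 / (2 * pi)) * (\<integral>\<^sup>+w. (\<integral>\<^sub>T \<theta>. G (c + cis \<theta> * w) * indicator (ball 0 R) w) \<partial>lborel)"
    by (rule nn_integral_cmult[OF Gm3])
  also have "(\<integral>\<^sup>+w. (\<integral>\<^sub>T \<theta>. G (c + cis \<theta> * w) * indicator (ball 0 R) w) \<partial>lborel) =
      (\<integral>\<^sub>T \<theta>. (\<integral>\<^sup>+w. G (c + cis \<theta> * w) * indicator (ball 0 R) w \<partial>lborel))"
    by (rule P.Fubini'[OF Gm2])
  also have "\<dots> = (\<integral>\<^sub>T \<theta>. (\<integral>\<^sup>+w. G w \<partial>lborel))"
  proof (rule nn_integral_cong)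
    fix \<theta>
    have "(\<integral>\<^sup>+w. G (c + cis \<theta> * w) * indicator (ball 0 R) w \<partial>lborel) = (\<integral>\<^sup>+w. G (c + cis \<theta> * w) \<partial>lborel)"
      by (intro nn_integral_cong) (auto simp: G_def dist_norm norm_mult split: split_indicator)
    also have "\<dots> = (\<integral>\<^sup>+w. G (c + w) \<partial>lborel)"
      by (rule nn_integral_rotate[of "\<lambda>w. G (c + w)"]) measurable
    also have "\<dots> = (\<integral>\<^sup>+w. G w \<partial>lborel)" by (rule nn_integral_translate) measurable
    finally show "(\<integral>\<^sup>+w. G (c + cis \<theta> * w) * indicator (ball 0 R) w \<partial>lborel) = (\<integral>\<^sup>+w. G w \<partial>lborel)" .
  qed
  also have "\<dots> = (\<integral>\<^sup>+w. G w \<partial>lborel) * ennreal (2 * pi)"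
    by (simp add: emeasure_restrict_space space_restrict_space)
  also have "ennreal (1 / (2 * pi)) * ((\<integral>\<^sup>+w. G w \<partial>lborel) * ennreal (2 * pi)) = (\<integral>\<^sup>+w. G w \<partial>lborel)"
  proof -
    have "ennreal (1 / (2 * pi)) * ennreal (2 * pi) = 1" by (simp add: ennreal_mult[symmetric])
    then show ?thesis by (metis mult.assoc mult.commute mult.right_neutral)
  qed
  finally show ?thesis
    using R by (simp add: G_def emeasure_ball unit_ball_vol_2 ennreal_mult[symmetric] mult.commute)
qed

text \<open>Hoelder's inequality against the constant 1 on the disc of area \<open>V\<close>: the
  power \<open>p\<close> of \<open>V * norm (f c)\<close> is at most \<open>V powr (p - 1)\<close>
  times the integral, and \<open>V powr p\<close> is divided out.\<close>

lemma area_mean_value_powr: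
  assumes f: "f holomorphic_on ball c R" and R: "0 < R" and p: "1 < p"
  shows "ennreal (norm (f c) powr p) \<le>
     ennreal (1 / (pi * R\<^sup>2)) * (\<integral>\<^sup>+w. ennreal (norm (f w) powr p) * indicator (ball c R) w \<partial>lborel)"
proof -
  define q where "q = p / (p - 1)"
  have q: "1 / p + 1 / q = 1" "p / q = p - 1" "1 < q"
    using p by (auto simp: q_def field_simps)
  define V where "V = pi * R\<^sup>2"
  have V: "0 < V" using R by (simp add: V_def)
  let ?I = "\<integral>\<^sup>+w. ennreal (norm (f w) powr p) * indicator (ball c R) w \<partial>lborel"
  have Gm: "(\<lambda>w. enorm (f w) * indicator (ball c R) w) \<in> borel_measurable borel"
    by (intro borel_measurable_norm_indicator holomorphic_on_imp_continuous_on[OF f]) simp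
  have "ennreal (V * norm (f c)) \<le> (\<integral>\<^sup>+w. enorm (f w) * indicator (ball c R) w \<partial>lborel)"
    unfolding V_def by (rule area_mean_value[OF f R])
  also have "\<dots> = (\<integral>\<^sup>+w. indicator (ball c R) w * (enorm (f w) * indicator (ball c R) w) \<partial>lborel)"
    by (intro nn_integral_cong) (auto split: split_indicator)
  also have "\<dots> \<le> epowr (\<integral>\<^sup>+w. epowr (indicator (ball c R) w) q \<partial>lborel) (1 / q) *
      epowr (\<integral>\<^sup>+w. epowr (enorm (f w) * indicator (ball c R) w) p \<partial>lborel) (1 / p)"
    by (rule nn_integral_Holder[OF p q(1)]) (use Gm in \<open>auto intro!: borel_measurable_indicator\<close>)
  also have "(\<integral>\<^sup>+w. epowr (indicator (ball c R) w) q \<partial>lborel) = (\<integral>\<^sup>+w. indicator (ball c R) w \<partial>lborel)"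
    by (intro nn_integral_cong) (auto split: split_indicator)
  also have "\<dots> = ennreal V"
    using R by (simp add: emeasure_ball unit_ball_vol_2 V_def)
  also have "(\<integral>\<^sup>+w. epowr (enorm (f w) * indicator (ball c R) w) p \<partial>lborel) = ?I"
    by (intro nn_integral_cong) (auto simp: epowr_ennreal split: split_indicator)
  finally have "epowr (ennreal (V * norm (f c))) p \<le> epowr (epowr (ennreal V) (1 / q) * epowr ?I (1 / p)) p"
    using p by (intro epowr_mono) auto
  also have "\<dots> = ennreal (V powr (p - 1)) * ?I"
    using p q V by (simp add: epowr_mult epowr_epowr) (simp add: epowr_ennreal)
  finally have "ennreal (V powr p * norm (f c) powr p) \<le> ennreal (V powr (p - 1)) * ?I"
    using V by (simp add: epowr_ennreal powr_mult)
  then have "ennreal (V powr (- p)) * ennreal (V powr p * norm (f c) powr p) \<le> ennreal (V powr (- p)) * (ennreal (V powr (p - 1)) * ?I)"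
    by (rule mult_left_mono) simp
  also have "\<dots> = ennreal (V powr (- p) * V powr (p - 1)) * ?I"
    by (simp add: mult.assoc[symmetric] ennreal_mult[symmetric])
  also have "V powr (- p) * V powr (p - 1) = 1 / V"
    using V by (subst powr_add[symmetric]) (simp add: powr_minus_divide)
  also have "ennreal (V powr (- p)) * ennreal (V powr p * norm (f c) powr p) = ennreal (norm (f c) powr p)"
  proof -
    have "V powr (- p) * V powr p = 1" using V by (subst powr_add[symmetric]) simp
    then show ?thesis by (simp only: ennreal_mult[symmetric] mult.assoc[symmetric] powr_ge_zero zero_le_mult_iff mult_1_left simp_thms)
  qed
  finally show ?thesis unfolding V_def .
qed

section \<open>Moments, power series and Cauchy transforms\<close>

lemma regular_measure_mono:
  assumes R: "regular_measure a C M X" and "C \<le> D"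
  shows "regular_measure a D M X"
  unfolding regular_measure_def
proof (intro conjI allI impI ballI regular_measureD[OF R])
  show "0 \<le> D" using regular_measureD(4)[OF R] assms by simp
  fix r :: real assume r: "r > 0"
  have "ennreal (C * r powr a) \<le> ennreal (D * r powr a)"
    using assms by (intro ennreal_leI mult_right_mono) auto
  then show "emeasure M {x \<in> space M. X x \<le> r} \<le> ennreal (D * r powr a)"
    using regular_measureD(5)[OF R r] by (rule order_trans[rotated])
qed

lemma measurable_unit_interval_continuous:
  fixes f :: "real \<Rightarrow> 'a::topological_space"
  assumes "continuous_on {0..<1} f"
  shows "f \<in> borel_measurable unit_interval"
  by (subst measurable_cong_sets[OF sets_restrict_space_cong[OF sets_lborel] refl])
     (rule borel_measurable_continuous_on_restrict[OF assms])

lemma measurable_ennreal_unit_interval: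
  assumes "continuous_on {0..<1} f"
  shows "(\<lambda>t. ennreal (f t)) \<in> borel_measurable unit_interval"
  by (rule measurable_compose[OF measurable_unit_interval_continuous[OF assms] measurable_ennreal])

lemma space_unit_interval: "space unit_interval = {0..<1}"
  by (simp add: space_restrict_space)

lemma unit_integral_mono:
  "(\<And>t. 0 \<le> t \<Longrightarrow> t < 1 \<Longrightarrow> f t \<le> g t) \<Longrightarrow> (\<integral>\<^sub>I t. f t) \<le> (\<integral>\<^sub>I t. g t)"
  by (rule nn_integral_mono) (auto simp: space_unit_interval)

lemma unit_integral_cong:
  "(\<And>t. 0 \<le> t \<Longrightarrow> t < 1 \<Longrightarrow> f t = g t) \<Longrightarrow> (\<integral>\<^sub>I t. f t) = (\<integral>\<^sub>I t. g t)"
  by (rule nn_integral_cong) (auto simp: space_unit_interval)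

text \<open>After multiplication by \<open>k + 1\<close> the moment has a kernel below the max
  kernel. The weight \<open>(k + 1) powr (p - 2)\<close> is this factor to the power
  \<open>p\<close> times the density of \<open>inv_square_weight\<close>.\<close>

lemma power_moment_bound:
  assumes p: "1 < p" and F: "F \<in> borel_measurable unit_interval"
  shows "(\<Sum>k. ennreal (real (k + 1) powr (p - 2)) * epowr (\<integral>\<^sub>I t. ennreal (t ^ k) * F t) p) \<le>
    ennreal (max_kernel_const p 2) * (\<integral>\<^sub>I t. epowr (F t) p)"
proof -
  have "(\<Sum>k. ennreal (real (k + 1) powr (p - 2)) * epowr (\<integral>\<^sub>I t. ennreal (t ^ k) * F t) p) \<le>
      (\<integral>\<^sup>+k. epowr (\<integral>\<^sub>I t. ennreal (1 / max (1 / real (k + 1)) (1 - t)) * F t) p \<partial>inv_square_weight)"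
    unfolding nn_integral_inv_square_weight
  proof (intro suminf_le summableI)
    fix k
    define a where "a = real (k + 1)"
    have a: "a > 0" by (simp add: a_def)
    have "1 / a\<^sup>2 * a powr p = a powr (p - 2)"
      using a by (simp add: powr_diff)
    then have e: "ennreal (a powr (p - 2)) = ennreal (1 / a\<^sup>2) * epowr (ennreal a) p"
      using a by (simp add: epowr_ennreal ennreal_mult[symmetric])
    have mm: "(\<lambda>t. ennreal (t ^ k) * F t) \<in> borel_measurable unit_interval"
      by (intro borel_measurable_times_ennreal F measurable_ennreal_unit_interval continuous_intros)
    have "ennreal (a powr (p - 2)) * epowr (\<integral>\<^sub>I t. ennreal (t ^ k) * F t) p =
        ennreal (1 / a\<^sup>2) * epowr (ennreal a * (\<integral>\<^sub>I t. ennreal (t ^ k) * F t)) p"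
      by (simp only: e epowr_mult mult.assoc)
    also have "ennreal a * (\<integral>\<^sub>I t. ennreal (t ^ k) * F t) = (\<integral>\<^sub>I t. ennreal a * (ennreal (t ^ k) * F t))"
      by (rule nn_integral_cmult[OF mm, symmetric])
    also have "ennreal (1 / a\<^sup>2) * epowr \<dots> p \<le>
        ennreal (1 / a\<^sup>2) * epowr (\<integral>\<^sub>I t. ennreal (1 / max (1 / a) (1 - t)) * F t) p"
    proof (intro mult_left_mono epowr_mono unit_integral_mono)
      fix t :: real assume t: "0 \<le> t" "t < 1"
      have "ennreal a * (ennreal (t ^ k) * F t) = ennreal (a * t ^ k) * F t"
        using a t by (simp add: ennreal_mult mult.assoc)
      also have "\<dots> \<le> ennreal (1 / max (1 / a) (1 - t)) * F t"
        unfolding a_def by (intro mult_right_mono ennreal_leI power_kernel_le t) simp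
      finally show "ennreal a * (ennreal (t ^ k) * F t) \<le> ennreal (1 / max (1 / a) (1 - t)) * F t" .
    qed (use p in auto)
    finally show "ennreal (real (k + 1) powr (p - 2)) * epowr (\<integral>\<^sub>I t. ennreal (t ^ k) * F t) p \<le>
      ennreal (1 / (real (k + 1))\<^sup>2) * epowr (\<integral>\<^sub>I t. ennreal (1 / max (1 / real (k + 1)) (1 - t)) * F t) p"
      unfolding a_def .
  qed
  also have "\<dots> \<le> ennreal (max_kernel_const p 2) * (\<integral>\<^sub>I t. epowr (F t) p)"
    by (rule max_kernel_bounded[OF p regular_inv_square_weight regular_measure_mono[OF regular_unit_interval] F]) simp
  finally show ?thesis .
qed

text \<open>The companion of \<open>power_moment_bound\<close> with the two measures exchanged. Here
  \<open>t ^ k\<close> is the density \<open>1 / (k + 1)^2\<close> times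
  \<open>(k + 1) * t ^ k\<close>, which is below the kernel, times a factor \<open>k + 1\<close>
  that is given to \<open>a k\<close>.\<close>

lemma power_series_bound:
  fixes a :: "nat \<Rightarrow> ennreal"
  assumes p: "1 < p"
  shows "(\<integral>\<^sub>I t. epowr (\<Sum>k. a k * ennreal (t ^ k)) p) \<le>
    ennreal (max_kernel_const p 2) * (\<Sum>k. epowr (a k) p * ennreal (real (k + 1) powr (p - 2)))"
proof -
  define F where "F k = ennreal (real (k + 1)) * a k" for k
  have "(\<integral>\<^sub>I t. epowr (\<Sum>k. a k * ennreal (t ^ k)) p) \<le>
     (\<integral>\<^sub>I t. epowr (\<integral>\<^sup>+k. ennreal (1 / max (1 - t) (1 / real (k + 1))) * F k \<partial>inv_square_weight) p)"
  proof (intro unit_integral_mono epowr_mono)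
    fix t :: real assume t: "0 \<le> t" "t < 1"
    show "(\<Sum>k. a k * ennreal (t ^ k)) \<le> (\<integral>\<^sup>+k. ennreal (1 / max (1 - t) (1 / real (k + 1))) * F k \<partial>inv_square_weight)"
      unfolding nn_integral_inv_square_weight
    proof (intro suminf_le summableI)
      fix k
      define b where "b = real (k + 1)"
      have b: "b > 0" by (simp add: b_def)
      have e: "1 / b\<^sup>2 * (b * t ^ k) * b = t ^ k" using b by (simp add: power2_eq_square)
      have "a k * ennreal (t ^ k) = ennreal (1 / b\<^sup>2) * (ennreal (b * t ^ k) * (ennreal b * a k))"
      proof -
        have "ennreal (1 / b\<^sup>2 * (b * t ^ k) * b) = ennreal (1 / b\<^sup>2) * ennreal (b * t ^ k) * ennreal b"
          using b t by (subst ennreal_mult, simp, simp, subst ennreal_mult) simp_all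
        then have "ennreal (t ^ k) = ennreal (1 / b\<^sup>2) * ennreal (b * t ^ k) * ennreal b"
          by (simp only: e)
        then show ?thesis by (simp only: mult_ac)
      qed
      also have "\<dots> \<le> ennreal (1 / b\<^sup>2) * (ennreal (1 / max (1 - t) (1 / b)) * (ennreal b * a k))"
        using power_kernel_le[OF t, of k]
        by (intro mult_left_mono mult_right_mono ennreal_leI) (simp_all add: b_def max.commute)
      finally show "a k * ennreal (t ^ k) \<le> ennreal (1 / (real (k + 1))\<^sup>2) * (ennreal (1 / max (1 - t) (1 / real (k + 1))) * F k)"
        by (simp add: b_def F_def)
    qed
  qed (use p in auto)
  also have "\<dots> \<le> ennreal (max_kernel_const p 2) * (\<integral>\<^sup>+k. epowr (F k) p \<partial>inv_square_weight)"
    by (rule max_kernel_bounded[OF p regular_measure_mono[OF regular_unit_interval] regular_inv_square_weight]) simp_all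
  also have "(\<integral>\<^sup>+k. epowr (F k) p \<partial>inv_square_weight) = (\<Sum>k. epowr (a k) p * ennreal (real (k + 1) powr (p - 2)))"
    unfolding nn_integral_inv_square_weight
  proof (rule suminf_cong)
    fix k
    define b where "b = real (k + 1)"
    have b: "b > 0" by (simp add: b_def)
    have "1 / b\<^sup>2 * b powr p = b powr (p - 2)"
      using b by (simp add: powr_diff)
    then have e: "ennreal (1 / b\<^sup>2) * epowr (ennreal b) p = ennreal (b powr (p - 2))"
      using b by (simp add: epowr_ennreal ennreal_mult[symmetric])
    show "ennreal (1 / (real (k + 1))\<^sup>2) * epowr (F k) p = epowr (a k) p * ennreal (real (k + 1) powr (p - 2))"
      unfolding F_def epowr_mult b_def[symmetric] mult.assoc[symmetric] e by (rule mult.commute)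
  qed
  finally show ?thesis .
qed

text \<open>The \<open>k\<close>-th derivative of the Cauchy transform of \<open>\<phi>\<close> on \<open>[0, 1]\<close>.\<close>

definition cauchy_kernel_integral :: "(real \<Rightarrow> real) \<Rightarrow> nat \<Rightarrow> complex \<Rightarrow> complex" where
  "cauchy_kernel_integral \<phi> k z =
     integral {0..1} (\<lambda>t. of_real (\<phi> t * fact k * t ^ k) * inverse (1 - of_real t * z) ^ Suc k)"

abbreviation cauchy_transform :: "(real \<Rightarrow> real) \<Rightarrow> complex \<Rightarrow> complex" where
  "cauchy_transform \<phi> \<equiv> cauchy_kernel_integral \<phi> 0"

lemma one_minus_scaled_nonzero:
  fixes z :: complex
  assumes "norm z < 1" "0 \<le> t" "t \<le> 1"
  shows "1 - of_real t * z \<noteq> 0"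
proof
  assume "1 - of_real t * z = 0"
  then have "of_real t * z = 1" by simp
  then have "norm (of_real t * z) = 1" by (metis norm_one)
  then have "t * norm z = 1" using assms by (simp add: norm_mult)
  moreover have "t * norm z \<le> norm z" using assms by (simp add: mult_left_le_one_le)
  ultimately show False using assms by simp
qed

lemma continuous_on_cauchy_integrand:
  assumes phi: "continuous_on {0..1} \<phi>" and z: "norm z < 1"
  shows "continuous_on {0..1} (\<lambda>t. of_real (\<phi> t * fact k * t ^ k) * inverse (1 - of_real t * z) ^ Suc k :: complex)"
  by (intro continuous_on_mult continuous_on_of_real continuous_on_power continuous_on_inverse continuous_on_diff
      continuous_on_const continuous_on_id phi ballI one_minus_scaled_nonzero z) auto

text \<open>Differentiation under the integral sign, possible because \<open>1 - t * z\<close> has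
  no zero for \<open>z\<close> in the disc and \<open>t\<close> up to 1. Treating all orders
  \<open>k\<close> at once yields the higher derivatives by induction.\<close>

lemma cauchy_kernel_integral_deriv:
  assumes phi: "continuous_on {0..1} \<phi>" and z: "norm z < 1"
  shows "(cauchy_kernel_integral \<phi> k has_field_derivative cauchy_kernel_integral \<phi> (Suc k) z) (at z)"
proof -
  let ?f = "\<lambda>k z t. of_real (\<phi> t * fact k * t ^ k) * inverse (1 - of_real t * z) ^ Suc k :: complex"
  have "((\<lambda>x. integral (cbox 0 1) (?f k x)) has_field_derivative integral (cbox 0 1) (?f (Suc k) z)) (at z within ball 0 1)"
  proof (rule leibniz_rule_field_derivative)
    fix x :: complex and t :: real assume x: "x \<in> ball 0 1" and t: "t \<in> cbox 0 1"
    have nz: "1 - of_real t * x \<noteq> 0" using x t by (intro one_minus_scaled_nonzero) auto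
    have i: "((\<lambda>x. inverse (1 - of_real t * x)) has_field_derivative of_real t * inverse (1 - of_real t * x) ^ 2) (at x within ball 0 1)"
      using nz by (auto intro!: derivative_eq_intros simp: power2_eq_square)
    have "((\<lambda>x. ?f k x t) has_field_derivative
        of_real (\<phi> t * fact k * t ^ k) * (of_nat (Suc k) * (of_real t * inverse (1 - of_real t * x) ^ 2 * inverse (1 - of_real t * x) ^ (Suc k - Suc 0)))) (at x within ball 0 1)"
      by (rule DERIV_cmult[OF DERIV_power[OF i]])
    also have "of_real (\<phi> t * fact k * t ^ k) * (of_nat (Suc k) * (of_real t * inverse (1 - of_real t * x) ^ 2 * inverse (1 - of_real t * x) ^ (Suc k - Suc 0))) = ?f (Suc k) x t"
      by (simp add: power2_eq_square algebra_simps)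
    finally show "((\<lambda>x. ?f k x t) has_field_derivative ?f (Suc k) x t) (at x within ball 0 1)" .
  next
    fix x :: complex assume "x \<in> ball 0 1"
    then show "?f k x integrable_on cbox 0 1"
      using continuous_on_cauchy_integrand[OF phi, of x k] by (intro integrable_continuous) auto
  next
    have p1: "continuous_on (ball 0 1 \<times> cbox 0 1) (\<lambda>x::complex \<times> real. \<phi> (snd x))"
      by (rule continuous_on_compose2[OF phi continuous_on_snd[OF continuous_on_id]]) auto
    have nz: "1 - of_real (snd x) * fst x \<noteq> 0" if "x \<in> ball 0 1 \<times> cbox 0 1" for x :: "complex \<times> real"
      using that by (intro one_minus_scaled_nonzero) auto
    show "continuous_on (ball 0 1 \<times> cbox 0 1) (\<lambda>(x, t). ?f (Suc k) x t)"
      unfolding split_beta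
      by (intro continuous_on_mult continuous_on_of_real continuous_on_power continuous_on_inverse continuous_on_diff
          continuous_on_const continuous_on_id continuous_on_fst continuous_on_snd p1 ballI nz)
  qed (use z in \<open>auto simp: convex_ball\<close>)
  then have "(cauchy_kernel_integral \<phi> k has_field_derivative cauchy_kernel_integral \<phi> (Suc k) z) (at z within ball 0 1)"
    unfolding cauchy_kernel_integral_def[abs_def] by (simp only: cbox_interval)
  then show ?thesis using z by (simp add: at_within_open[of z "ball 0 1"])
qed

lemma cauchy_transform_higher_deriv:
  assumes phi: "continuous_on {0..1} \<phi>"
  shows "norm z < 1 \<Longrightarrow> (deriv ^^ k) (cauchy_transform \<phi>) z = cauchy_kernel_integral \<phi> k z"
proof (induction k arbitrary: z)
  case (Suc k)
  have "\<forall>\<^sub>F w in nhds z. w \<in> ball 0 1"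
    using Suc.prems by (intro eventually_nhds_in_open) auto
  then have "\<forall>\<^sub>F w in nhds z. (deriv ^^ k) (cauchy_transform \<phi>) w = cauchy_kernel_integral \<phi> k w"
    by eventually_elim (simp add: Suc.IH)
  then have "deriv ((deriv ^^ k) (cauchy_transform \<phi>)) z = deriv (cauchy_kernel_integral \<phi> k) z"
    by (intro deriv_cong_ev refl)
  also have "\<dots> = cauchy_kernel_integral \<phi> (Suc k) z"
    by (rule DERIV_imp_deriv[OF cauchy_kernel_integral_deriv[OF phi Suc.prems]])
  finally show ?case by simp
qed simp

lemma cauchy_transform_holomorphic:
  assumes "continuous_on {0..1} \<phi>"
  shows "cauchy_transform \<phi> holomorphic_on ball 0 1"
  unfolding holomorphic_on_open[OF open_ball]
  using cauchy_kernel_integral_deriv[OF assms, of _ 0] by (auto simp del: One_nat_def) blast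

text \<open>At 0 the kernel of the \<open>k\<close>-th derivative is \<open>fact k * t ^ k\<close>,
  so the coefficient is a moment of \<open>\<phi>\<close>; for nonnegative \<open>\<phi>\<close> its
  modulus is the moment itself.\<close>

lemma maclaurin_coeff_cauchy_transform:
  assumes phi: "continuous_on {0..1} \<phi>" and nn: "\<And>t. t \<in> {0..1} \<Longrightarrow> 0 \<le> \<phi> t"
  shows "enorm (maclaurin_coeff (cauchy_transform \<phi>) k) = (\<integral>\<^sub>I t. ennreal (t ^ k) * ennreal (\<phi> t))"
proof -
  have c: "continuous_on {0..1} (\<lambda>t. \<phi> t * t ^ k)" by (intro continuous_intros phi)
  have nn': "0 \<le> integral {0..1} (\<lambda>t. \<phi> t * t ^ k)"
    using nn by (intro integral_nonneg integrable_continuous_real c) auto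
  have "cauchy_kernel_integral \<phi> k 0 = integral {0..1} (\<lambda>t. complex_of_real (\<phi> t * t ^ k) * fact k)"
    by (simp add: cauchy_kernel_integral_def mult_ac)
  also have "\<dots> = integral {0..1} (\<lambda>t. complex_of_real (\<phi> t * t ^ k)) * fact k"
    by (rule integral_mult_left)
  also have "integral {0..1} (\<lambda>t. complex_of_real (\<phi> t * t ^ k)) = of_real (integral {0..1} (\<lambda>t. \<phi> t * t ^ k))"
    by (intro integral_unique has_integral_of_real integrable_integral integrable_continuous_real c)
  finally have "maclaurin_coeff (cauchy_transform \<phi>) k = of_real (integral {0..1} (\<lambda>t. \<phi> t * t ^ k))"
    by (simp add: maclaurin_coeff_def cauchy_transform_higher_deriv[OF phi])
  then have "enorm (maclaurin_coeff (cauchy_transform \<phi>) k) = ennreal (integral {0..1} (\<lambda>t. \<phi> t * t ^ k))"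
    using nn' by simp
  also have "\<dots> = (\<integral>\<^sub>I t. ennreal (\<phi> t * t ^ k))"
    using nn by (intro nn_integral_unit_interval_continuous[symmetric] c) auto
  also have "\<dots> = (\<integral>\<^sub>I t. ennreal (t ^ k) * ennreal (\<phi> t))"
    using nn by (intro nn_integral_cong) (auto simp: space_unit_interval ennreal_mult mult.commute)
  finally show ?thesis .
qed

lemma norm_cauchy_kernel_integral_le:
  assumes phi: "continuous_on {0..1} \<phi>" and nn: "\<And>t. t \<in> {0..1} \<Longrightarrow> 0 \<le> \<phi> t" and z: "norm z < 1"
  shows "enorm (cauchy_kernel_integral \<phi> k z) \<le>
    (\<integral>\<^sub>I t. ennreal (\<phi> t * fact k / norm (1 - of_real t * z) ^ Suc k))"
proof -
  let ?f = "\<lambda>t. of_real (\<phi> t * fact k * t ^ k) * inverse (1 - of_real t * z) ^ Suc k :: complex"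
  note c = continuous_on_cauchy_integrand[OF phi z, of k]
  have "norm (integral {0..1} ?f) \<le> integral {0..1} (\<lambda>t. norm (?f t))"
    by (intro integral_norm_bound_integral integrable_continuous_real continuous_on_norm c order_refl)
  then have "enorm (cauchy_kernel_integral \<phi> k z) \<le> ennreal (integral {0..1} (\<lambda>t. norm (?f t)))"
    unfolding cauchy_kernel_integral_def by (rule ennreal_leI)
  also have "\<dots> = (\<integral>\<^sub>I t. enorm (?f t))"
    by (intro nn_integral_unit_interval_continuous[symmetric] continuous_on_norm c) simp
  also have "\<dots> \<le> (\<integral>\<^sub>I t. ennreal (\<phi> t * fact k / norm (1 - of_real t * z) ^ Suc k))"
  proof (intro nn_integral_mono ennreal_leI)
    fix t assume "t \<in> space unit_interval"
    then have t: "0 \<le> t" "t < 1" "0 \<le> \<phi> t" using nn by (auto simp: space_unit_interval)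
    have "norm (?f t) = (\<phi> t * fact k) * t ^ k * (1 / norm (1 - of_real t * z) ^ Suc k)"
      using t by (simp add: norm_mult norm_power norm_inverse divide_inverse power_inverse)
    also have "\<dots> \<le> (\<phi> t * fact k) * 1 * (1 / norm (1 - of_real t * z) ^ Suc k)"
      using t by (intro mult_right_mono mult_left_mono power_le_one) auto
    finally show "norm (?f t) \<le> \<phi> t * fact k / norm (1 - of_real t * z) ^ Suc k" by simp
  qed
  finally show ?thesis .
qed

text \<open>Only \<open>t \<ge> s\<close> is kept. There \<open>F t \<ge> F s\<close> and the kernel
  is at least \<open>1 / (2 * (1 - s))\<close>, while the interval has length
  \<open>1 - s\<close>.\<close>

lemma cauchy_kernel_lower:
  assumes mono: "\<And>s t. 0 \<le> s \<Longrightarrow> s \<le> t \<Longrightarrow> t < 1 \<Longrightarrow> F s \<le> F t" and s: "0 \<le> s" "s < 1"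
  shows "F s \<le> 2 * (\<integral>\<^sub>I t. ennreal (1 / (1 - t * s)) * F t)"
proof -
  have "F s = 2 * (\<integral>\<^sub>I t. (ennreal (1 / (2 * (1 - s))) * F s) * indicator {s..<1} t)"
  proof -
    have "(\<integral>\<^sub>I t. (ennreal (1 / (2 * (1 - s))) * F s) * indicator {s..<1} t) =
        (ennreal (1 / (2 * (1 - s))) * F s) * emeasure unit_interval {s..<1}"
      using s by (intro nn_integral_cmult_indicator) (auto simp: sets_restrict_space_iff)
    also have "emeasure unit_interval {s..<1} = emeasure lborel {s..<1}"
      using s by (intro emeasure_restrict_space) auto
    also have "\<dots> = ennreal (1 - s)" using s by simp
    finally have e: "(\<integral>\<^sub>I t. (ennreal (1 / (2 * (1 - s))) * F s) * indicator {s..<1} t) =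
       ennreal (1 / (2 * (1 - s))) * F s * ennreal (1 - s)" .
    have "ennreal (1 / (2 * (1 - s))) * ennreal (1 - s) = ennreal (1 / (2 * (1 - s)) * (1 - s))"
      using s by (intro ennreal_mult[symmetric]) auto
    also have "1 / (2 * (1 - s)) * (1 - s) = 1 / 2" using s by (simp add: field_simps)
    finally have "2 * (ennreal (1 / (2 * (1 - s))) * ennreal (1 - s)) = ennreal 2 * ennreal (1 / 2)" by simp
    also have "\<dots> = ennreal (2 * (1 / 2))" by (intro ennreal_mult[symmetric]) auto
    finally have "2 * (ennreal (1 / (2 * (1 - s))) * ennreal (1 - s)) = 1" by simp
    then show ?thesis unfolding e by (metis mult.assoc mult.commute mult.right_neutral)
  qed
  also have "\<dots> \<le> 2 * (\<integral>\<^sub>I t. ennreal (1 / (1 - t * s)) * F t)"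
  proof (intro mult_left_mono unit_integral_mono)
    fix t :: real assume t: "0 \<le> t" "t < 1"
    show "(ennreal (1 / (2 * (1 - s))) * F s) * indicator {s..<1} t \<le> ennreal (1 / (1 - t * s)) * F t"
    proof (cases "s \<le> t")
      case True
      have "t * s < 1" using mult_left_le_one_le[of s t] t s by simp
      \<comment> \<open>With \<open>t * s\<close> replaced by the smaller \<open>s * s\<close>, this
        is the inequality \<open>0 \<le> (1 - s)^2\<close>.\<close>
      moreover have "1 - t * s \<le> 2 * (1 - s)"
      proof -
        have "s * s \<le> t * s" using True s by (intro mult_right_mono) auto
        moreover have "0 \<le> (1 - s) * (1 - s)" using s by simp
        ultimately show ?thesis by (simp add: algebra_simps)
      qed
      ultimately have "1 / (2 * (1 - s)) \<le> 1 / (1 - t * s)" by (intro divide_left_mono) auto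
      then have "ennreal (1 / (2 * (1 - s))) * F s \<le> ennreal (1 / (1 - t * s)) * F t"
        using mono[OF s(1) True t(2)] by (intro mult_mono ennreal_leI) auto
      then show ?thesis using t True by simp
    qed simp
  qed simp
  finally show ?thesis .
qed

section \<open>Norms of Cauchy transforms\<close>

text \<open>Continuity is required up to \<open>t = 1\<close>: the dilates of \<open>h\<close> have
  it, while \<open>h\<close> itself may be unbounded there. As \<open>C\<close> stands under the
  root, an integral of at most \<open>1 / C\<close> gives norm at most 1.\<close>

definition test_bounded :: "real \<Rightarrow> fnorm \<Rightarrow> real \<Rightarrow> bool" where
  "test_bounded p X C \<longleftrightarrow> (\<forall>\<phi>. continuous_on {0..1} \<phi> \<longrightarrow> (\<forall>t\<in>{0..1}. 0 \<le> \<phi> t) \<longrightarrow>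
     X (cauchy_transform \<phi>) \<le> epowr (ennreal C * (\<integral>\<^sub>I t. ennreal (\<phi> t powr p))) (1 / p))"

lemma borel_measurable_max_kernel_integral:
  assumes RM: "regular_measure a C M X" and RN: "regular_measure b D N Y" and [measurable]: "F \<in> borel_measurable N"
  shows "(\<lambda>x. \<integral>\<^sup>+y. ennreal (1 / max (X x) (Y y)) * F y \<partial>N) \<in> borel_measurable M"
proof -
  note [measurable] = regular_measureD(2)[OF RM] regular_measureD(2)[OF RN]
  interpret N: sigma_finite_measure N by (rule regular_measureD(1)[OF RN])
  show ?thesis by measurable
qed

text \<open>The size \<open>y\<close> is left free. For the Hardy space it is the distance of the
  boundary point \<open>cis \<theta>\<close> from 1, independent of the radius, so that one kernel
  serves all circles.\<close>

lemma cauchy_transform_le_max_kernel: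
  assumes phi: "continuous_on {0..1} \<phi>" and nn: "\<And>t. t \<in> {0..1} \<Longrightarrow> 0 \<le> \<phi> t" and z: "norm z < 1"
    and y: "\<And>t. 0 \<le> t \<Longrightarrow> t < 1 \<Longrightarrow> max y (1 - t) \<le> 2 * norm (1 - of_real t * z)"
  shows "enorm (cauchy_transform \<phi> z) \<le> (\<integral>\<^sub>I t. ennreal (1 / max y (1 - t)) * ennreal (2 * \<phi> t))"
proof -
  have "enorm (cauchy_transform \<phi> z) \<le> (\<integral>\<^sub>I t. ennreal (\<phi> t * fact 0 / norm (1 - of_real t * z) ^ Suc 0))"
    by (rule norm_cauchy_kernel_integral_le[OF phi nn z])
  also have "\<dots> \<le> (\<integral>\<^sub>I t. ennreal (1 / max y (1 - t)) * ennreal (2 * \<phi> t))"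
  proof (intro nn_integral_mono)
    fix t assume "t \<in> space unit_interval"
    then have t: "0 \<le> t" "t < 1" "0 \<le> \<phi> t" using nn by (auto simp: space_unit_interval)
    have m: "0 < max y (1 - t)" using t by simp
    have "1 / norm (1 - of_real t * z) \<le> 1 / (max y (1 - t) / 2)"
    proof -
      have "0 < norm (1 - of_real t * z)" using y[OF t(1,2)] m by linarith
      then show ?thesis using y[OF t(1,2)] m by (intro divide_left_mono mult_pos_pos) auto
    qed
    then have "\<phi> t * (1 / norm (1 - of_real t * z)) \<le> \<phi> t * (1 / (max y (1 - t) / 2))"
      using t by (intro mult_left_mono)
    also have "\<dots> = 1 / max y (1 - t) * (2 * \<phi> t)" by simp
    finally have "ennreal (\<phi> t * fact 0 / norm (1 - of_real t * z) ^ Suc 0) \<le> ennreal (1 / max y (1 - t) * (2 * \<phi> t))"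
      by (intro ennreal_leI) simp
    also have "\<dots> = ennreal (1 / max y (1 - t)) * ennreal (2 * \<phi> t)"
      using m t by (intro ennreal_mult) auto
    finally show "ennreal (\<phi> t * fact 0 / norm (1 - of_real t * z) ^ Suc 0) \<le> ennreal (1 / max y (1 - t)) * ennreal (2 * \<phi> t)" .
  qed
  finally show ?thesis .
qed

lemma measurable_scaled_unit_interval:
  assumes "continuous_on {0..1} \<phi>"
  shows "(\<lambda>t. ennreal (c * \<phi> t)) \<in> borel_measurable unit_interval"
proof -
  have "continuous_on {0..<1} (\<lambda>t. c * \<phi> t)"
    by (intro continuous_intros continuous_on_subset[OF assms]) auto
  then show ?thesis by (rule measurable_ennreal_unit_interval)
qed

lemma unit_integral_epowr_scaled:
  assumes phi: "continuous_on {0..1} \<phi>" and nn: "\<And>t. t \<in> {0..1} \<Longrightarrow> 0 \<le> \<phi> t" and c: "0 \<le> c" and p: "1 < p"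
  shows "(\<integral>\<^sub>I t. epowr (ennreal (c * \<phi> t)) p) = ennreal (c powr p) * (\<integral>\<^sub>I t. ennreal (\<phi> t powr p))"
proof -
  have "continuous_on {0..<1} (\<lambda>t. \<phi> t powr p)"
    using nn p by (intro continuous_on_powr' continuous_on_const continuous_on_subset[OF phi]) auto
  note m = measurable_ennreal_unit_interval[OF this]
  have "(\<integral>\<^sub>I t. epowr (ennreal (c * \<phi> t)) p) = (\<integral>\<^sub>I t. ennreal (c powr p) * ennreal (\<phi> t powr p))"
  proof (rule nn_integral_cong)
    fix t assume "t \<in> space unit_interval"
    then have "0 \<le> \<phi> t" using nn by (auto simp: space_unit_interval)
    then show "epowr (ennreal (c * \<phi> t)) p = ennreal (c powr p) * ennreal (\<phi> t powr p)"
      using c by (simp add: epowr_mult epowr_ennreal ennreal_mult)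
  qed
  also have "\<dots> = ennreal (c powr p) * (\<integral>\<^sub>I t. ennreal (\<phi> t powr p))"
    by (rule nn_integral_cmult[OF m])
  finally show ?thesis .
qed

text \<open>The Maclaurin coefficients of a Cauchy transform are the moments of
  \<open>\<phi>\<close>, so this is \<open>power_moment_bound\<close>.\<close>

lemma test_bounded_HL:
  assumes p: "1 < p"
  shows "test_bounded p (HL_norm p) (max_kernel_const p 2)"
  unfolding test_bounded_def
proof (intro allI impI)
  fix \<phi> :: "real \<Rightarrow> real" assume phi: "continuous_on {0..1} \<phi>" and nn: "\<forall>t\<in>{0..1}. 0 \<le> \<phi> t"
  let ?a = "\<lambda>k. norm (maclaurin_coeff (cauchy_transform \<phi>) k)"
  have "(\<Sum>k. ennreal (?a k powr p * real (k + 1) powr (p - 2))) =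
     (\<Sum>k. ennreal (real (k + 1) powr (p - 2)) * epowr (\<integral>\<^sub>I t. ennreal (t ^ k) * ennreal (1 * \<phi> t)) p)"
  proof (rule suminf_cong)
    fix k
    have "ennreal (?a k powr p * real (k + 1) powr (p - 2)) = ennreal (real (k + 1) powr (p - 2)) * epowr (ennreal (?a k)) p"
      by (simp only: mult.commute[of "?a k powr p"] epowr_ennreal[OF norm_ge_zero] ennreal_mult[OF powr_ge_zero powr_ge_zero])
    then show "ennreal (?a k powr p * real (k + 1) powr (p - 2)) =
       ennreal (real (k + 1) powr (p - 2)) * epowr (\<integral>\<^sub>I t. ennreal (t ^ k) * ennreal (1 * \<phi> t)) p"
      using nn by (simp only: maclaurin_coeff_cauchy_transform[OF phi] mult_1_left)
  qed
  also have "\<dots> \<le> ennreal (max_kernel_const p 2) * (\<integral>\<^sub>I t. epowr (ennreal (1 * \<phi> t)) p)"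
    by (rule power_moment_bound[OF p measurable_scaled_unit_interval[OF phi]])
  also have "(\<integral>\<^sub>I t. epowr (ennreal (1 * \<phi> t)) p) = (\<integral>\<^sub>I t. ennreal (\<phi> t powr p))"
    using nn by (subst unit_integral_epowr_scaled[OF phi _ _ p]) auto
  finally show "HL_norm p (cauchy_transform \<phi>) \<le> epowr (ennreal (max_kernel_const p 2) * (\<integral>\<^sub>I t. ennreal (\<phi> t powr p))) (1 / p)"
    unfolding HL_norm_def using p by (intro epowr_mono) auto
qed

section \<open>Cauchy transforms in the Hardy space\<close>

lemma continuous_on_circle:
  assumes f: "f holomorphic_on ball 0 1" and r: "0 < r" "r < 1"
  shows "continuous_on A (\<lambda>\<theta>. f (rcis r \<theta>))"
proof (rule continuous_on_compose2[OF holomorphic_on_imp_continuous_on[OF f]])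
  show "continuous_on A (rcis r)" by (intro continuous_on_rcis continuous_on_id continuous_on_const)
  show "rcis r ` A \<subseteq> ball 0 1" using r by (intro image_subsetI rcis_in_ball) auto
qed

lemma measurable_circle:
  assumes f: "f holomorphic_on ball 0 1" and r: "0 < r" "r < 1"
  shows "(\<lambda>\<theta>. enorm (f (rcis r \<theta>))) \<in> borel_measurable full_turn"
proof -
  have "(\<lambda>\<theta>. norm (f (rcis r \<theta>))) \<in> borel_measurable borel"
    by (intro borel_measurable_continuous_onI continuous_on_norm continuous_on_circle[OF f r])
  then have "(\<lambda>\<theta>. enorm (f (rcis r \<theta>))) \<in> borel_measurable lborel"
    using measurable_compose[OF _ measurable_ennreal] by simp
  then show ?thesis by (rule measurable_restrict_space1)
qed

lemma integral_mean_nn: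
  assumes f: "f holomorphic_on ball 0 1" and r: "0 < r" "r < 1" and p: "1 < p"
  shows "ennreal (integral_mean p r f) =
     epowr (ennreal (1 / (2 * pi)) * (\<integral>\<^sub>T \<theta>. epowr (enorm (f (rcis r \<theta>))) p)) (1 / p)"
proof -
  have c: "continuous_on {0..2 * pi} (\<lambda>\<theta>. norm (f (rcis r \<theta>)) powr p)"
    using p by (intro continuous_on_powr' continuous_on_norm continuous_on_circle[OF f r] continuous_on_const) auto
  have "(\<integral>\<^sub>T \<theta>. epowr (enorm (f (rcis r \<theta>))) p) = ennreal (integral {0..2 * pi} (\<lambda>\<theta>. norm (f (rcis r \<theta>)) powr p))"
    using nn_integral_Icc_continuous[OF c] by (simp add: epowr_ennreal)
  moreover have "0 \<le> integral {0..2 * pi} (\<lambda>\<theta>. norm (f (rcis r \<theta>)) powr p)"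
    by (intro integral_nonneg integrable_continuous_real c) simp
  ultimately show ?thesis
    by (simp only: integral_mean_def epowr_ennreal ennreal_mult[symmetric]) (simp add: epowr_ennreal ennreal_mult[symmetric])
qed

text \<open>The max kernel acts from the interval to the circle; 18 comes from
  \<open>regular_full_turn\<close>, and \<open>2 powr p\<close> from the factor 2 in
  \<open>norm_1_minus_scaled_ge\<close>. The bound does not involve the radius, so it survives the
  supremum.\<close>

lemma test_bounded_Hardy:
  assumes p: "1 < p"
  shows "test_bounded p (Hardy_norm p) (max_kernel_const p 18 * 2 powr p)"
  unfolding test_bounded_def
proof (intro allI impI)
  fix \<phi> :: "real \<Rightarrow> real" assume phi: "continuous_on {0..1} \<phi>" and "\<forall>t\<in>{0..1}. 0 \<le> \<phi> t"
  then have nn: "\<And>t. t \<in> {0..1} \<Longrightarrow> 0 \<le> \<phi> t" by simp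
  let ?I = "\<integral>\<^sub>I t. ennreal (\<phi> t powr p)"
  let ?B = "epowr (ennreal (max_kernel_const p 18 * 2 powr p) * ?I) (1 / p)"
  show "Hardy_norm p (cauchy_transform \<phi>) \<le> ?B"
    unfolding Hardy_norm_def
  proof (rule SUP_least)
    fix r :: real assume "r \<in> {0<..<1}"
    then have r: "0 < r" "r < 1" by auto
    have RT: "regular_measure 1 18 full_turn (\<lambda>\<theta>. norm (1 - cis \<theta> * 1))" by (rule regular_full_turn) simp
    have RU: "regular_measure 1 18 unit_interval (\<lambda>t. 1 - t)" by (rule regular_measure_mono[OF regular_unit_interval]) simp
    have "(\<integral>\<^sub>T \<theta>. epowr (enorm (cauchy_transform \<phi> (rcis r \<theta>))) p) \<le>
        (\<integral>\<^sub>T \<theta>. epowr (\<integral>\<^sub>I t. ennreal (1 / max (norm (1 - cis \<theta> * 1)) (1 - t)) * ennreal (2 * \<phi> t)) p)"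
    proof (intro nn_integral_mono epowr_mono cauchy_transform_le_max_kernel[OF phi nn])
      fix \<theta> :: real
      show "norm (rcis r \<theta>) < 1" using r by simp
      fix t :: real assume t: "0 \<le> t" "t < 1"
      have tr: "t * r \<le> t" using t r by (simp add: mult_left_le)
      \<comment> \<open>The radius is moved into the parameter: the inequality is applied to
        \<open>t * r\<close> and the boundary point, and
        \<open>1 - t * r \<ge> 1 - t\<close>.\<close>
      have "max (1 - t * r) (norm (1 - cis \<theta>)) \<le> 2 * norm (1 - of_real (t * r) * cis \<theta>)"
        using t r tr by (intro norm_1_minus_scaled_ge) auto
      then show "max (norm (1 - cis \<theta> * 1)) (1 - t) \<le> 2 * norm (1 - of_real t * rcis r \<theta>)"
        using tr by (simp add: rcis_def mult.assoc)
    qed (use p in auto)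
    also have "\<dots> \<le> ennreal (max_kernel_const p 18) * (\<integral>\<^sub>I t. epowr (ennreal (2 * \<phi> t)) p)"
      by (rule max_kernel_bounded[OF p RT RU measurable_scaled_unit_interval[OF phi]])
    also have "\<dots> = ennreal (max_kernel_const p 18 * 2 powr p) * ?I"
      using max_kernel_const_pos[OF p, of 18]
      by (subst unit_integral_epowr_scaled[OF phi nn _ p]) (auto simp: ennreal_mult mult.assoc)
    finally have le: "(\<integral>\<^sub>T \<theta>. epowr (enorm (cauchy_transform \<phi> (rcis r \<theta>))) p) \<le> ennreal (max_kernel_const p 18 * 2 powr p) * ?I" .
    have "ennreal (1 / (2 * pi)) * (\<integral>\<^sub>T \<theta>. epowr (enorm (cauchy_transform \<phi> (rcis r \<theta>))) p) \<le>
        1 * (ennreal (max_kernel_const p 18 * 2 powr p) * ?I)"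
    proof (rule mult_mono[OF _ le])
      have "1 / (2 * pi) \<le> 1" using pi_gt3 by simp
      then show "ennreal (1 / (2 * pi)) \<le> 1" by (metis ennreal_1 ennreal_leI)
    qed auto
    then show "ennreal (integral_mean p r (cauchy_transform \<phi>)) \<le> ?B"
      unfolding integral_mean_nn[OF cauchy_transform_holomorphic[OF phi] r p]
      using p by (intro epowr_mono) auto
  qed
qed

section \<open>Cauchy transforms in the Dirichlet-type space\<close>

lemma deriv_cauchy_transform:
  assumes "continuous_on {0..1} \<phi>" "norm z < 1"
  shows "deriv (cauchy_transform \<phi>) z = cauchy_kernel_integral \<phi> 1 z"
  using DERIV_imp_deriv[OF cauchy_kernel_integral_deriv[OF assms, of 0]] by simp

text \<open>Differentiation squares the kernel. One factor is at most
  \<open>2 / norm (1 - z)\<close> and leaves the integral, the other is at most twice the max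
  kernel; the 4 is their product.\<close>

lemma deriv_cauchy_transform_le:
  assumes phi: "continuous_on {0..1} \<phi>" and nn: "\<And>t. t \<in> {0..1} \<Longrightarrow> 0 \<le> \<phi> t" and z: "norm z < 1"
  shows "enorm (deriv (cauchy_transform \<phi>) z) \<le>
     ennreal (1 / norm (1 - z)) * (\<integral>\<^sub>I t. ennreal (1 / max (norm (1 - z)) (1 - t)) * ennreal (4 * \<phi> t))"
proof -
  have y0: "0 < norm (1 - z)" using z by auto
  have RU: "regular_measure 1 1 unit_interval (\<lambda>t. 1 - t)" by (rule regular_unit_interval)
  have m: "(\<lambda>t. ennreal (1 / max (norm (1 - z)) (1 - t)) * ennreal (4 * \<phi> t)) \<in> borel_measurable unit_interval"
    using y0 by (intro borel_measurable_times_ennreal measurable_scaled_unit_interval[OF phi] measurable_ennreal_unit_interval continuous_intros) auto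
  have "enorm (deriv (cauchy_transform \<phi>) z) \<le> (\<integral>\<^sub>I t. ennreal (\<phi> t * fact 1 / norm (1 - of_real t * z) ^ Suc 1))"
    unfolding deriv_cauchy_transform[OF phi z] by (rule norm_cauchy_kernel_integral_le[OF phi nn z])
  also have "\<dots> \<le> (\<integral>\<^sub>I t. ennreal (1 / norm (1 - z)) * (ennreal (1 / max (norm (1 - z)) (1 - t)) * ennreal (4 * \<phi> t)))"
  proof (intro nn_integral_mono)
    fix t assume "t \<in> space unit_interval"
    then have t: "0 \<le> t" "t < 1" "0 \<le> \<phi> t" using nn by (auto simp: space_unit_interval)
    define N where "N = norm (1 - of_real t * z)"
    define Mx where "Mx = max (norm (1 - z)) (1 - t)"
    have mx: "max (1 - t) (norm (1 - z)) \<le> 2 * N"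
      unfolding N_def using t z by (intro norm_1_minus_scaled_ge) auto
    have M0: "0 < Mx" using t by (simp add: Mx_def)
    have le: "Mx \<le> 2 * N" "norm (1 - z) \<le> 2 * N" using mx by (auto simp: Mx_def)
    have N0: "0 < N" using le M0 by linarith
    have "norm (1 - z) * Mx \<le> (2 * N) * (2 * N)" using le y0 M0 N0 by (intro mult_mono) auto
    then have "1 / (N * N) \<le> 4 / (norm (1 - z) * Mx)"
      using y0 M0 N0 by (simp add: field_simps)
    then have "\<phi> t * (1 / (N * N)) \<le> \<phi> t * (4 / (norm (1 - z) * Mx))" using t by (intro mult_left_mono)
    also have "\<dots> = 1 / norm (1 - z) * (1 / Mx * (4 * \<phi> t))" by simp
    finally have "ennreal (\<phi> t * fact 1 / N ^ Suc 1) \<le> ennreal (1 / norm (1 - z) * (1 / Mx * (4 * \<phi> t)))"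
      by (intro ennreal_leI) simp
    also have "\<dots> = ennreal (1 / norm (1 - z)) * (ennreal (1 / Mx) * ennreal (4 * \<phi> t))"
      using y0 M0 t by (simp only: ennreal_mult[symmetric] zero_le_divide_1_iff zero_le_mult_iff less_imp_le zero_le_numeral simp_thms)
    finally show "ennreal (\<phi> t * fact 1 / norm (1 - of_real t * z) ^ Suc 1) \<le>
       ennreal (1 / norm (1 - z)) * (ennreal (1 / max (norm (1 - z)) (1 - t)) * ennreal (4 * \<phi> t))"
      unfolding N_def Mx_def .
  qed
  also have "\<dots> = ennreal (1 / norm (1 - z)) * (\<integral>\<^sub>I t. ennreal (1 / max (norm (1 - z)) (1 - t)) * ennreal (4 * \<phi> t))"
    by (rule nn_integral_cmult[OF m])
  finally show ?thesis .
qed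

text \<open>
  Weighting area measure by \<open>1 / |1 - z|\<close> makes \<open>|1 - z|\<close> a size function of exponent 1, and
  \<open>1 - |z| \<le> |1 - z|\<close> absorbs the weight of the space.
\<close>

lemma test_bounded_Dirichlet:
  assumes p: "1 < p"
  shows "\<exists>C. 0 < C \<and> test_bounded p (Dirichlet_norm p) C"
proof -
  \<comment> \<open>The maximum with 1 lets the disc and the unit interval share one
    constant.\<close>
  define c0 where "c0 = max 1 (pi * near_const 2 1)"
  define D where "D = max_kernel_const p c0"
  define E where "E = max_kernel_const p 2"
  have c0: "1 \<le> c0" by (simp add: c0_def)
  have D0: "0 \<le> D" "0 \<le> E" using max_kernel_const_pos[OF p, of c0] max_kernel_const_pos[OF p, of 2] c0 by (auto simp: D_def E_def)
  have RD: "regular_measure 1 c0 (density unit_disc (\<lambda>z. ennreal (norm (1 - z) powr (- 1)))) (\<lambda>z. norm (1 - z))"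
  proof (rule regular_measure_mono)
    have two_minus_one: "2 - 1 = (1::real)" by simp
    have "regular_measure (2 - 1) (pi * near_const 2 1) (density unit_disc (\<lambda>z. ennreal (norm (1 - z) powr (- 1)))) (\<lambda>z. norm (1 - z))"
      by (rule regular_measure_density[OF regular_unit_disc]) simp_all
    then show "regular_measure 1 (pi * near_const 2 1) (density unit_disc (\<lambda>z. ennreal (norm (1 - z) powr (- 1)))) (\<lambda>z. norm (1 - z))"
      by (simp only: two_minus_one)
  qed (simp add: c0_def)
  have RU: "regular_measure 1 c0 unit_interval (\<lambda>t. 1 - t)"
    by (rule regular_measure_mono[OF regular_unit_interval c0])
  have "test_bounded p (Dirichlet_norm p) (D * 4 powr p + E + 1)"
    unfolding test_bounded_def
  proof (intro allI impI)
    fix \<phi> :: "real \<Rightarrow> real" assume phi: "continuous_on {0..1} \<phi>" and "\<forall>t\<in>{0..1}. 0 \<le> \<phi> t"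
    then have nn: "\<And>t. t \<in> {0..1} \<Longrightarrow> 0 \<le> \<phi> t" by simp
    let ?f = "cauchy_transform \<phi>"
    let ?I = "\<integral>\<^sub>I t. ennreal (\<phi> t powr p)"
    let ?K = "\<lambda>z. \<integral>\<^sub>I t. ennreal (1 / max (norm (1 - z)) (1 - t)) * ennreal (4 * \<phi> t)"
    have "(\<integral>\<^sup>+ z\<in>ball 0 1. ennreal (norm (deriv ?f z) powr p * (1 - norm z) powr (p - 1) / pi) \<partial>lborel) =
       (\<integral>\<^sup>+ z. ennreal (norm (deriv ?f z) powr p * (1 - norm z) powr (p - 1) / pi) \<partial>unit_disc)"
      by (subst nn_integral_restrict_space) auto
    also have "\<dots> \<le> (\<integral>\<^sup>+ z. ennreal (norm (1 - z) powr (- 1)) * epowr (?K z) p \<partial>unit_disc)"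
    proof (rule nn_integral_mono)
      fix z assume "z \<in> space unit_disc"
      then have z: "norm z < 1" by (simp add: space_restrict_space)
      have y0: "0 < norm (1 - z)" using z by auto
      define y where "y = norm (1 - z)"
      have le1: "1 - norm z \<le> y" unfolding y_def using norm_triangle_ineq2[of 1 z] by simp
      have "(1 - norm z) powr (p - 1) \<le> y powr (p - 1)"
        using z p le1 by (intro powr_mono2) auto
      then have "norm (deriv ?f z) powr p * (1 - norm z) powr (p - 1) / pi \<le> norm (deriv ?f z) powr p * y powr (p - 1) / 1"
        using pi_gt3 by (intro frac_le mult_left_mono) auto
      then have "ennreal (norm (deriv ?f z) powr p * (1 - norm z) powr (p - 1) / pi) \<le> ennreal (norm (deriv ?f z) powr p * y powr (p - 1))"
        by (intro ennreal_leI) simp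
      also have "\<dots> = epowr (enorm (deriv ?f z)) p * ennreal (y powr (p - 1))"
        by (simp add: epowr_ennreal ennreal_mult)
      also have "\<dots> \<le> epowr (ennreal (1 / y) * ?K z) p * ennreal (y powr (p - 1))"
        using deriv_cauchy_transform_le[OF phi nn z] p unfolding y_def[symmetric]
        by (intro mult_right_mono epowr_mono) auto
      also have "\<dots> = (ennreal ((1 / y) powr p) * ennreal (y powr (p - 1))) * epowr (?K z) p"
        by (simp only: epowr_mult epowr_ennreal[OF zero_le_divide_1_iff[THEN iffD2, OF norm_ge_zero]] y_def mult_ac)
      \<comment> \<open>The exponents \<open>- p\<close> and \<open>p - 1\<close> add up to
        \<open>- 1\<close>, exactly the density under which the disc has exponent 1.\<close>
      also have "ennreal ((1 / y) powr p) * ennreal (y powr (p - 1)) = ennreal (y powr (- 1))"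
      proof -
        have "(1 / y) powr p * y powr (p - 1) = y powr (- 1)"
          using y0 by (simp add: y_def powr_divide powr_diff powr_minus_divide)
        then show ?thesis by (simp only: ennreal_mult[symmetric] powr_ge_zero)
      qed
      finally show "ennreal (norm (deriv ?f z) powr p * (1 - norm z) powr (p - 1) / pi) \<le> ennreal (norm (1 - z) powr (- 1)) * epowr (?K z) p"
        unfolding y_def .
    qed
    also have "\<dots> = (\<integral>\<^sup>+ z. epowr (?K z) p \<partial>density unit_disc (\<lambda>z. ennreal (norm (1 - z) powr (- 1))))"
    proof (rule nn_integral_density[symmetric])
      have "(\<lambda>x. ennreal (x powr (- 1))) \<in> borel_measurable (borel :: real measure)" by measurable
      from measurable_compose[OF regular_measureD(2)[OF regular_unit_disc] this]
      show "(\<lambda>z. ennreal (norm (1 - z) powr (- 1))) \<in> borel_measurable unit_disc" .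
      show "(\<lambda>z. epowr (?K z) p) \<in> borel_measurable unit_disc"
        by (intro measurable_epowr borel_measurable_max_kernel_integral[OF regular_unit_disc regular_unit_interval] measurable_scaled_unit_interval[OF phi])
    qed
    also have "\<dots> \<le> ennreal D * (\<integral>\<^sub>I t. epowr (ennreal (4 * \<phi> t)) p)"
      unfolding D_def by (rule max_kernel_bounded[OF p RD RU measurable_scaled_unit_interval[OF phi]])
    also have "\<dots> = ennreal (D * 4 powr p) * ?I"
      using D0 by (subst unit_integral_epowr_scaled[OF phi nn _ p]) (auto simp: ennreal_mult mult.assoc)
    finally have 1: "(\<integral>\<^sup>+ z\<in>ball 0 1. ennreal (norm (deriv ?f z) powr p * (1 - norm z) powr (p - 1) / pi) \<partial>lborel) \<le> ennreal (D * 4 powr p) * ?I" .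
    \<comment> \<open>The value at 0 is the zeroth moment of \<open>\<phi>\<close>, hence a single
      term of the series in \<open>power_moment_bound\<close>.\<close>
    have "ennreal (norm (?f 0) powr p) = epowr (enorm (maclaurin_coeff ?f 0)) p"
      by (simp add: epowr_ennreal maclaurin_coeff_def)
    also have "\<dots> = ennreal (real (0 + 1) powr (p - 2)) * epowr (\<integral>\<^sub>I t. ennreal (t ^ 0) * ennreal (1 * \<phi> t)) p"
      using maclaurin_coeff_cauchy_transform[OF phi nn, of 0] by simp
    also have "\<dots> \<le> (\<Sum>k. ennreal (real (k + 1) powr (p - 2)) * epowr (\<integral>\<^sub>I t. ennreal (t ^ k) * ennreal (1 * \<phi> t)) p)"
      by (rule ennreal_le_suminf)
    also have "\<dots> \<le> ennreal E * (\<integral>\<^sub>I t. epowr (ennreal (1 * \<phi> t)) p)"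
      unfolding E_def by (rule power_moment_bound[OF p measurable_scaled_unit_interval[OF phi]])
    also have "(\<integral>\<^sub>I t. epowr (ennreal (1 * \<phi> t)) p) = ?I"
      by (subst unit_integral_epowr_scaled[OF phi nn _ p]) auto
    finally have 2: "ennreal (norm (?f 0) powr p) \<le> ennreal E * ?I" .
    have "ennreal (D * 4 powr p) * ?I + ennreal E * ?I = ennreal (D * 4 powr p + E) * ?I"
      using D0 by (simp add: distrib_right)
    also have "\<dots> \<le> ennreal (D * 4 powr p + E + 1) * ?I"
      by (intro mult_right_mono ennreal_leI) auto
    finally show "Dirichlet_norm p ?f \<le> epowr (ennreal (D * 4 powr p + E + 1) * ?I) (1 / p)"
      unfolding Dirichlet_norm_def using p add_mono[OF 1 2] by (intro epowr_mono) auto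
  qed
  moreover have "0 < D * 4 powr p + E + 1" using D0 by (simp add: add_nonneg_pos)
  ultimately show ?thesis by blast
qed

lemma test_bounded_spaces:
  assumes p: "1 < p" and X: "X \<in> {Hardy_norm p, Dirichlet_norm p, HL_norm p}"
  shows "\<exists>C. 0 < C \<and> test_bounded p X C"
proof -
  have "0 < max_kernel_const p 18 * 2 powr p" "0 < max_kernel_const p 2"
    using max_kernel_const_pos[OF p] by auto
  then show ?thesis
    using X test_bounded_Hardy[OF p] test_bounded_Dirichlet[OF p] test_bounded_HL[OF p] by blast
qed

section \<open>Integrals along rays\<close>

definition ray_bounded :: "real \<Rightarrow> fnorm \<Rightarrow> real \<Rightarrow> bool" where
  "ray_bounded p X C \<longleftrightarrow> (\<forall>f\<in>fspace X. \<forall>\<alpha>.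
     (\<integral>\<^sub>I t. epowr (enorm (f (rcis t \<alpha>))) p) \<le> ennreal C * epowr (X f) p)"

lemma fspaceD: "f \<in> fspace X \<Longrightarrow> f holomorphic_on ball 0 1"
  by (simp add: fspace_def)

lemma measurable_ray:
  assumes f: "f holomorphic_on ball 0 1"
  shows "(\<lambda>t. enorm (f (rcis t \<alpha>))) \<in> borel_measurable unit_interval"
  by (intro measurable_ennreal_unit_interval
      continuous_on_norm continuous_on_ray[OF f])

lemma ennreal_norm_sums_le:
  fixes c :: "nat \<Rightarrow> complex"
  assumes "c sums s"
  shows "enorm s \<le> (\<Sum>k. enorm (c k))"
proof (rule LIMSEQ_le_const2)
  show "(\<lambda>n. enorm (\<Sum>k<n. c k)) \<longlonglongrightarrow> enorm s"
    using assms unfolding sums_def by (intro tendsto_ennrealI tendsto_norm)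
  have "enorm (\<Sum>k<n. c k) \<le> (\<Sum>k. enorm (c k))" for n
  proof -
    have "enorm (\<Sum>k<n. c k) \<le> ennreal (\<Sum>k<n. norm (c k))" by (intro ennreal_leI norm_sum)
    also have "\<dots> = (\<Sum>k<n. enorm (c k))" by (rule sum_ennreal[symmetric]) simp
    also have "\<dots> \<le> (\<Sum>k. enorm (c k))" by (rule sum_le_suminf) auto
    finally show ?thesis .
  qed
  then show "\<exists>N. \<forall>n\<ge>N. enorm (\<Sum>k<n. c k) \<le> (\<Sum>k. enorm (c k))" by blast
qed

lemma maclaurin_sums:
  assumes f: "f holomorphic_on ball 0 1" and z: "norm z < 1"
  shows "(\<lambda>k. maclaurin_coeff f k * z ^ k) sums f z"
  using holomorphic_power_series[OF f, of z] z by (simp add: maclaurin_coeff_def)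

text \<open>The power series with coefficients \<open>norm (maclaurin_coeff f k)\<close> majorises
  \<open>f\<close> on every ray at once, and \<open>power_series_bound\<close> applies to
  it.\<close>

lemma ray_bounded_HL:
  assumes p: "1 < p"
  shows "ray_bounded p (HL_norm p) (max_kernel_const p 2)"
  unfolding ray_bounded_def
proof (intro ballI allI)
  fix f \<alpha> assume f: "f \<in> fspace (HL_norm p)"
  let ?a = "\<lambda>k. norm (maclaurin_coeff f k)"
  have "(\<integral>\<^sub>I t. epowr (enorm (f (rcis t \<alpha>))) p) \<le>
      (\<integral>\<^sub>I t. epowr (\<Sum>k. ennreal (?a k) * ennreal (t ^ k)) p)"
  proof (intro unit_integral_mono epowr_mono)
    fix t :: real assume t: "0 \<le> t" "t < 1"
    have "enorm (f (rcis t \<alpha>)) \<le> (\<Sum>k. enorm (maclaurin_coeff f k * rcis t \<alpha> ^ k))"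
      by (rule ennreal_norm_sums_le[OF maclaurin_sums[OF fspaceD[OF f]]]) (use t in simp)
    also have "\<dots> = (\<Sum>k. ennreal (?a k) * ennreal (t ^ k))"
      using t by (simp add: norm_mult norm_power ennreal_mult)
    finally show "enorm (f (rcis t \<alpha>)) \<le> (\<Sum>k. ennreal (?a k) * ennreal (t ^ k))" .
  qed (use p in auto)
  also have "\<dots> \<le> ennreal (max_kernel_const p 2) * (\<Sum>k. epowr (ennreal (?a k)) p * ennreal (real (k + 1) powr (p - 2)))"
    by (rule power_series_bound[OF p])
  also have "(\<Sum>k. epowr (ennreal (?a k)) p * ennreal (real (k + 1) powr (p - 2))) = epowr (HL_norm p f) p"
    using p by (simp add: HL_norm_def epowr_epowr epowr_ennreal ennreal_mult)
  finally show "(\<integral>\<^sub>I t. epowr (enorm (f (rcis t \<alpha>))) p) \<le> ennreal (max_kernel_const p 2) * epowr (HL_norm p f) p" .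
qed

text \<open>Cauchy's formula on the circle of radius \<open>r\<close>, at the point
  \<open>rcis (r * t) \<alpha>\<close>. The factor \<open>r\<close> cancels, and the max kernel
  between the interval and the circle remains, with a constant independent of
  \<open>r\<close>.\<close>

lemma ray_bound_circle:
  assumes f: "f holomorphic_on ball 0 1" and r: "0 < r" "r < 1" and p: "1 < p"
  shows "(\<integral>\<^sub>I t. epowr (enorm (f (rcis (r * t) \<alpha>))) p) \<le>
     ennreal (max_kernel_const p 18) * (\<integral>\<^sub>T \<theta>. epowr (enorm (f (rcis r \<theta>))) p)"
proof -
  let ?y = "\<lambda>\<theta>. norm (1 - cis \<theta> * cis (- \<alpha>))"
  have RT: "regular_measure 1 18 full_turn ?y" by (rule regular_full_turn) simp
  have RU: "regular_measure 1 18 unit_interval (\<lambda>t. 1 - t)" by (rule regular_measure_mono[OF regular_unit_interval]) simp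
  have "(\<integral>\<^sub>I t. epowr (enorm (f (rcis (r * t) \<alpha>))) p) \<le>
      (\<integral>\<^sub>I t. epowr (\<integral>\<^sub>T \<theta>. ennreal (1 / max (1 - t) (?y \<theta>)) * enorm (f (rcis r \<theta>))) p)"
  proof (intro unit_integral_mono epowr_mono)
    fix t :: real assume t: "0 \<le> t" "t < 1"
    let ?z = "rcis (r * t) \<alpha>"
    let ?F = "\<lambda>\<theta>. enorm (f (rcis r \<theta>))"
    have "norm (?z - 0) < r" using r t by (simp add: abs_mult)
    from Cauchy_formula_bound[OF f r this]
    have "enorm (f ?z) \<le> ennreal (1 / (2 * pi)) *
        (\<integral>\<^sub>T \<theta>. ennreal (norm (f (rcis r \<theta>)) * (r / norm (rcis r \<theta> - ?z))))"
      by (simp only: add_0_left)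
    also have "\<dots> \<le> ennreal (1 / (2 * pi)) *
        (\<integral>\<^sub>T \<theta>. ennreal 2 * (ennreal (1 / max (1 - t) (?y \<theta>)) * ?F \<theta>))"
    proof (intro mult_left_mono nn_integral_mono)
      fix \<theta> :: real
      \<comment> \<open>Only the relative angle matters, and \<open>norm (1 - \<zeta>)\<close> is
        the size function \<open>?y\<close> of the circle.\<close>
      define \<zeta> where "\<zeta> = cis (\<alpha> - \<theta>)"
      have "rcis r \<theta> - ?z = of_real r * cis \<theta> * (1 - of_real t * \<zeta>)"
        by (simp add: rcis_def \<zeta>_def algebra_simps cis_mult)
      then have n: "norm (rcis r \<theta> - ?z) = r * norm (1 - of_real t * \<zeta>)"
        using r by (simp add: norm_mult)
      have "1 - cis \<theta> * cis (- \<alpha>) = - (cis (\<theta> - \<alpha>) * (1 - \<zeta>))"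
        by (simp add: \<zeta>_def algebra_simps cis_mult)
      then have y: "?y \<theta> = norm (1 - \<zeta>)" by (simp add: norm_mult)
      have m: "max (1 - t) (norm (1 - \<zeta>)) \<le> 2 * norm (1 - of_real t * \<zeta>)"
        using t by (intro norm_1_minus_scaled_ge) (auto simp: \<zeta>_def)
      have m0: "0 < max (1 - t) (norm (1 - \<zeta>))" using t by simp
      have "r / norm (rcis r \<theta> - ?z) = 1 / norm (1 - of_real t * \<zeta>)"
        using r by (simp add: n)
      also have "\<dots> \<le> 1 / (max (1 - t) (norm (1 - \<zeta>)) / 2)"
      proof (intro divide_left_mono mult_pos_pos)
        show "0 < norm (1 - of_real t * \<zeta>)" using m m0 by linarith
      qed (use m m0 in auto)
      finally have "norm (f (rcis r \<theta>)) * (r / norm (rcis r \<theta> - ?z)) \<le> norm (f (rcis r \<theta>)) * (1 / (max (1 - t) (norm (1 - \<zeta>)) / 2))"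
        by (intro mult_left_mono) auto
      also have "\<dots> = 2 * (1 / max (1 - t) (norm (1 - \<zeta>)) * norm (f (rcis r \<theta>)))" by simp
      finally have "ennreal (norm (f (rcis r \<theta>)) * (r / norm (rcis r \<theta> - ?z))) \<le> ennreal (2 * (1 / max (1 - t) (norm (1 - \<zeta>)) * norm (f (rcis r \<theta>))))"
        by (rule ennreal_leI)
      also have "\<dots> = ennreal 2 * (ennreal (1 / max (1 - t) (norm (1 - \<zeta>))) * ?F \<theta>)"
      proof -
        have "0 \<le> 1 / max (1 - t) (norm (1 - \<zeta>))" using m0 by simp
        then show ?thesis
          by (simp only: ennreal_mult[OF zero_le_numeral mult_nonneg_nonneg[OF _ norm_ge_zero]] ennreal_mult[OF _ norm_ge_zero])
      qed
      finally show "ennreal (norm (f (rcis r \<theta>)) * (r / norm (rcis r \<theta> - ?z))) \<le> ennreal 2 * (ennreal (1 / max (1 - t) (?y \<theta>)) * ?F \<theta>)"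
        unfolding y .
    qed simp
    also have "(\<integral>\<^sub>T \<theta>. ennreal 2 * (ennreal (1 / max (1 - t) (?y \<theta>)) * ?F \<theta>)) =
        ennreal 2 * (\<integral>\<^sub>T \<theta>. ennreal (1 / max (1 - t) (?y \<theta>)) * ?F \<theta>)"
    proof (rule nn_integral_cmult)
      have "(\<lambda>x. ennreal (1 / max (1 - t) x)) \<in> borel_measurable (borel :: real measure)" by measurable
      from measurable_compose[OF regular_measureD(2)[OF RT] this] measurable_circle[OF f r]
      show "(\<lambda>\<theta>. ennreal (1 / max (1 - t) (?y \<theta>)) * ?F \<theta>) \<in> borel_measurable full_turn"
        by (rule borel_measurable_times_ennreal)
    qed
    also have "ennreal (1 / (2 * pi)) * (ennreal 2 * (\<integral>\<^sub>T \<theta>. ennreal (1 / max (1 - t) (?y \<theta>)) * ?F \<theta>)) \<le>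
        1 * (\<integral>\<^sub>T \<theta>. ennreal (1 / max (1 - t) (?y \<theta>)) * ?F \<theta>)"
      unfolding mult.assoc[symmetric]
    proof (rule mult_right_mono)
      have "1 / (2 * pi) * 2 \<le> 1" using pi_gt3 by simp
      then have "ennreal (1 / (2 * pi) * 2) \<le> ennreal 1" by (rule ennreal_leI)
      moreover have "ennreal (1 / (2 * pi) * 2) = ennreal (1 / (2 * pi)) * ennreal 2" by (rule ennreal_mult) auto
      ultimately show "ennreal (1 / (2 * pi)) * ennreal 2 \<le> 1" by (simp only: ennreal_1)
    qed simp
    finally show "enorm (f ?z) \<le> (\<integral>\<^sub>T \<theta>. ennreal (1 / max (1 - t) (?y \<theta>)) * ?F \<theta>)" by simp
  qed (use p in auto)
  also have "\<dots> \<le> ennreal (max_kernel_const p 18) * (\<integral>\<^sub>T \<theta>. epowr (enorm (f (rcis r \<theta>))) p)"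
    by (rule max_kernel_bounded[OF p RU RT measurable_circle[OF f r]])
  finally show ?thesis .
qed

text \<open>The shift by 2 keeps every term strictly between 0 and 1. These are the dilation factors
  and truncation radii of the limits below.\<close>

definition unit_seq :: "nat \<Rightarrow> real" where
  "unit_seq n = 1 - 1 / real (n + 2)"

lemma unit_seq_bounds: "0 < unit_seq n" "unit_seq n < 1"
  by (auto simp: unit_seq_def field_simps)

lemma unit_seq_mult:
  assumes "t \<in> {0..<1}"
  shows "0 \<le> unit_seq n * t" "unit_seq n * t < 1"
proof -
  show "0 \<le> unit_seq n * t" using unit_seq_bounds[of n] assms by simp
  have "unit_seq n * t \<le> t" using unit_seq_bounds[of n] assms by (intro mult_left_le_one_le) auto
  then show "unit_seq n * t < 1" using assms by simp
qed

lemma unit_seq_lim: "unit_seq \<longlonglongrightarrow> 1"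
proof -
  have "(\<lambda>n. 1 - 1 / real (n + 2)) \<longlonglongrightarrow> 1 - 0"
    by (intro tendsto_diff tendsto_const LIMSEQ_ignore_initial_segment[where k=2] lim_1_over_n)
  then show ?thesis by (simp add: unit_seq_def[abs_def])
qed

text \<open>\<open>ray_bound_circle\<close> for the radii \<open>unit_seq n\<close>, followed by
  Fatou's lemma. The factor \<open>2 * pi\<close> undoes the normalisation of the integral
  means.\<close>

lemma ray_bounded_Hardy:
  assumes p: "1 < p"
  shows "ray_bounded p (Hardy_norm p) (max_kernel_const p 18 * (2 * pi))"
  unfolding ray_bounded_def
proof (intro ballI allI)
  fix f \<alpha> assume "f \<in> fspace (Hardy_norm p)"
  then have f: "f holomorphic_on ball 0 1" by (rule fspaceD)
  define K where "K = max_kernel_const p 18"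
  have K: "0 \<le> K" using max_kernel_const_pos[OF p, of 18] by (simp add: K_def)
  let ?B = "ennreal (K * (2 * pi)) * epowr (Hardy_norm p f) p"
  have circ: "(\<integral>\<^sub>I t. epowr (enorm (f (rcis (r * t) \<alpha>))) p) \<le> ?B" if r: "0 < r" "r < 1" for r
  proof -
    let ?J = "\<integral>\<^sub>T \<theta>. epowr (enorm (f (rcis r \<theta>))) p"
    have "epowr (ennreal (integral_mean p r f)) p = ennreal (1 / (2 * pi)) * ?J"
      using p by (simp add: integral_mean_nn[OF f r p] epowr_epowr)
    then have "ennreal (2 * pi) * epowr (ennreal (integral_mean p r f)) p = (ennreal (2 * pi) * ennreal (1 / (2 * pi))) * ?J"
      by (simp only: mult.assoc)
    also have "ennreal (2 * pi) * ennreal (1 / (2 * pi)) = 1"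
      by (subst ennreal_mult[symmetric]) auto
    finally have J: "?J = ennreal (2 * pi) * epowr (ennreal (integral_mean p r f)) p" by simp
    have "ennreal (integral_mean p r f) \<le> Hardy_norm p f"
      unfolding Hardy_norm_def using r by (intro SUP_upper) auto
    then have "?J \<le> ennreal (2 * pi) * epowr (Hardy_norm p f) p"
      unfolding J using p by (intro mult_left_mono epowr_mono) auto
    then have "ennreal K * ?J \<le> ennreal K * (ennreal (2 * pi) * epowr (Hardy_norm p f) p)"
      by (rule mult_left_mono) simp
    also have "\<dots> = ?B" using K by (simp add: ennreal_mult mult.assoc)
    finally show ?thesis
      using ray_bound_circle[OF f r p, of \<alpha>] unfolding K_def by (rule order_trans[rotated])
  qed
  have mp: "(\<lambda>x. epowr x p) \<in> borel_measurable borel" by measurable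
  have "(\<integral>\<^sub>I t. epowr (enorm (f (rcis t \<alpha>))) p) \<le> ?B"
  proof (rule nn_integral_limit_le)
    fix t assume "t \<in> space unit_interval"
    then have t: "0 \<le> t" "t < 1" by (auto simp: space_unit_interval)
    have "isCont f (rcis t \<alpha>)"
      using holomorphic_on_imp_continuous_on[OF f] t by (simp add: continuous_on_eq_continuous_at)
    moreover have "(\<lambda>n. rcis (unit_seq n * t) \<alpha>) \<longlonglongrightarrow> rcis (1 * t) \<alpha>"
      unfolding rcis_def by (intro tendsto_mult tendsto_of_real unit_seq_lim tendsto_const)
    ultimately have "(\<lambda>n. f (rcis (unit_seq n * t) \<alpha>)) \<longlonglongrightarrow> f (rcis t \<alpha>)"
      using isCont_tendsto_compose[where g=f and l="rcis t \<alpha>"] by simp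
    then show "(\<lambda>n. epowr (enorm (f (rcis (unit_seq n * t) \<alpha>))) p) \<longlonglongrightarrow> epowr (enorm (f (rcis t \<alpha>))) p"
      using p unfolding epowr_ennreal[OF norm_ge_zero]
      by (intro tendsto_ennrealI tendsto_powr2 tendsto_norm tendsto_const always_eventually) auto
  next
    fix n
    have "continuous_on {0..<1} (\<lambda>t. f (rcis (unit_seq n * t) \<alpha>))"
    proof (rule continuous_on_compose2[OF holomorphic_on_imp_continuous_on[OF f]])
      show "continuous_on {0..<1} (\<lambda>t. rcis (unit_seq n * t) \<alpha>)"
        by (intro continuous_on_rcis continuous_on_mult continuous_on_id continuous_on_const)
      show "(\<lambda>t. rcis (unit_seq n * t) \<alpha>) ` {0..<1} \<subseteq> ball 0 1"
        using unit_seq_mult by (intro image_subsetI rcis_in_ball) auto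
    qed
    from continuous_on_norm[OF this]
    show "(\<lambda>t. epowr (enorm (f (rcis (unit_seq n * t) \<alpha>))) p) \<in> borel_measurable unit_interval"
      by (intro measurable_compose[OF _ mp] measurable_ennreal_unit_interval)
  qed (intro circ unit_seq_bounds)
  then show "(\<integral>\<^sub>I t. epowr (enorm (f (rcis t \<alpha>))) p) \<le> ennreal (max_kernel_const p 18 * (2 * pi)) * epowr (Hardy_norm p f) p"
    unfolding K_def .
qed

section \<open>Radial integrals in the Dirichlet-type space\<close>

lemma epowr_add_le:
  assumes p: "0 < p"
  shows "epowr (a + b) p \<le> ennreal (2 powr p) * (epowr a p + epowr b p)"
proof -
  have "a + b \<le> 2 * max a b" by (simp add: mult_2 add_mono)
  then have "epowr (a + b) p \<le> epowr (2 * max a b) p" using p by (intro epowr_mono) auto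
  also have "\<dots> = ennreal (2 powr p) * epowr (max a b) p"
    using epowr_ennreal[of 2 p] by (simp add: epowr_mult)
  also have "\<dots> \<le> ennreal (2 powr p) * (epowr a p + epowr b p)"
    by (intro mult_left_mono) (auto simp: max_def add_increasing add_increasing2)
  finally show ?thesis .
qed

text \<open>On \<open>0 \<le> s \<le> t\<close> the kernel \<open>1 / (1 - s)\<close> of Hardy's inequality equals \<open>1 / max (1 - t) (1 - s)\<close>.\<close>

lemma Hardy_inequality_ray:
  assumes f: "f holomorphic_on ball 0 1" and p: "1 < p"
  shows "(\<integral>\<^sub>I t. epowr (enorm (f (rcis t \<alpha>) - f 0)) p) \<le>
     ennreal (max_kernel_const p 1) * (\<integral>\<^sub>I s. epowr (ennreal ((1 - s) * norm (deriv f (rcis s \<alpha>)))) p)"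
proof -
  let ?d = "\<lambda>s. norm (deriv f (rcis s \<alpha>))"
  have f': "deriv f holomorphic_on ball 0 1" by (rule holomorphic_deriv[OF f open_ball])
  have cd: "continuous_on {0..<1} (\<lambda>s. (1 - s) * ?d s)"
    by (intro continuous_on_mult continuous_on_norm continuous_on_diff continuous_on_const continuous_on_id continuous_on_ray[OF f'])
  have md: "(\<lambda>s. ennreal ((1 - s) * ?d s)) \<in> borel_measurable unit_interval"
    by (intro measurable_ennreal_unit_interval cd)
  have "(\<integral>\<^sub>I t. epowr (enorm (f (rcis t \<alpha>) - f 0)) p) \<le>
      (\<integral>\<^sub>I t. epowr (\<integral>\<^sub>I s. ennreal (1 / max (1 - t) (1 - s)) * ennreal ((1 - s) * ?d s)) p)"
  proof (intro unit_integral_mono epowr_mono)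
    fix t :: real assume t: "0 \<le> t" "t < 1"
    have I: "((\<lambda>s. cis \<alpha> * deriv f (rcis s \<alpha>)) has_integral f (rcis t \<alpha>) - f 0) {0..t}"
      by (rule radial_fundamental_theorem) (use f t in \<open>auto intro: holomorphic_derivI[OF f open_ball]\<close>)
    have c: "continuous_on {0..t} (\<lambda>s. cis \<alpha> * deriv f (rcis s \<alpha>))"
      by (intro continuous_on_mult continuous_on_const continuous_on_ray_segment[OF f' t(2)])
    have "enorm (f (rcis t \<alpha>) - f 0) \<le> (\<integral>\<^sup>+s. enorm (cis \<alpha> * deriv f (rcis s \<alpha>)) \<partial>restrict_space lborel {0..t})"
      by (rule ennreal_norm_has_integral_le[OF c I])
    also have "\<dots> \<le> (\<integral>\<^sub>I s. ennreal (1 / max (1 - t) (1 - s)) * ennreal ((1 - s) * ?d s))"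
    proof (rule nn_integral_restrict_mono)
      fix s assume s: "s \<in> {0..t}"
      then have "1 / max (1 - t) (1 - s) * ((1 - s) * ?d s) = ?d s" using t by (simp add: max_def)
      then show "enorm (cis \<alpha> * deriv f (rcis s \<alpha>)) \<le> ennreal (1 / max (1 - t) (1 - s)) * ennreal ((1 - s) * ?d s)"
        using s t by (subst ennreal_mult[symmetric]) (auto simp: norm_mult)
    qed (use t in auto)
    finally show "enorm (f (rcis t \<alpha>) - f 0) \<le> (\<integral>\<^sub>I s. ennreal (1 / max (1 - t) (1 - s)) * ennreal ((1 - s) * ?d s))" .
  qed (use p in auto)
  also have "\<dots> \<le> ennreal (max_kernel_const p 1) * (\<integral>\<^sub>I s. epowr (ennreal ((1 - s) * ?d s)) p)"
    by (rule max_kernel_bounded[OF p regular_unit_interval regular_unit_interval md])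
  finally show ?thesis .
qed

text \<open>
  The disc of radius \<open>(1 - s) / 2\<close> about a point of modulus \<open>s\<close> meets only points \<open>w\<close> for which
  \<open>1 - s\<close> and \<open>1 - |w|\<close> are comparable, so that the area mean value property turns the radial
  integral into the area integral.
\<close>

lemma radial_le_area:
  assumes F: "F holomorphic_on ball 0 1" and p: "1 < p"
  shows "(\<integral>\<^sub>I s. epowr (ennreal ((1 - s) * norm (F (rcis s \<alpha>)))) p) \<le>
     ennreal (12 * 2 powr (p - 1)) * (\<integral>\<^sup>+ z\<in>ball 0 1. ennreal (norm (F z) powr p * (1 - norm z) powr (p - 1) / pi) \<partial>lborel)"
proof -
  \<comment> \<open>The 6 is 4 times 3 / 2: the 4 from the square of the radius
    \<open>(1 - s) / 2\<close>, the 3 / 2 from comparing \<open>1 / (1 - s)\<close> with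
    \<open>1 / (1 - norm w)\<close>. The other powers cost \<open>2 powr (p - 1)\<close>.
    Integration in \<open>s\<close> doubles \<open>B\<close>, whence the 12.\<close>
  define B where "B = 6 * 2 powr (p - 1)"
  have B0: "0 \<le> B" by (simp add: B_def)
  define H where "H w = ennreal (norm (F w) powr p * (1 - norm w) powr (p - 1) / pi) * indicator (ball 0 1) w" for w
  \<comment> \<open>The mean value disc is replaced by a weaker condition that forgets the direction
    \<open>\<alpha>\<close>. For fixed \<open>w\<close> it leaves a set of \<open>s\<close> of
    length at most \<open>2 * (1 - norm w)\<close>, which compensates the factor
    \<open>1 / (1 - norm w)\<close>.\<close>
  define k where "k s w = ennreal (B * (1 / (1 - norm w))) * indicator {s'. 1 - s' \<le> 2 * (1 - norm w)} s" for s :: real and w :: complex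
  have ch: "continuous_on (ball 0 1) (\<lambda>w. norm (F w) powr p * (1 - norm w) powr (p - 1) / pi)"
    using p by (intro continuous_on_divide continuous_on_mult continuous_on_powr' continuous_on_norm continuous_on_diff
       continuous_on_const continuous_on_id holomorphic_on_imp_continuous_on[OF F]) auto
  have "(\<lambda>w. enorm (norm (F w) powr p * (1 - norm w) powr (p - 1) / pi) * indicator (ball 0 1) w) \<in> borel_measurable borel"
    by (intro borel_measurable_norm_indicator ch) simp
  then have Hm: "H \<in> borel_measurable borel"
    by (simp add: H_def[abs_def] abs_mult)
  have pt: "epowr (ennreal ((1 - s) * norm (F (rcis s \<alpha>)))) p \<le> (\<integral>\<^sup>+w. k s w * H w \<partial>lborel)"
    if s: "0 \<le> s" "s < 1" for s
  proof -
    define c where "c = rcis s \<alpha>"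
    define R where "R = (1 - s) / 2"
    have R0: "0 < R" using s by (simp add: R_def)
    have nc: "norm c = s" using s by (simp add: c_def)
    have sub: "ball c R \<subseteq> ball 0 1"
    proof
      fix w assume "w \<in> ball c R"
      then have "norm (w - c) < R" by (simp add: dist_norm norm_minus_commute)
      moreover have "norm w \<le> norm c + norm (w - c)" using norm_triangle_ineq[of c "w - c"] by simp
      ultimately show "w \<in> ball 0 1" using nc s by (simp add: R_def field_simps)
    qed
    have "epowr (ennreal ((1 - s) * norm (F c))) p = ennreal ((1 - s) powr p) * ennreal (norm (F c) powr p)"
      using s by (simp add: epowr_mult epowr_ennreal ennreal_mult)
    also have "\<dots> \<le> ennreal ((1 - s) powr p) * (ennreal (1 / (pi * R\<^sup>2)) * (\<integral>\<^sup>+w. ennreal (norm (F w) powr p) * indicator (ball c R) w \<partial>lborel))"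
      by (intro mult_left_mono area_mean_value_powr[OF holomorphic_on_subset[OF F sub] R0 p]) simp
    also have "\<dots> = ennreal ((1 - s) powr p / (pi * R\<^sup>2)) * (\<integral>\<^sup>+w. ennreal (norm (F w) powr p) * indicator (ball c R) w \<partial>lborel)"
    proof -
      have "ennreal ((1 - s) powr p) * ennreal (1 / (pi * R\<^sup>2)) = ennreal ((1 - s) powr p * (1 / (pi * R\<^sup>2)))"
        by (intro ennreal_mult[symmetric]) auto
      then show ?thesis by (simp add: mult.assoc[symmetric])
    qed
    also have "\<dots> = (\<integral>\<^sup>+w. ennreal ((1 - s) powr p / (pi * R\<^sup>2)) * (ennreal (norm (F w) powr p) * indicator (ball c R) w) \<partial>lborel)"
    proof (rule nn_integral_cmult[symmetric])
      have "continuous_on (ball c R) (\<lambda>w. norm (F w) powr p)"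
        using p by (intro continuous_on_powr' continuous_on_norm continuous_on_const continuous_on_subset[OF holomorphic_on_imp_continuous_on[OF F] sub]) auto
      then have "(\<lambda>w. enorm (norm (F w) powr p) * indicator (ball c R) w) \<in> borel_measurable borel"
        by (intro borel_measurable_norm_indicator) auto
      then show "(\<lambda>w. ennreal (norm (F w) powr p) * indicator (ball c R) w) \<in> borel_measurable lborel" by simp
    qed
    also have "\<dots> \<le> (\<integral>\<^sup>+w. k s w * H w \<partial>lborel)"
    proof (rule nn_integral_mono)
      fix w :: complex
      show "ennreal ((1 - s) powr p / (pi * R\<^sup>2)) * (ennreal (norm (F w) powr p) * indicator (ball c R) w) \<le> k s w * H w"
      proof (cases "w \<in> ball c R")
        case True
        then have w1: "w \<in> ball 0 1" using sub by blast
        have d: "norm (w - c) < R" using True by (simp add: dist_norm norm_minus_commute)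
        define a where "a = 1 - s"
        define b where "b = 1 - norm w"
        have "norm w \<le> norm c + norm (w - c)" using norm_triangle_ineq[of c "w - c"] by simp
        then have ab: "a \<le> 2 * b" using d nc by (simp add: a_def b_def R_def field_simps)
        have "norm c \<le> norm w + norm (w - c)" using norm_triangle_ineq4[of w "w - c"] by simp
        then have ba: "2 * b \<le> 3 * a" using d nc by (simp add: a_def b_def R_def field_simps)
        have a0: "0 < a" and b0: "0 < b" using s w1 by (auto simp: a_def b_def)
        \<comment> \<open>The exponent \<open>p - 2\<close> may have either sign. It is split into
          \<open>p - 1\<close> and \<open>-1\<close>, and each part is compared in its own
          direction, by \<open>a \<le> 2 * b\<close> and \<open>2 * b \<le> 3 * a\<close>.\<close>
        have "a powr p / (pi * R\<^sup>2) = 4 / pi * (a powr (p - 1) * (1 / a))"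
          using a0 by (simp add: R_def a_def[symmetric] power2_eq_square powr_diff field_simps)
        also have "\<dots> \<le> 4 / pi * ((2 * b) powr (p - 1) * (3 / (2 * b)))"
        proof (intro mult_left_mono mult_mono)
          show "a powr (p - 1) \<le> (2 * b) powr (p - 1)" using a0 ab p by (intro powr_mono2) auto
          show "1 / a \<le> 3 / (2 * b)" using a0 b0 ba by (simp add: field_simps)
        qed (use a0 b0 in auto)
        also have "\<dots> = B * (1 / b) * (b powr (p - 1) / pi)"
          using b0 by (simp add: B_def powr_mult field_simps)
        finally have "a powr p / (pi * R\<^sup>2) * norm (F w) powr p \<le> B * (1 / b) * (b powr (p - 1) / pi) * norm (F w) powr p"
          by (rule mult_right_mono) simp
        also have "\<dots> = B * (1 / b) * (norm (F w) powr p * b powr (p - 1) / pi)" by simp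
        finally have "ennreal (a powr p / (pi * R\<^sup>2) * norm (F w) powr p) \<le> ennreal (B * (1 / b) * (norm (F w) powr p * b powr (p - 1) / pi))"
          by (rule ennreal_leI)
        also have "ennreal (a powr p / (pi * R\<^sup>2) * norm (F w) powr p) = ennreal (a powr p / (pi * R\<^sup>2)) * ennreal (norm (F w) powr p)"
          by (intro ennreal_mult) auto
        also have "ennreal (B * (1 / b) * (norm (F w) powr p * b powr (p - 1) / pi)) = ennreal (B * (1 / b)) * ennreal (norm (F w) powr p * b powr (p - 1) / pi)"
          using B0 b0 by (intro ennreal_mult) auto
        finally show ?thesis using True w1 ab by (simp add: k_def H_def a_def[symmetric] b_def[symmetric])
      qed simp
    qed
    finally show ?thesis unfolding c_def .
  qed
  interpret U: sigma_finite_measure unit_interval by (rule sigma_finite_restrict_lborel) simp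
  interpret P: pair_sigma_finite "lborel :: complex measure" unit_interval ..
  have km: "(\<lambda>(w, s). k s w * H w) \<in> borel_measurable (lborel \<Otimes>\<^sub>M unit_interval)"
  proof -
    let ?P = "(lborel :: complex measure) \<Otimes>\<^sub>M unit_interval"
    have k1: "(\<lambda>x. snd x) \<in> borel_measurable ?P"
    proof (rule measurable_compose[OF measurable_snd])
      show "(\<lambda>x. x) \<in> borel_measurable unit_interval" by (intro measurable_unit_interval_continuous continuous_on_id)
    qed
    have k2: "(\<lambda>x. 1 - norm (fst x)) \<in> borel_measurable ?P"
    proof (rule measurable_compose[OF measurable_fst])
      show "(\<lambda>x. 1 - norm x) \<in> borel_measurable (lborel :: complex measure)" by simp
    qed
    have k3: "{x \<in> space ?P. 1 - snd x \<le> 2 * (1 - norm (fst x))} \<in> sets ?P"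
      by (intro borel_measurable_le borel_measurable_diff borel_measurable_const k1 borel_measurable_times k2)
    have k4: "(\<lambda>x. ennreal (B * (1 / (1 - norm (fst x))))) \<in> borel_measurable ?P"
      by (intro measurable_compose[OF _ measurable_ennreal] borel_measurable_times borel_measurable_divide borel_measurable_const k2)
    let ?A = "{x \<in> space ?P. 1 - snd x \<le> 2 * (1 - norm (fst x))}"
    let ?g = "\<lambda>x. ennreal (B * (1 / (1 - norm (fst x)))) * indicator ?A x * H (fst x)"
    have "?g \<in> borel_measurable ?P"
      by (intro borel_measurable_times_ennreal k4 borel_measurable_indicator k3 measurable_compose[OF measurable_fst]) (simp add: Hm)
    moreover have "(\<lambda>(w, s). k s w * H w) \<in> borel_measurable ?P \<longleftrightarrow>
        ?g \<in> borel_measurable ?P"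
      by (rule measurable_cong) (auto simp: k_def split: split_indicator)
    ultimately show ?thesis by blast
  qed
  have "(\<integral>\<^sub>I s. epowr (ennreal ((1 - s) * norm (F (rcis s \<alpha>)))) p) \<le> (\<integral>\<^sub>I s. \<integral>\<^sup>+w. k s w * H w \<partial>lborel)"
    by (intro nn_integral_mono pt) (auto simp: space_unit_interval)
  also have "\<dots> = (\<integral>\<^sup>+w. \<integral>\<^sup>+s. k s w * H w \<partial>unit_interval \<partial>lborel)"
    using P.Fubini'[OF km] .
  also have "\<dots> \<le> (\<integral>\<^sup>+w. ennreal (2 * B) * H w \<partial>lborel)"
  proof (rule nn_integral_mono)
    fix w :: complex
    show "(\<integral>\<^sub>I s. k s w * H w) \<le> ennreal (2 * B) * H w"
    proof (cases "norm w < 1")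
      case True
      define b where "b = 1 - norm w"
      have b0: "0 < b" using True by (simp add: b_def)
      let ?A = "{s \<in> space unit_interval. 1 - s \<le> 2 * b}"
      have As: "?A \<in> sets unit_interval"
        using regular_measureD(2)[OF regular_unit_interval] by (intro borel_measurable_le) auto
      have "(\<integral>\<^sub>I s. k s w * H w) = (\<integral>\<^sub>I s. (ennreal (B * (1 / b)) * H w) * indicator ?A s)"
        by (intro nn_integral_cong) (auto simp: k_def b_def split: split_indicator)
      also have "\<dots> = (ennreal (B * (1 / b)) * H w) * emeasure unit_interval ?A"
        by (rule nn_integral_cmult_indicator[OF As])
      also have "\<dots> \<le> (ennreal (B * (1 / b)) * H w) * ennreal (1 * (2 * b) powr 1)"
        using b0 by (intro mult_left_mono regular_measureD(5)[OF regular_unit_interval]) auto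
      also have "\<dots> = (ennreal (B * (1 / b)) * ennreal (2 * b)) * H w" using b0 by (simp add: mult_ac)
      also have "ennreal (B * (1 / b)) * ennreal (2 * b) = ennreal (B * (1 / b) * (2 * b))"
        using B0 b0 by (intro ennreal_mult[symmetric]) auto
      also have "B * (1 / b) * (2 * b) = 2 * B" using b0 by simp
      finally show ?thesis .
    qed (simp add: H_def)
  qed
  also have "\<dots> = ennreal (2 * B) * (\<integral>\<^sup>+w. H w \<partial>lborel)"
    using Hm by (intro nn_integral_cmult) simp
  finally show ?thesis by (simp add: B_def H_def)
qed

text \<open>\<open>f - f 0\<close> is handled by Hardy's inequality along the ray followed by
  \<open>radial_le_area\<close>; then \<open>f 0\<close> is added back, whose power is the second
  summand of the norm. \<open>K + 1\<close> dominates the constants of both parts.\<close>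

lemma ray_bounded_Dirichlet:
  assumes p: "1 < p"
  shows "\<exists>C. 0 < C \<and> ray_bounded p (Dirichlet_norm p) C"
proof -
  define K where "K = max_kernel_const p 1 * (12 * 2 powr (p - 1))"
  have K0: "0 \<le> K" using max_kernel_const_pos[OF p, of 1] by (simp add: K_def)
  have "ray_bounded p (Dirichlet_norm p) (2 powr p * (K + 1))"
    unfolding ray_bounded_def
  proof (intro ballI allI)
    fix f \<alpha> assume "f \<in> fspace (Dirichlet_norm p)"
    then have f: "f holomorphic_on ball 0 1" by (rule fspaceD)
    have f': "deriv f holomorphic_on ball 0 1" by (rule holomorphic_deriv[OF f open_ball])
    let ?D = "\<integral>\<^sup>+ z\<in>ball 0 1. ennreal (norm (deriv f z) powr p * (1 - norm z) powr (p - 1) / pi) \<partial>lborel"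
    let ?c = "ennreal (norm (f 0) powr p)"
    have "(\<integral>\<^sub>I t. epowr (enorm (f (rcis t \<alpha>) - f 0)) p) \<le>
        ennreal (max_kernel_const p 1) * (\<integral>\<^sub>I s. epowr (ennreal ((1 - s) * norm (deriv f (rcis s \<alpha>)))) p)"
      by (rule Hardy_inequality_ray[OF f p])
    also have "\<dots> \<le> ennreal (max_kernel_const p 1) * (ennreal (12 * 2 powr (p - 1)) * ?D)"
      by (intro mult_left_mono radial_le_area[OF f' p]) simp
    also have "\<dots> = ennreal K * ?D"
      using max_kernel_const_pos[OF p, of 1] by (simp add: K_def ennreal_mult mult.assoc)
    finally have 1: "(\<integral>\<^sub>I t. epowr (enorm (f (rcis t \<alpha>) - f 0)) p) \<le> ennreal K * ?D" .
    have mp: "(\<lambda>x. epowr x p) \<in> borel_measurable borel" by measurable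
    have m1: "(\<lambda>t. epowr (enorm (f (rcis t \<alpha>) - f 0)) p) \<in> borel_measurable unit_interval"
      by (intro measurable_compose[OF _ mp] measurable_ray holomorphic_on_diff f holomorphic_on_const)
    have "(\<integral>\<^sub>I t. epowr (enorm (f (rcis t \<alpha>))) p) \<le>
        (\<integral>\<^sub>I t. ennreal (2 powr p) * (epowr (enorm (f (rcis t \<alpha>) - f 0)) p + ?c))"
    proof (rule nn_integral_mono)
      fix t
      have "enorm (f (rcis t \<alpha>)) \<le> ennreal (norm (f (rcis t \<alpha>) - f 0) + norm (f 0))"
        by (intro ennreal_leI) (metis diff_add_cancel norm_triangle_ineq)
      then have "epowr (enorm (f (rcis t \<alpha>))) p \<le> epowr (enorm (f (rcis t \<alpha>) - f 0) + enorm (f 0)) p"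
        using p by (intro epowr_mono) auto
      also have "\<dots> \<le> ennreal (2 powr p) * (epowr (enorm (f (rcis t \<alpha>) - f 0)) p + epowr (enorm (f 0)) p)"
        using p by (intro epowr_add_le) simp
      finally show "epowr (enorm (f (rcis t \<alpha>))) p \<le> ennreal (2 powr p) * (epowr (enorm (f (rcis t \<alpha>) - f 0)) p + ?c)"
        by (simp add: epowr_ennreal)
    qed
    also have "\<dots> = ennreal (2 powr p) * ((\<integral>\<^sub>I t. epowr (enorm (f (rcis t \<alpha>) - f 0)) p) + (\<integral>\<^sub>I t. ?c))"
      by (simp only: nn_integral_cmult[OF borel_measurable_add[OF m1 borel_measurable_const]] nn_integral_add[OF m1 borel_measurable_const])
    also have "(\<integral>\<^sub>I t. ?c) = ?c"
      by (simp add: emeasure_restrict_space space_unit_interval)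
    also have "ennreal (2 powr p) * ((\<integral>\<^sub>I t. epowr (enorm (f (rcis t \<alpha>) - f 0)) p) + ?c) \<le>
        ennreal (2 powr p) * (ennreal (K + 1) * (?D + ?c))"
    proof (rule mult_left_mono)
      have "ennreal K * ?D + 1 * ?c \<le> ennreal (K + 1) * ?D + ennreal (K + 1) * ?c"
      proof (intro add_mono mult_right_mono ennreal_leI)
        show "1 \<le> ennreal (K + 1)" using K0 by (metis ennreal_1 ennreal_leI le_add_same_cancel2)
      qed auto
      then show "(\<integral>\<^sub>I t. epowr (enorm (f (rcis t \<alpha>) - f 0)) p) + ?c \<le> ennreal (K + 1) * (?D + ?c)"
        using add_right_mono[OF 1, of ?c] by (simp only: distrib_left mult_1_left)
    qed simp
    also have "\<dots> = ennreal (2 powr p * (K + 1)) * epowr (Dirichlet_norm p f) p"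
      using p K0 by (simp add: Dirichlet_norm_def epowr_epowr ennreal_mult mult.assoc)
    finally show "(\<integral>\<^sub>I t. epowr (enorm (f (rcis t \<alpha>))) p) \<le> ennreal (2 powr p * (K + 1)) * epowr (Dirichlet_norm p f) p" .
  qed
  then show ?thesis using K0 by (intro exI[of _ "2 powr p * (K + 1)"]) simp
qed

lemma ray_bounded_spaces:
  assumes p: "1 < p" and X: "X \<in> {Hardy_norm p, Dirichlet_norm p, HL_norm p}"
  shows "\<exists>C. 0 < C \<and> ray_bounded p X C"
proof -
  have "0 < max_kernel_const p 18 * (2 * pi)" "0 < max_kernel_const p 2"
    using max_kernel_const_pos[OF p] by auto
  then show ?thesis
    using X ray_bounded_Hardy[OF p] ray_bounded_Dirichlet[OF p] ray_bounded_HL[OF p] by blast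
qed

section \<open>Symbols with nonnegative coefficients\<close>

lemma Hardy_inf_norm_le:
  assumes "\<And>r \<alpha>. 0 < r \<Longrightarrow> r < 1 \<Longrightarrow> enorm (f (rcis r \<alpha>)) \<le> K"
  shows "Hardy_inf_norm f \<le> K"
  unfolding Hardy_inf_norm_def using assms by (intro SUP_least) auto

lemma norm_le_Hardy_inf_norm:
  assumes "0 < r" "r < 1" "0 \<le> \<alpha>" "\<alpha> \<le> 2 * pi"
  shows "enorm (f (rcis r \<alpha>)) \<le> Hardy_inf_norm f"
  unfolding Hardy_inf_norm_def using assms by (intro SUP_upper2[of r] SUP_upper2[of \<alpha>]) auto

locale nonneg_symbol =
  fixes g :: "complex \<Rightarrow> complex"
  assumes g: "g holomorphic_on ball 0 1" and coeff: "maclaurin_coeff g n \<in> \<real>\<^sub>\<ge>\<^sub>0"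
begin

text \<open>These are the Maclaurin coefficients of \<open>deriv g\<close>, as
  \<open>maclaurin_coeff_deriv\<close> shows, taken as real numbers so that they can be
  ordered.\<close>

definition b :: "nat \<Rightarrow> real" where "b n = real (n + 1) * Re (maclaurin_coeff g (n + 1))"

definition h :: "real \<Rightarrow> real" where "h t = Re (deriv g (of_real t))"

lemma b_nonneg: "0 \<le> b n"
  using coeff[of "n + 1"] by (simp add: b_def complex_nonneg_Reals_iff)

lemma deriv_holomorphic: "deriv g holomorphic_on ball 0 1"
  by (rule holomorphic_deriv[OF g open_ball])

lemma maclaurin_coeff_deriv: "maclaurin_coeff (deriv g) n = of_real (b n)"
proof -
  have "of_real (Re (maclaurin_coeff g (n + 1))) = maclaurin_coeff g (n + 1)"
    using coeff[of "n + 1"] by (simp add: complex_nonneg_Reals_iff complex_eq_iff)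
  then have "of_real (b n) = of_nat (n + 1) * maclaurin_coeff g (n + 1)"
    by (simp add: b_def)
  also have "\<dots> = (deriv ^^ Suc n) g 0 / fact n"
  proof -
    have "(of_nat (Suc n) :: complex) \<noteq> 0" by (rule of_nat_neq_0)
    then have "of_nat (Suc n) * (D / fact (Suc n)) = D / fact n" for D :: complex
      unfolding fact_Suc by (simp del: of_nat_Suc)
    then show ?thesis by (simp only: maclaurin_coeff_def Suc_eq_plus1)
  qed
  also have "(deriv ^^ Suc n) g = (deriv ^^ n) (deriv g)" by (simp only: funpow_Suc_right o_apply)
  finally show ?thesis by (simp add: maclaurin_coeff_def)
qed

lemma deriv_sums:
  assumes "norm z < 1"
  shows "(\<lambda>n. of_real (b n) * z ^ n) sums deriv g z"
  using maclaurin_sums[OF deriv_holomorphic assms] by (simp add: maclaurin_coeff_deriv)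

lemma h_sums:
  assumes "0 \<le> t" "t < 1"
  shows "(\<lambda>n. b n * t ^ n) sums h t"
  using sums_Re[OF deriv_sums[of "of_real t"]] assms by (simp add: h_def flip: of_real_power)

lemma deriv_eq_h:
  assumes t: "0 \<le> t" "t < 1"
  shows "deriv g (of_real t) = of_real (h t)"
proof -
  have "(\<lambda>n. of_real (b n * t ^ n)) sums (of_real (h t) :: complex)"
    by (rule sums_of_real[OF h_sums[OF t]])
  then show ?thesis using deriv_sums[of "of_real t"] t by (simp add: sums_unique2)
qed

lemma h_nonneg: "0 \<le> t \<Longrightarrow> t < 1 \<Longrightarrow> 0 \<le> h t"
  using sums_le[OF _ sums_zero h_sums] b_nonneg by simp

lemma h_mono: "0 \<le> s \<Longrightarrow> s \<le> t \<Longrightarrow> t < 1 \<Longrightarrow> h s \<le> h t"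
  by (rule sums_le[OF _ h_sums h_sums]) (auto intro!: mult_left_mono power_mono b_nonneg)

lemma ennreal_h:
  assumes t: "0 \<le> t" "t < 1"
  shows "ennreal (h t) = (\<Sum>n. ennreal (b n * t ^ n))"
  using t by (intro suminf_ennreal_eq[symmetric] h_sums) (auto intro!: mult_nonneg_nonneg b_nonneg)

lemma norm_deriv_le_h:
  assumes t: "0 \<le> t" "t < 1"
  shows "norm (deriv g (rcis t \<alpha>)) \<le> h t"
proof -
  have "enorm (deriv g (rcis t \<alpha>)) \<le> (\<Sum>n. enorm (of_real (b n) * rcis t \<alpha> ^ n))"
    by (rule ennreal_norm_sums_le[OF deriv_sums]) (use t in simp)
  also have "\<dots> = (\<Sum>n. ennreal (b n * t ^ n))"
    using t by (simp add: norm_mult norm_power b_nonneg)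
  also have "\<dots> = ennreal (h t)" by (rule ennreal_h[OF t, symmetric])
  finally show ?thesis using h_nonneg[OF t] by simp
qed

lemma continuous_h: "continuous_on {0..<1} h"
proof -
  have "continuous_on {0..<1} (\<lambda>t. deriv g (rcis t 0))" by (rule continuous_on_ray[OF deriv_holomorphic])
  then have "continuous_on {0..<1} (\<lambda>t. Re (deriv g (rcis t 0)))" by (rule continuous_on_Re)
  then show ?thesis by (simp add: h_def[abs_def] rcis_def)
qed

lemma measurable_h: "(\<lambda>t. ennreal (h t)) \<in> borel_measurable unit_interval"
  by (intro measurable_ennreal_unit_interval continuous_h)

section \<open>The moments of \<open>h\<close> and the coefficient series\<close>

definition energy :: "real \<Rightarrow> ennreal" where
  "energy q = (\<integral>\<^sub>I t. epowr (ennreal (h t)) q)"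

abbreviation moment :: "nat \<Rightarrow> ennreal" where
  "moment k \<equiv> \<integral>\<^sub>I t. ennreal (t ^ k) * ennreal (h t)"

lemma nn_integral_power: "(\<integral>\<^sub>I t. ennreal (t ^ m)) = ennreal (1 / real (m + 1))"
proof -
  have "((\<lambda>t::real. t ^ m) has_integral 1 ^ Suc m / real (Suc m) - 0 ^ Suc m / real (Suc m)) {0..1}"
    by (rule fundamental_theorem_of_calculus)
       (auto intro!: derivative_eq_intros simp flip: has_real_derivative_iff_has_vector_derivative simp del: power_Suc)
  then have "integral {0..1} (\<lambda>t::real. t ^ m) = 1 / real (m + 1)" by (simp add: integral_unique)
  then show ?thesis
    by (subst nn_integral_unit_interval_continuous) (auto intro!: continuous_intros)
qed

lemma measurable_power: "(\<lambda>t::real. ennreal (t ^ m)) \<in> borel_measurable unit_interval"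
  by (intro measurable_ennreal_unit_interval continuous_intros)

text \<open>Expand \<open>h\<close> in its power series and integrate termwise:
  \<open>t ^ (n + k)\<close> has integral \<open>1 / (n + k + 1)\<close>. All terms are nonnegative,
  so the exchange is free, even for infinite sums.\<close>

lemma moment_eq: "moment k = (\<Sum>n. ennreal (real (n + 1) * Re (maclaurin_coeff g (n + 1)) / real (n + k + 1)))"
proof -
  have "moment k = (\<integral>\<^sub>I t. (\<Sum>n. ennreal (b n) * ennreal (t ^ (n + k))))"
  proof (rule unit_integral_cong)
    fix t :: real assume t: "0 \<le> t" "t < 1"
    have "ennreal (t ^ k) * ennreal (h t) = (\<Sum>n. ennreal (t ^ k) * ennreal (b n * t ^ n))"
      by (simp add: ennreal_h[OF t])
    also have "\<dots> = (\<Sum>n. ennreal (b n) * ennreal (t ^ (n + k)))"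
    proof (rule suminf_cong)
      fix n
      have "ennreal (t ^ k) * ennreal (b n * t ^ n) = ennreal (t ^ k * (b n * t ^ n))"
        using t b_nonneg[of n] by (intro ennreal_mult[symmetric]) auto
      also have "t ^ k * (b n * t ^ n) = b n * t ^ (n + k)" by (simp add: power_add)
      also have "ennreal \<dots> = ennreal (b n) * ennreal (t ^ (n + k))"
        using t b_nonneg[of n] by (intro ennreal_mult) auto
      finally show "ennreal (t ^ k) * ennreal (b n * t ^ n) = ennreal (b n) * ennreal (t ^ (n + k))" .
    qed
    finally show "ennreal (t ^ k) * ennreal (h t) = (\<Sum>n. ennreal (b n) * ennreal (t ^ (n + k)))" .
  qed
  also have "\<dots> = (\<Sum>n. \<integral>\<^sub>I t. ennreal (b n) * ennreal (t ^ (n + k)))"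
    by (intro nn_integral_suminf borel_measurable_times_ennreal borel_measurable_const measurable_power)
  also have "\<dots> = (\<Sum>n. ennreal (real (n + 1) * Re (maclaurin_coeff g (n + 1)) / real (n + k + 1)))"
  proof (rule suminf_cong)
    fix n
    have "(\<integral>\<^sub>I t. ennreal (b n) * ennreal (t ^ (n + k))) = ennreal (b n) * ennreal (1 / real (n + k + 1))"
      by (simp only: nn_integral_cmult[OF measurable_power] nn_integral_power)
    also have "\<dots> = ennreal (b n * (1 / real (n + k + 1)))"
      using b_nonneg[of n] by (intro ennreal_mult[symmetric]) auto
    finally show "(\<integral>\<^sub>I t. ennreal (b n) * ennreal (t ^ (n + k))) =
        ennreal (real (n + 1) * Re (maclaurin_coeff g (n + 1)) / real (n + k + 1))"
      by (simp add: b_def)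
  qed
  finally show ?thesis .
qed

lemma coeff_series_eq:
  "coeff_series q g = (\<Sum>k. ennreal (real (k + 1) powr (q - 2)) * epowr (moment k) q)"
  by (simp only: coeff_series_def moment_eq)

lemma coeff_series_le_energy:
  assumes "1 < q"
  shows "coeff_series q g \<le> ennreal (max_kernel_const q 2) * energy q"
  unfolding coeff_series_eq energy_def by (rule power_moment_bound[OF assms measurable_h])

text \<open>\<open>cauchy_kernel_lower\<close> for the increasing function \<open>h\<close>, with
  \<open>1 / (1 - t * s)\<close> expanded in powers of \<open>t * s\<close>. Thus \<open>h\<close>
  is recovered from its moments as an upper bound, up to the factor 2.\<close>

lemma h_le_moments:
  assumes s: "0 \<le> s" "s < 1"
  shows "ennreal (h s) \<le> 2 * (\<Sum>k. moment k * ennreal (s ^ k))"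
proof -
  have "ennreal (h s) \<le> 2 * (\<integral>\<^sub>I t. ennreal (1 / (1 - t * s)) * ennreal (h t))"
    using h_mono s by (intro cauchy_kernel_lower ennreal_leI) auto
  also have "(\<integral>\<^sub>I t. ennreal (1 / (1 - t * s)) * ennreal (h t)) =
      (\<integral>\<^sub>I t. (\<Sum>k. ennreal (t ^ k) * ennreal (h t) * ennreal (s ^ k)))"
  proof (rule unit_integral_cong)
    fix t :: real assume t: "0 \<le> t" "t < 1"
    have ts: "t * s < 1" using mult_left_le_one_le[of s t] t s by simp
    have "ennreal (1 / (1 - t * s)) = (\<Sum>k. ennreal (1 * (t * s) ^ k))"
      using t s ts by (intro suminf_ennreal_geometric[symmetric]) auto
    also have "\<dots> = (\<Sum>k. ennreal (t ^ k) * ennreal (s ^ k))"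
      using t s by (simp add: power_mult_distrib ennreal_mult)
    finally have "ennreal (1 / (1 - t * s)) * ennreal (h t) = (\<Sum>k. ennreal (t ^ k) * ennreal (s ^ k)) * ennreal (h t)"
      by simp
    also have "\<dots> = (\<Sum>k. ennreal (t ^ k) * ennreal (s ^ k) * ennreal (h t))"
      by (rule ennreal_suminf_multc[symmetric])
    also have "\<dots> = (\<Sum>k. ennreal (t ^ k) * ennreal (h t) * ennreal (s ^ k))"
      by (simp only: mult_ac)
    finally show "ennreal (1 / (1 - t * s)) * ennreal (h t) = (\<Sum>k. ennreal (t ^ k) * ennreal (h t) * ennreal (s ^ k))" .
  qed
  also have "\<dots> = (\<Sum>k. \<integral>\<^sub>I t. ennreal (t ^ k) * ennreal (h t) * ennreal (s ^ k))"
    by (intro nn_integral_suminf borel_measurable_times_ennreal borel_measurable_const measurable_power measurable_h)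
  also have "\<dots> = (\<Sum>k. moment k * ennreal (s ^ k))"
    by (intro suminf_cong nn_integral_multc borel_measurable_times_ennreal measurable_power measurable_h)
  finally show ?thesis .
qed

text \<open>By \<open>h_le_moments\<close> the function \<open>h\<close> lies below a power series
  with the moments as coefficients, to which \<open>power_series_bound\<close> applies;
  \<open>2 powr q\<close> is the factor 2 from there.\<close>

lemma energy_le_coeff_series:
  assumes q: "1 < q"
  shows "energy q \<le> ennreal (2 powr q * max_kernel_const q 2) * coeff_series q g"
proof -
  have e2: "epowr 2 q = ennreal (2 powr q)" using epowr_ennreal[of 2 q] by simp
  have ms: "(\<lambda>s. \<Sum>k. moment k * ennreal (s ^ k)) \<in> borel_measurable unit_interval"
    by (intro borel_measurable_suminf_order borel_measurable_times_ennreal borel_measurable_const measurable_power)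
  have mq: "(\<lambda>x. epowr x q) \<in> borel_measurable borel" by measurable
  have "energy q \<le> (\<integral>\<^sub>I s. ennreal (2 powr q) * epowr (\<Sum>k. moment k * ennreal (s ^ k)) q)"
    unfolding energy_def
  proof (rule unit_integral_mono)
    fix s :: real assume s: "0 \<le> s" "s < 1"
    have "epowr (ennreal (h s)) q \<le> epowr (2 * (\<Sum>k. moment k * ennreal (s ^ k))) q"
      using q by (intro epowr_mono h_le_moments s) simp
    then show "epowr (ennreal (h s)) q \<le> ennreal (2 powr q) * epowr (\<Sum>k. moment k * ennreal (s ^ k)) q"
      by (simp only: epowr_mult e2)
  qed
  also have "\<dots> = ennreal (2 powr q) * (\<integral>\<^sub>I s. epowr (\<Sum>k. moment k * ennreal (s ^ k)) q)"
    by (rule nn_integral_cmult[OF measurable_compose[OF ms mq]])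
  also have "\<dots> \<le> ennreal (2 powr q) * (ennreal (max_kernel_const q 2) * (\<Sum>k. epowr (moment k) q * ennreal (real (k + 1) powr (q - 2))))"
    by (intro mult_left_mono power_series_bound q) simp
  also have "\<dots> = ennreal (2 powr q * max_kernel_const q 2) * coeff_series q g"
    using less_imp_le[OF max_kernel_const_pos[OF q, of 2]]
    by (simp add: coeff_series_eq mult.assoc[symmetric] mult.commute[of "epowr _ q"] ennreal_mult)
  finally show ?thesis .
qed

section \<open>The operator bounded above by the energy, and the energy by the operator on test
  functions\<close>

lemma norm_T_op_le:
  assumes f: "f holomorphic_on ball 0 1" and r: "0 \<le> r" "r < 1"
  shows "enorm (T_op g f (rcis r \<alpha>)) \<le> (\<integral>\<^sub>I t. enorm (f (rcis t \<alpha>)) * ennreal (h t))"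
proof -
  have c: "continuous_on {0..r} (\<lambda>s. cis \<alpha> * (f (rcis s \<alpha>) * deriv g (rcis s \<alpha>)))"
    by (intro continuous_on_mult continuous_on_const continuous_on_ray_segment f deriv_holomorphic r)
  have "enorm (T_op g f (rcis r \<alpha>)) \<le>
      (\<integral>\<^sup>+s. enorm (cis \<alpha> * (f (rcis s \<alpha>) * deriv g (rcis s \<alpha>))) \<partial>restrict_space lborel {0..r})"
    by (rule ennreal_norm_has_integral_le[OF c T_op_radial[OF f g r]])
  also have "\<dots> \<le> (\<integral>\<^sub>I t. enorm (f (rcis t \<alpha>)) * ennreal (h t))"
  proof (rule nn_integral_restrict_mono)
    fix s assume "s \<in> {0..r}"
    then have s: "0 \<le> s" "s < 1" using r by auto
    have "enorm (cis \<alpha> * (f (rcis s \<alpha>) * deriv g (rcis s \<alpha>))) = enorm (f (rcis s \<alpha>)) * enorm (deriv g (rcis s \<alpha>))"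
      by (simp add: norm_mult ennreal_mult)
    also have "\<dots> \<le> enorm (f (rcis s \<alpha>)) * ennreal (h s)"
      by (intro mult_left_mono ennreal_leI norm_deriv_le_h s) simp
    finally show "enorm (cis \<alpha> * (f (rcis s \<alpha>) * deriv g (rcis s \<alpha>))) \<le> enorm (f (rcis s \<alpha>)) * ennreal (h s)" .
  qed (use r in auto)
  finally show ?thesis .
qed

lemma Hardy_inf_norm_T_op_le:
  assumes pq: "1 < p" "1 / p + 1 / q = 1" and f: "f holomorphic_on ball 0 1"
    and A: "\<And>\<alpha>. (\<integral>\<^sub>I t. epowr (enorm (f (rcis t \<alpha>))) p) \<le> A"
  shows "Hardy_inf_norm (T_op g f) \<le> epowr A (1 / p) * epowr (energy q) (1 / q)"
proof (rule Hardy_inf_norm_le)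
  fix r \<alpha> :: real assume r: "0 < r" "r < 1"
  have qp: "1 < q" "1 / q + 1 / p = 1" using conjugate_gt_1[OF pq] pq by auto
  have "enorm (T_op g f (rcis r \<alpha>)) \<le> (\<integral>\<^sub>I t. enorm (f (rcis t \<alpha>)) * ennreal (h t))"
    using r by (intro norm_T_op_le[OF f]) auto
  also have "\<dots> \<le> epowr (\<integral>\<^sub>I t. epowr (enorm (f (rcis t \<alpha>))) p) (1 / p) * epowr (\<integral>\<^sub>I t. epowr (ennreal (h t)) q) (1 / q)"
    by (rule nn_integral_Holder[OF qp measurable_ray[OF f] measurable_h])
  also have "\<dots> \<le> epowr A (1 / p) * epowr (energy q) (1 / q)"
    unfolding energy_def using pq by (intro mult_right_mono epowr_mono A) auto
  finally show "enorm (T_op g f (rcis r \<alpha>)) \<le> epowr A (1 / p) * epowr (energy q) (1 / q)" .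
qed

text \<open>For real \<open>s\<close> the kernel \<open>1 / (1 - t * s)\<close> is positive, so the
  transform is a real integral and the lower bound for increasing functions applies to its real
  part.\<close>

lemma cauchy_transform_real:
  assumes phi: "continuous_on {0..1} \<phi>" and nn: "\<And>t. t \<in> {0..1} \<Longrightarrow> 0 \<le> \<phi> t"
    and mono: "\<And>s t. 0 \<le> s \<Longrightarrow> s \<le> t \<Longrightarrow> t < 1 \<Longrightarrow> \<phi> s \<le> \<phi> t" and s: "0 \<le> s" "s < 1"
  shows "cauchy_transform \<phi> (of_real s) = of_real (Re (cauchy_transform \<phi> (of_real s)))"
    "\<phi> s \<le> 2 * Re (cauchy_transform \<phi> (of_real s))"
proof -
  let ?f = "\<lambda>t. \<phi> t * inverse (1 - t * s)"
  have ts: "t * s < 1" if "t \<in> {0..1}" for t using mult_left_le_one_le[of s t] that s by simp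
  have c: "continuous_on {0..1} ?f"
    by (intro continuous_on_mult continuous_on_inverse continuous_on_diff continuous_on_const continuous_on_id phi) (use ts in force)
  have nnf: "0 \<le> ?f t" if "t \<in> {0..1}" for t using nn[OF that] ts[OF that] by simp
  have "cauchy_transform \<phi> (of_real s) = integral {0..1} (\<lambda>t. of_real (?f t))"
    unfolding cauchy_kernel_integral_def by (rule integral_cong) simp
  also have "\<dots> = of_real (integral {0..1} ?f)"
    by (intro integral_unique has_integral_of_real integrable_integral integrable_continuous_real c)
  finally have eq: "cauchy_transform \<phi> (of_real s) = of_real (integral {0..1} ?f)" .
  then show "cauchy_transform \<phi> (of_real s) = of_real (Re (cauchy_transform \<phi> (of_real s)))" by simp
  have I0: "0 \<le> integral {0..1} ?f" by (intro integral_nonneg integrable_continuous_real c nnf)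
  have "ennreal (\<phi> s) \<le> 2 * (\<integral>\<^sub>I t. ennreal (1 / (1 - t * s)) * ennreal (\<phi> t))"
    using mono s by (intro cauchy_kernel_lower ennreal_leI) auto
  also have "(\<integral>\<^sub>I t. ennreal (1 / (1 - t * s)) * ennreal (\<phi> t)) = (\<integral>\<^sub>I t. ennreal (?f t))"
  proof (rule nn_integral_cong)
    fix t assume "t \<in> space unit_interval"
    then have t: "t \<in> {0..1}" by (auto simp: space_unit_interval)
    have "ennreal (1 / (1 - t * s)) * ennreal (\<phi> t) = ennreal (1 / (1 - t * s) * \<phi> t)"
      using nn[OF t] ts[OF t] by (intro ennreal_mult[symmetric]) auto
    then show "ennreal (1 / (1 - t * s)) * ennreal (\<phi> t) = ennreal (?f t)"
      by (simp add: divide_inverse mult.commute)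
  qed
  also have "\<dots> = ennreal (integral {0..1} ?f)"
    by (rule nn_integral_unit_interval_continuous[OF c nnf])
  also have "2 * ennreal (integral {0..1} ?f) = ennreal (2 * integral {0..1} ?f)"
    using I0 by (subst ennreal_mult) auto
  finally show "\<phi> s \<le> 2 * Re (cauchy_transform \<phi> (of_real s))"
    using I0 eq by simp
qed

text \<open>\<open>T_op\<close> is evaluated at radii below 1, so integrals are first bounded on
  \<open>{0..r}\<close>; Fatou's lemma removes the truncation.\<close>

lemma nn_integral_le_if_truncations_le:
  assumes F: "F \<in> borel_measurable unit_interval"
    and le: "\<And>r. 0 < r \<Longrightarrow> r < 1 \<Longrightarrow> (\<integral>\<^sup>+t. F t \<partial>restrict_space lborel {0..r}) \<le> K"
  shows "(\<integral>\<^sub>I t. F t) \<le> K"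
proof (rule nn_integral_limit_le)
  let ?u = "\<lambda>n t. F t * indicator {0..unit_seq n} t"
  fix n
  have "{0..unit_seq n} \<in> sets unit_interval"
    using unit_seq_bounds(2)[of n] by (auto simp: sets_restrict_space_iff)
  then show "?u n \<in> borel_measurable unit_interval"
    by (intro borel_measurable_times_ennreal F borel_measurable_indicator)
  have "(\<integral>\<^sub>I t. ?u n t) = (\<integral>\<^sup>+t. F t \<partial>restrict_space lborel {0..unit_seq n})"
    using unit_seq_bounds[of n] by (simp add: nn_integral_restrict_space) (intro nn_integral_cong, auto split: split_indicator)
  then show "(\<integral>\<^sub>I t. ?u n t) \<le> K" using le unit_seq_bounds by simp
next
  fix t assume "t \<in> space unit_interval"
  then have t: "0 \<le> t" "t < 1" by (auto simp: space_unit_interval)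
  have "eventually (\<lambda>n. t < unit_seq n) sequentially"
    using order_tendstoD(1)[OF unit_seq_lim t(2)] .
  then have "eventually (\<lambda>n. F t * indicator {0..unit_seq n} t = F t) sequentially"
    by eventually_elim (use t in simp)
  then show "(\<lambda>n. F t * indicator {0..unit_seq n} t) \<longlonglongrightarrow> F t" by (rule tendsto_eventually)
qed

text \<open>On the positive radius the integrand of \<open>T_op\<close> is real and nonnegative, so
  no cancellation occurs: the value at \<open>r\<close> is the integral of the Cauchy transform
  times \<open>h\<close>, and the transform is at least \<open>\<phi> / 2\<close>.\<close>

lemma pairing_le_T_op:
  assumes phi: "continuous_on {0..1} \<phi>" and nn: "\<And>t. t \<in> {0..1} \<Longrightarrow> 0 \<le> \<phi> t"
    and mono: "\<And>s t. 0 \<le> s \<Longrightarrow> s \<le> t \<Longrightarrow> t < 1 \<Longrightarrow> \<phi> s \<le> \<phi> t"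
  shows "(\<integral>\<^sub>I t. ennreal (\<phi> t) * ennreal (h t)) \<le> 2 * Hardy_inf_norm (T_op g (cauchy_transform \<phi>))"
proof (rule nn_integral_le_if_truncations_le)
  show "(\<lambda>t. ennreal (\<phi> t) * ennreal (h t)) \<in> borel_measurable unit_interval"
    using measurable_scaled_unit_interval[OF phi, of 1] by (intro borel_measurable_times_ennreal measurable_h) simp
  fix r :: real assume r: "0 < r" "r < 1"
  let ?f = "cauchy_transform \<phi>"
  let ?F = "\<lambda>s. Re (?f (of_real s))"
  note f = cauchy_transform_holomorphic[OF phi]
  have eq: "cis 0 * (?f (rcis s 0) * deriv g (rcis s 0)) = of_real (?F s * h s)" if "s \<in> {0..r}" for s
  proof -
    have s: "0 \<le> s" "s < 1" using that r by auto
    have "rcis s 0 = of_real s" by (simp add: rcis_def)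
    then show ?thesis
      using cauchy_transform_real(1)[OF phi nn mono s] deriv_eq_h[OF s] by (metis cis_zero mult_1 of_real_mult)
  qed
  have "((\<lambda>s. cis 0 * (?f (rcis s 0) * deriv g (rcis s 0))) has_integral T_op g ?f (rcis r 0)) {0..r}"
    using r by (intro T_op_radial[OF f g]) auto
  then have "((\<lambda>s. of_real (?F s * h s)) has_integral T_op g ?f (rcis r 0)) {0..r}"
    by (subst (asm) has_integral_cong[OF eq]) auto
  from has_integral_Re[OF this]
  have I: "((\<lambda>s. ?F s * h s) has_integral Re (T_op g ?f (rcis r 0))) {0..r}" by simp
  have F0: "\<phi> s \<le> 2 * ?F s" "0 \<le> \<phi> s" "0 \<le> h s" if "s \<in> {0..r}" for s
    using cauchy_transform_real(2)[OF phi nn mono, of s] nn[of s] h_nonneg[of s] that r by auto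
  have "(\<integral>\<^sup>+t. ennreal (\<phi> t) * ennreal (h t) \<partial>restrict_space lborel {0..r}) \<le> (\<integral>\<^sup>+t. ennreal (2 * (?F t * h t)) \<partial>restrict_space lborel {0..r})"
  proof (rule nn_integral_restrict_mono)
    fix t assume t: "t \<in> {0..r}"
    have "ennreal (\<phi> t) * ennreal (h t) = ennreal (\<phi> t * h t)" using F0[OF t] by (intro ennreal_mult[symmetric])
    also have "\<dots> \<le> ennreal (2 * ?F t * h t)" using F0[OF t] by (intro ennreal_leI mult_right_mono)
    finally show "ennreal (\<phi> t) * ennreal (h t) \<le> ennreal (2 * (?F t * h t))" by (simp add: mult.assoc)
  qed auto
  also have "\<dots> = ennreal (2 * Re (T_op g ?f (rcis r 0)))"
  proof (rule nn_integral_restrict_eq_integral)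
    show "0 \<le> 2 * (?F t * h t)" if "t \<in> {0..r}" for t using F0[OF that] by simp
    show "((\<lambda>t. 2 * (?F t * h t)) has_integral 2 * Re (T_op g ?f (rcis r 0))) {0..r}"
      by (rule has_integral_mult_right[OF I])
  qed simp
  also have "\<dots> \<le> ennreal (2 * norm (T_op g ?f (rcis r 0)))"
    by (intro ennreal_leI mult_left_mono complex_Re_le_cmod) simp
  also have "\<dots> = 2 * enorm (T_op g ?f (rcis r 0))"
    by (subst ennreal_mult) auto
  also have "\<dots> \<le> 2 * Hardy_inf_norm (T_op g ?f)"
    using r by (intro mult_left_mono norm_le_Hardy_inf_norm) auto
  finally show "(\<integral>\<^sup>+t. ennreal (\<phi> t) * ennreal (h t) \<partial>restrict_space lborel {0..r}) \<le> 2 * Hardy_inf_norm (T_op g ?f)" .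
qed

text \<open>The test function is a multiple \<open>c\<close> of a dilate of \<open>h\<close> to the
  power \<open>q - 1\<close>. With \<open>I\<close> the integral of the dilate to the power
  \<open>q\<close>, the pairing gives \<open>c * I \<le> 2 * B\<close>, which resolves to a bound on
  \<open>I\<close> uniform in the dilation. The hypothesis speaks of test functions, not of an
  operator norm, so that compactness can supply it as well.\<close>

lemma energy_le_if_tests_bounded:
  assumes pq: "1 < p" "1 / p + 1 / q = 1" and \<delta>: "0 < \<delta>" and B: "0 \<le> B"
    and tests: "\<And>\<phi>. continuous_on {0..1} \<phi> \<Longrightarrow> (\<forall>t\<in>{0..1}. 0 \<le> \<phi> t) \<Longrightarrow>
       (\<integral>\<^sub>I t. ennreal (\<phi> t powr p)) \<le> ennreal \<delta> \<Longrightarrow>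
       Hardy_inf_norm (T_op g (cauchy_transform \<phi>)) \<le> ennreal B"
  shows "energy q \<le> ennreal ((2 * B) powr q * \<delta> powr (- (q / p)))"
proof -
  let ?K = "(2 * B) powr q * \<delta> powr (- (q / p))"
  have q: "1 < q" using conjugate_gt_1[OF pq] .
  \<comment> \<open>Hence the power \<open>p\<close> of a test function is a multiple of the power
    \<open>q\<close> of the dilate.\<close>
  have qp: "(q - 1) * p = q"
  proof -
    have "p * q * (1 / p + 1 / q) = q + p" using pq(1) q by (simp only: distrib_left) simp
    then have "q + p = p * q" unfolding pq(2) by simp
    then show ?thesis by (simp add: algebra_simps)
  qed
  have dil: "(\<integral>\<^sub>I t. ennreal (h (\<rho> * t) powr q)) \<le> ennreal ?K" if \<rho>: "0 < \<rho>" "\<rho> < 1" for \<rho>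
  proof -
    have \<rho>t: "0 \<le> \<rho> * t" "\<rho> * t < 1" "\<rho> * t \<le> t" if "t \<in> {0..1}" for t
    proof -
      show "0 \<le> \<rho> * t" using \<rho> that by simp
      have "\<rho> * t \<le> \<rho>" using \<rho> that by (simp add: mult_left_le)
      then show "\<rho> * t < 1" using \<rho>(2) by (rule order_le_less_trans)
      show "\<rho> * t \<le> t" using \<rho> that by (intro mult_left_le_one_le) auto
    qed
    have ch: "continuous_on {0..1} (\<lambda>t. h (\<rho> * t))"
      by (rule continuous_on_compose2[OF continuous_h]) (use \<rho>t in \<open>auto intro!: continuous_intros\<close>)
    have h0: "0 \<le> h (\<rho> * t)" if "t \<in> {0..1}" for t using \<rho>t[OF that] by (intro h_nonneg) auto
    have chq: "continuous_on {0..1} (\<lambda>t. h (\<rho> * t) powr u)" if "0 < u" for u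
      using h0 that by (intro continuous_on_powr' ch continuous_on_const) auto
    define I where "I = integral {0..1} (\<lambda>t. h (\<rho> * t) powr q)"
    have I0: "0 \<le> I" unfolding I_def using q by (intro integral_nonneg integrable_continuous_real chq) auto
    have I: "(\<integral>\<^sub>I t. ennreal (h (\<rho> * t) powr q)) = ennreal I"
      unfolding I_def using q by (intro nn_integral_unit_interval_continuous chq) auto
    show ?thesis
    proof (cases "I = 0")
      case True
      then show ?thesis by (simp add: I)
    next
      case False
      then have Ip: "0 < I" using I0 by simp
      \<comment> \<open>Chosen so that \<open>c powr p * I = \<delta>\<close>; this divides by
        \<open>I\<close>, hence the separate case \<open>I = 0\<close>.\<close>
      define c where "c = (\<delta> / I) powr (1 / p)"
      have c0: "0 < c" using Ip \<delta> by (simp add: c_def)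
      define \<phi> where "\<phi> t = c * h (\<rho> * t) powr (q - 1)" for t
      have c1: "continuous_on {0..1} \<phi>"
        unfolding \<phi>_def[abs_def] using q by (intro continuous_on_mult continuous_on_const chq) simp
      have nn: "0 \<le> \<phi> t" for t using c0 by (simp add: \<phi>_def)
      have mono: "\<phi> s \<le> \<phi> t" if "0 \<le> s" "s \<le> t" "t < 1" for s t
      proof -
        have "h (\<rho> * s) \<le> h (\<rho> * t)"
          using that \<rho> \<rho>t[of s] \<rho>t[of t] by (intro h_mono) auto
        moreover have "0 \<le> h (\<rho> * s)" using that by (intro h0) auto
        ultimately show ?thesis
          unfolding \<phi>_def using c0 q by (intro mult_left_mono powr_mono2) auto
      qed
      have mq: "(\<lambda>t. ennreal (h (\<rho> * t) powr q)) \<in> borel_measurable unit_interval"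
        using q by (intro measurable_ennreal_unit_interval continuous_on_subset[OF chq]) auto
      have "(\<integral>\<^sub>I t. ennreal (\<phi> t powr p)) = (\<integral>\<^sub>I t. ennreal (c powr p) * ennreal (h (\<rho> * t) powr q))"
        using c0 qp by (simp add: \<phi>_def powr_mult powr_powr ennreal_mult)
      also have "\<dots> = ennreal (c powr p) * ennreal I"
        by (simp only: nn_integral_cmult[OF mq] I)
      also have "c powr p = \<delta> / I" using Ip \<delta> pq by (simp add: c_def powr_powr)
      also have "ennreal (\<delta> / I) * ennreal I = ennreal \<delta>" using Ip \<delta> by (simp add: ennreal_mult[symmetric])
      finally have "Hardy_inf_norm (T_op g (cauchy_transform \<phi>)) \<le> ennreal B"
        using nn by (intro tests c1) auto
      then have "(\<integral>\<^sub>I t. ennreal (\<phi> t) * ennreal (h t)) \<le> 2 * ennreal B"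
        by (intro order_trans[OF pairing_le_T_op[OF c1 nn mono]] mult_left_mono) auto
      moreover have "ennreal c * ennreal I \<le> (\<integral>\<^sub>I t. ennreal (\<phi> t) * ennreal (h t))"
        unfolding I[symmetric] nn_integral_cmult[OF mq, symmetric]
      proof (rule unit_integral_mono)
        fix t :: real assume t: "0 \<le> t" "t < 1"
        have hh: "0 \<le> h (\<rho> * t)" "h (\<rho> * t) \<le> h t" using t \<rho>t[of t] by (auto intro!: h0 h_mono)
        have "ennreal c * ennreal (h (\<rho> * t) powr q) = ennreal (c * h (\<rho> * t) powr q)"
          using c0 by (intro ennreal_mult[symmetric]) auto
        also have "c * h (\<rho> * t) powr q = \<phi> t * h (\<rho> * t)"
        \<comment> \<open>Lowering the exponent by one divides by \<open>h (\<rho> * t)\<close>;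
          where that vanishes both sides are 0.\<close>
        proof (cases "h (\<rho> * t) = 0")
          case False
          then have "h (\<rho> * t) powr (q - 1) * h (\<rho> * t) = h (\<rho> * t) powr q"
            using hh by (simp add: powr_diff)
          then show ?thesis by (simp add: \<phi>_def mult.assoc)
        qed (use q in \<open>simp add: \<phi>_def\<close>)
        also have "ennreal (\<phi> t * h (\<rho> * t)) \<le> ennreal (\<phi> t * h t)"
          using hh nn by (intro ennreal_leI mult_left_mono) auto
        also have "\<dots> = ennreal (\<phi> t) * ennreal (h t)"
          using hh nn by (intro ennreal_mult) auto
        finally show "ennreal c * ennreal (h (\<rho> * t) powr q) \<le> ennreal (\<phi> t) * ennreal (h t)" .
      qed
      ultimately have "ennreal c * ennreal I \<le> 2 * ennreal B" by (rule order_trans[rotated])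
      also have "2 * ennreal B = ennreal (2 * B)" using B by (subst ennreal_mult) auto
      also have "ennreal c * ennreal I = ennreal (c * I)" using c0 Ip by (intro ennreal_mult[symmetric]) auto
      finally have cI: "c * I \<le> 2 * B" using B by simp
      \<comment> \<open>Since \<open>c * I\<close> equals
        \<open>\<delta> powr (1 / p) * I powr (1 / q)\<close>, the power \<open>q\<close> isolates
        \<open>I\<close>.\<close>
      have "(c * I) powr q \<le> (2 * B) powr q"
        using cI c0 Ip q by (intro powr_mono2) auto
      moreover have "(c * I) powr q = \<delta> powr (q / p) * I"
      proof -
        have "(c * I) powr q = (\<delta> / I) powr (q / p) * I powr q"
          using c0 Ip by (simp add: powr_mult c_def powr_powr)
        also have "\<dots> = \<delta> powr (q / p) * (I powr q / I powr (q / p))"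
          using \<delta> Ip by (simp add: powr_divide)
        also have "I powr q / I powr (q / p) = I powr (q - q / p)" by (rule powr_diff[symmetric])
        also have "q - q / p = 1"
        proof -
          have "q - q / p = q * (1 - 1 / p)" by (simp add: algebra_simps)
          also have "1 - 1 / p = 1 / q" using pq by simp
          finally show ?thesis using q by simp
        qed
        finally show ?thesis using Ip by simp
      qed
      ultimately have "\<delta> powr (- (q / p)) * (\<delta> powr (q / p) * I) \<le> \<delta> powr (- (q / p)) * (2 * B) powr q"
        by (intro mult_left_mono) auto
      moreover have "\<delta> powr (- (q / p)) * (\<delta> powr (q / p) * I) = I"
      proof -
        have "\<delta> powr (- (q / p)) * \<delta> powr (q / p) = 1" using \<delta> by (subst powr_add[symmetric]) simp
        then show ?thesis by (simp only: mult.assoc[symmetric] mult_1_left)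
      qed
      ultimately have "I \<le> ?K" by (simp only: mult.commute)
      then show ?thesis unfolding I by (rule ennreal_leI)
    qed
  qed
  \<comment> \<open>The dilation factors tend to 1 and Fatou's lemma carries the uniform bound over
    to \<open>h\<close>, so finiteness of the energy is a conclusion here.\<close>
  show ?thesis
    unfolding energy_def
  proof (rule nn_integral_limit_le)
    fix t assume "t \<in> space unit_interval"
    then have t: "0 \<le> t" "t < 1" by (auto simp: space_unit_interval)
    have "(\<lambda>n. unit_seq n * t) \<longlonglongrightarrow> 1 * t" by (intro tendsto_mult unit_seq_lim tendsto_const)
    then have "(\<lambda>n. h (unit_seq n * t)) \<longlonglongrightarrow> h t"
      using continuous_on_tendsto_compose[OF continuous_h, of "\<lambda>n. unit_seq n * t" t sequentially] t unit_seq_mult[of t] by simp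
    moreover have "\<forall>\<^sub>F n in sequentially. 0 \<le> h (unit_seq n * t)"
      using t unit_seq_mult[of t] by (intro always_eventually allI h_nonneg) auto
    ultimately show "(\<lambda>n. ennreal (h (unit_seq n * t) powr q)) \<longlonglongrightarrow> epowr (ennreal (h t)) q"
      unfolding epowr_ennreal[OF h_nonneg[OF t]] using q by (intro tendsto_ennrealI tendsto_powr2 tendsto_const) auto
  next
    fix n
    have "continuous_on {0..<1} (\<lambda>t. h (unit_seq n * t))"
      by (rule continuous_on_compose2[OF continuous_h]) (use unit_seq_mult in \<open>auto intro!: continuous_intros\<close>)
    then have "continuous_on {0..<1} (\<lambda>t. h (unit_seq n * t) powr q)"
      using q unit_seq_mult by (intro continuous_on_powr' continuous_on_const) (auto intro!: h_nonneg)
    then show "(\<lambda>t. ennreal (h (unit_seq n * t) powr q)) \<in> borel_measurable unit_interval"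
      by (rule measurable_ennreal_unit_interval)
  qed (intro dil unit_seq_bounds)
qed

end

section \<open>Compactness\<close>

text \<open>Cauchy's formula on the circle of radius \<open>r\<close>, averaged over
  \<open>r\<close> between \<open>R\<close> and 1. Exchanging the integrals makes the inner ones run
  along rays, where the hypothesis applies. Ray bounds thus supply the local boundedness that
  Montel's theorem asks for, whatever the space.\<close>

lemma local_bound_from_rays:
  assumes f: "f holomorphic_on ball 0 1" and p: "1 < p" and A: "0 \<le> A"
    and rays: "\<And>\<alpha>. (\<integral>\<^sub>I t. epowr (enorm (f (rcis t \<alpha>))) p) \<le> ennreal A"
    and \<rho>: "0 \<le> \<rho>" "\<rho> < 1" and z: "norm z \<le> \<rho>"
  shows "norm (f z) \<le> 4 / (1 - \<rho>)\<^sup>2 * (1 + A)"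
proof -
  \<comment> \<open>At the midpoint both \<open>R - \<rho>\<close> and \<open>1 - R\<close> equal
    \<open>(1 - \<rho>) / 2\<close>, the origin of the 4 and the square in the bound.\<close>
  define R where "R = (1 + \<rho>) / 2"
  have R: "\<rho> < R" "0 < R" "R < 1" using \<rho> by (auto simp: R_def)
  define \<kappa> where "\<kappa> = 1 / (2 * pi) * (1 / (R - \<rho>))"
  have \<kappa>: "0 < \<kappa>" using R by (simp add: \<kappa>_def)
  \<comment> \<open>Extension by zero, so that the exchange of integrals takes place on the whole
    plane.\<close>
  define G where "G r \<theta> = enorm (f (rcis r \<theta>)) * indicator ({0..<1} \<times> {0..2 * pi}) (r, \<theta>)" for r \<theta> :: real
  have Gm: "(\<lambda>(r, \<theta>). G r \<theta>) \<in> borel_measurable (lborel \<Otimes>\<^sub>M lborel)"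
  proof -
    have "continuous_on ({0..<1} \<times> {0..2 * pi}) (\<lambda>x. f (rcis (fst x) (snd x)))"
    proof (rule continuous_on_compose2[OF holomorphic_on_imp_continuous_on[OF f]])
      show "continuous_on ({0..<1} \<times> {0..2 * pi}) (\<lambda>x. rcis (fst x) (snd x))"
        by (intro continuous_on_rcis continuous_on_fst continuous_on_snd continuous_on_id)
      show "(\<lambda>x. rcis (fst x) (snd x)) ` ({0..<1} \<times> {0..2 * pi}) \<subseteq> ball 0 1"
        by (intro image_subsetI rcis_in_ball) auto
    qed
    then have m: "(\<lambda>x. enorm (f (rcis (fst x) (snd x))) * indicator ({0..<1} \<times> {0..2 * pi}) x) \<in> borel_measurable borel"
      by (rule borel_measurable_norm_indicator) (intro borel_Times; simp)
    have eq: "sets (lborel \<Otimes>\<^sub>M lborel) = sets (borel :: (real \<times> real) measure)"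
      by (simp only: lborel_prod sets_lborel)
    have "(\<lambda>(r, \<theta>). G r \<theta>) = (\<lambda>x. enorm (f (rcis (fst x) (snd x))) * indicator ({0..<1} \<times> {0..2 * pi}) x)"
      by (simp add: G_def fun_eq_iff)
    then show ?thesis using m by (simp only: measurable_cong_sets[OF eq refl])
  qed
  have pt: "enorm (f z) * indicator {R<..<1} r \<le> ennreal \<kappa> * (\<integral>\<^sup>+\<theta>. G r \<theta> \<partial>lborel)" for r
  proof (cases "r \<in> {R<..<1}")
    case True
    then have r: "R < r" "r < 1" "0 < r" using R by auto
    have zr: "norm (z - 0) < r" using z R r by simp
    have "enorm (f z) \<le> ennreal (1 / (2 * pi)) *
           (\<integral>\<^sub>T \<theta>. ennreal (norm (f (0 + rcis r \<theta>)) * (r / norm (0 + rcis r \<theta> - z))))"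
      by (rule Cauchy_formula_bound[OF f r(3,2) zr])
    also have "\<dots> \<le> ennreal (1 / (2 * pi)) * (\<integral>\<^sub>T \<theta>. ennreal (1 / (R - \<rho>)) * enorm (f (rcis r \<theta>)))"
    proof (intro mult_left_mono nn_integral_mono)
      fix \<theta>
      have "r - norm z \<le> norm (rcis r \<theta> - z)" using norm_triangle_ineq2[of "rcis r \<theta>" z] r by simp
      then have d: "R - \<rho> \<le> norm (rcis r \<theta> - z)" using r z by linarith
      have "r / norm (rcis r \<theta> - z) \<le> 1 / (R - \<rho>)" using r R d by (intro frac_le) auto
      then have "norm (f (rcis r \<theta>)) * (r / norm (rcis r \<theta> - z)) \<le> norm (f (rcis r \<theta>)) * (1 / (R - \<rho>))"
        by (intro mult_left_mono) auto
      then have "ennreal (norm (f (0 + rcis r \<theta>)) * (r / norm (0 + rcis r \<theta> - z))) \<le> ennreal (1 / (R - \<rho>) * norm (f (rcis r \<theta>)))"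
        by (intro ennreal_leI) (simp add: mult.commute)
      also have "\<dots> = ennreal (1 / (R - \<rho>)) * enorm (f (rcis r \<theta>))"
        using R by (intro ennreal_mult) auto
      finally show "ennreal (norm (f (0 + rcis r \<theta>)) * (r / norm (0 + rcis r \<theta> - z))) \<le> ennreal (1 / (R - \<rho>)) * enorm (f (rcis r \<theta>))" .
    qed simp
    also have "(\<integral>\<^sub>T \<theta>. ennreal (1 / (R - \<rho>)) * enorm (f (rcis r \<theta>))) = ennreal (1 / (R - \<rho>)) * (\<integral>\<^sub>T \<theta>. enorm (f (rcis r \<theta>)))"
      by (rule nn_integral_cmult[OF measurable_circle[OF f r(3,2)]])
    also have "(\<integral>\<^sub>T \<theta>. enorm (f (rcis r \<theta>))) = (\<integral>\<^sup>+\<theta>. G r \<theta> \<partial>lborel)"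
    proof -
      have "(\<integral>\<^sub>T \<theta>. enorm (f (rcis r \<theta>))) = (\<integral>\<^sup>+\<theta>. enorm (f (rcis r \<theta>)) * indicator {0..2 * pi} \<theta> \<partial>lborel)"
        by (subst nn_integral_restrict_space) auto
      also have "\<dots> = (\<integral>\<^sup>+\<theta>. G r \<theta> \<partial>lborel)"
        using r by (intro nn_integral_cong) (auto simp: G_def split: split_indicator)
      finally show ?thesis .
    qed
    also have "ennreal (1 / (2 * pi)) * (ennreal (1 / (R - \<rho>)) * (\<integral>\<^sup>+\<theta>. G r \<theta> \<partial>lborel)) = ennreal \<kappa> * (\<integral>\<^sup>+\<theta>. G r \<theta> \<partial>lborel)"
    proof -
      have "ennreal (1 / (2 * pi)) * ennreal (1 / (R - \<rho>)) = ennreal \<kappa>"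
        unfolding \<kappa>_def using R by (intro ennreal_mult[symmetric]) auto
      then show ?thesis by (simp only: mult.assoc[symmetric])
    qed
    finally show ?thesis using True by simp
  qed simp
  have "enorm (f z) * ennreal (1 - R) = (\<integral>\<^sup>+r. enorm (f z) * indicator {R<..<1} r \<partial>lborel)"
    using R by (subst nn_integral_cmult_indicator) auto
  also have "\<dots> \<le> (\<integral>\<^sup>+r. ennreal \<kappa> * (\<integral>\<^sup>+\<theta>. G r \<theta> \<partial>lborel) \<partial>lborel)"
    by (intro nn_integral_mono pt)
  also have "\<dots> = ennreal \<kappa> * (\<integral>\<^sup>+r. \<integral>\<^sup>+\<theta>. G r \<theta> \<partial>lborel \<partial>lborel)"
    using Gm by (intro nn_integral_cmult lborel.borel_measurable_nn_integral)
  also have "(\<integral>\<^sup>+r. \<integral>\<^sup>+\<theta>. G r \<theta> \<partial>lborel \<partial>lborel) = (\<integral>\<^sup>+\<theta>. \<integral>\<^sup>+r. G r \<theta> \<partial>lborel \<partial>lborel)"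
    by (rule lborel_pair.Fubini'[OF Gm, symmetric])
  also have "\<dots> \<le> (\<integral>\<^sup>+\<theta>. ennreal (1 + A) * indicator {0..2 * pi} \<theta> \<partial>lborel)"
  proof (rule nn_integral_mono)
    fix \<theta> :: real
    show "(\<integral>\<^sup>+r. G r \<theta> \<partial>lborel) \<le> ennreal (1 + A) * indicator {0..2 * pi} \<theta>"
    proof (cases "\<theta> \<in> {0..2 * pi}")
      case True
      have mp: "(\<lambda>x. epowr x p) \<in> borel_measurable borel" by measurable
      have "(\<integral>\<^sup>+r. G r \<theta> \<partial>lborel) = (\<integral>\<^sup>+r. enorm (f (rcis r \<theta>)) * indicator {0..<1} r \<partial>lborel)"
        using True by (intro nn_integral_cong) (auto simp: G_def split: split_indicator)
      also have "\<dots> = (\<integral>\<^sub>I r. enorm (f (rcis r \<theta>)))"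
        by (subst nn_integral_restrict_space) auto
      also have "\<dots> \<le> (\<integral>\<^sub>I r. 1 + epowr (enorm (f (rcis r \<theta>))) p)"
      proof (rule nn_integral_mono)
        fix r
        \<comment> \<open>On an interval of length one this elementary inequality is enough to pass
          from the power \<open>p\<close> to the first power.\<close>
        have "x \<le> 1 + x powr p" if "0 \<le> x" for x :: real
        proof (cases "x \<le> 1")
          case False
          then have "x powr 1 \<le> x powr p" using p by (intro powr_mono) auto
          then show ?thesis using False by simp
        qed (simp add: add_increasing2)
        then have "enorm (f (rcis r \<theta>)) \<le> ennreal (1 + norm (f (rcis r \<theta>)) powr p)"
          by (intro ennreal_leI) simp
        then show "enorm (f (rcis r \<theta>)) \<le> 1 + epowr (enorm (f (rcis r \<theta>))) p"
          by (simp add: epowr_ennreal)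
      qed
      also have "\<dots> = (\<integral>\<^sub>I r. 1) + (\<integral>\<^sub>I r. epowr (enorm (f (rcis r \<theta>))) p)"
        by (intro nn_integral_add borel_measurable_const measurable_compose[OF measurable_ray[OF f] mp])
      also have "\<dots> \<le> 1 + ennreal A"
        using rays by (intro add_mono) (simp_all add: emeasure_restrict_space space_unit_interval)
      also have "\<dots> = ennreal (1 + A)" using A by simp
      finally show ?thesis using True by simp
    qed (simp add: G_def)
  qed
  also have "\<dots> = ennreal (1 + A) * ennreal (2 * pi)"
    by (subst nn_integral_cmult_indicator) auto
  finally have "enorm (f z) * ennreal (1 - R) \<le> ennreal \<kappa> * (ennreal (1 + A) * ennreal (2 * pi))"
    by (simp add: mult_left_mono)
  also have "\<dots> = ennreal (\<kappa> * ((1 + A) * (2 * pi)))"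
    using A \<kappa> by (simp add: ennreal_mult del: ennreal_plus)
  also have "enorm (f z) * ennreal (1 - R) = ennreal (norm (f z) * (1 - R))"
    using R by (intro ennreal_mult[symmetric]) auto
  finally have "norm (f z) * (1 - R) \<le> \<kappa> * ((1 + A) * (2 * pi))"
    using A \<kappa> by (simp add: zero_le_mult_iff)
  also have "\<dots> = (1 + A) / (R - \<rho>)" by (simp add: \<kappa>_def)
  finally have "norm (f z) \<le> (1 + A) / (R - \<rho>) / (1 - R)" using R by (simp add: pos_le_divide_eq mult_ac)
  also have "\<dots> = 4 / (1 - \<rho>)\<^sup>2 * (1 + A)"
  proof -
    have e: "R - \<rho> = (1 - \<rho>) / 2" "1 - R = (1 - \<rho>) / 2" by (simp_all add: R_def field_simps)
    show ?thesis unfolding e by (simp add: power2_eq_square)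
  qed
  finally show ?thesis .
qed

lemma ennreal_tendsto_0I:
  fixes f :: "nat \<Rightarrow> ennreal"
  assumes "\<And>e::real. 0 < e \<Longrightarrow> eventually (\<lambda>n. f n \<le> ennreal e) sequentially"
  shows "f \<longlonglongrightarrow> 0"
proof (rule order_tendstoI)
  fix a :: ennreal assume "0 < a"
  then obtain e where e: "0 < e" "ennreal e < a"
  proof (cases a)
    case (real r)
    then have "0 < r" using \<open>0 < a\<close> by simp
    then show ?thesis using real that[of "r / 2"] by (simp add: ennreal_less_iff)
  next
    case top
    then show ?thesis using that[of 1] by simp
  qed
  show "eventually (\<lambda>n. f n < a) sequentially"
    using assms[OF e(1)] by eventually_elim (rule order_le_less_trans[OF _ e(2)])
qed simp

context nonneg_symbol
begin

text \<open>Dominated convergence along the truncations at \<open>unit_seq n\<close>, with the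
  integrand of the finite energy as majorant.\<close>

lemma energy_tail:
  assumes q: "1 < q" and fin: "energy q < \<infinity>" and \<tau>: "0 < \<tau>"
  obtains R where "0 < R" "R < 1" "(\<integral>\<^sub>I t. epowr (ennreal (h t) * indicator {R<..} t) q) \<le> ennreal \<tau>"
proof -
  have mp: "(\<lambda>x. epowr x q) \<in> borel_measurable borel" by measurable
  let ?u = "\<lambda>n t. epowr (ennreal (h t) * indicator {unit_seq n<..} t) q"
  have um: "?u n \<in> borel_measurable unit_interval" for n
  proof (intro measurable_compose[OF _ mp] borel_measurable_times_ennreal measurable_h)
    show "(\<lambda>t. indicator {unit_seq n<..} t :: ennreal) \<in> borel_measurable unit_interval"
      by (intro measurable_restrict_space1 borel_measurable_indicator) simp
  qed
  have "(\<lambda>n. \<integral>\<^sub>I t. ?u n t) \<longlonglongrightarrow> (\<integral>\<^sub>I t. 0)"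
  proof (rule nn_integral_dominated_convergence[where w="\<lambda>t. epowr (ennreal (h t)) q"])
    show "(\<lambda>t. epowr (ennreal (h t)) q) \<in> borel_measurable unit_interval"
      by (rule measurable_compose[OF measurable_h mp])
    show "(\<integral>\<^sub>I t. epowr (ennreal (h t)) q) < \<infinity>" using fin by (simp add: energy_def)
    show "AE t in unit_interval. ?u n t \<le> epowr (ennreal (h t)) q" for n
      by (intro AE_I2) (auto split: split_indicator)
    show "AE t in unit_interval. (\<lambda>n. ?u n t) \<longlonglongrightarrow> 0"
    proof (rule AE_I2)
      fix t assume "t \<in> space unit_interval"
      then have t: "t < 1" by (auto simp: space_unit_interval)
      have "eventually (\<lambda>n. t < unit_seq n) sequentially" using order_tendstoD(1)[OF unit_seq_lim t] .
      then have "eventually (\<lambda>n. ?u n t = 0) sequentially" by eventually_elim simp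
      then show "(\<lambda>n. ?u n t) \<longlonglongrightarrow> 0" by (rule tendsto_eventually)
    qed
  qed (simp_all add: um)
  then have "(\<lambda>n. \<integral>\<^sub>I t. ?u n t) \<longlonglongrightarrow> 0" by simp
  then have "eventually (\<lambda>n. (\<integral>\<^sub>I t. ?u n t) < ennreal \<tau>) sequentially"
    using \<tau> by (intro order_tendstoD(2)) auto
  then obtain n where "(\<integral>\<^sub>I t. ?u n t) < ennreal \<tau>"
    by (auto simp: eventually_sequentially)
  then show ?thesis using that[of "unit_seq n"] unit_seq_bounds by simp
qed

lemma T_op_diff:
  assumes F: "F holomorphic_on ball 0 1" and G: "G holomorphic_on ball 0 1" and r: "0 \<le> r" "r < 1"
  shows "T_op g (\<lambda>z. F z - G z) (rcis r \<alpha>) = T_op g F (rcis r \<alpha>) - T_op g G (rcis r \<alpha>)"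
proof -
  have "((\<lambda>s. cis \<alpha> * ((F (rcis s \<alpha>) - G (rcis s \<alpha>)) * deriv g (rcis s \<alpha>))) has_integral T_op g (\<lambda>z. F z - G z) (rcis r \<alpha>)) {0..r}"
    by (rule T_op_radial[OF holomorphic_on_diff[OF F G] g r])
  moreover have "((\<lambda>s. cis \<alpha> * ((F (rcis s \<alpha>) - G (rcis s \<alpha>)) * deriv g (rcis s \<alpha>))) has_integral T_op g F (rcis r \<alpha>) - T_op g G (rcis r \<alpha>)) {0..r}"
    using has_integral_diff[OF T_op_radial[OF F g r, of \<alpha>] T_op_radial[OF G g r, of \<alpha>]] by (simp add: algebra_simps)
  ultimately show ?thesis by (rule has_integral_unique)
qed

text \<open>Up to \<open>R\<close> the function \<open>d\<close> is small and
  \<open>h \<le> h R\<close> by monotonicity. Beyond \<open>R\<close> only the ray bound on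
  \<open>d\<close> is at hand, and Hoelder's inequality pairs it with the tail of
  \<open>h\<close>.\<close>

lemma T_op_splitting:
  assumes pq: "1 < p" "1 / p + 1 / q = 1" and d: "d holomorphic_on ball 0 1"
    and A: "\<And>\<alpha>. (\<integral>\<^sub>I t. epowr (enorm (d (rcis t \<alpha>))) p) \<le> A"
    and R: "0 < R" "R < 1" and small: "\<And>z. norm z \<le> R \<Longrightarrow> norm (d z) \<le> e" and r: "0 \<le> r" "r < 1"
  shows "enorm (T_op g d (rcis r \<alpha>)) \<le> ennreal (e * h R) +
     epowr A (1 / p) * epowr (\<integral>\<^sub>I t. epowr (ennreal (h t) * indicator {R<..} t) q) (1 / q)"
proof -
  have qp: "1 < q" "1 / q + 1 / p = 1" using conjugate_gt_1[OF pq] pq by auto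
  have e0: "0 \<le> e" using order_trans[OF norm_ge_zero small[of 0]] R by simp
  have hR: "0 \<le> h R" using R by (intro h_nonneg) auto
  let ?H = "\<lambda>t. ennreal (h t) * indicator {R<..} t"
  have im: "(\<lambda>t. indicator {R<..} t :: ennreal) \<in> borel_measurable unit_interval"
    by (intro measurable_restrict_space1 borel_measurable_indicator) simp
  have Hm: "?H \<in> borel_measurable unit_interval"
    by (intro borel_measurable_times_ennreal measurable_h im)
  have "enorm (T_op g d (rcis r \<alpha>)) \<le> (\<integral>\<^sub>I t. enorm (d (rcis t \<alpha>)) * ennreal (h t))"
    by (rule norm_T_op_le[OF d r])
  also have "\<dots> \<le> (\<integral>\<^sub>I t. ennreal (e * h R) + enorm (d (rcis t \<alpha>)) * ?H t)"
  proof (rule unit_integral_mono)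
    fix t :: real assume t: "0 \<le> t" "t < 1"
    show "enorm (d (rcis t \<alpha>)) * ennreal (h t) \<le> ennreal (e * h R) + enorm (d (rcis t \<alpha>)) * ?H t"
    proof (cases "t \<le> R")
      case True
      have "norm (d (rcis t \<alpha>)) \<le> e" using True t by (intro small) simp
      moreover have "h t \<le> h R" using True t R by (intro h_mono) auto
      ultimately have "norm (d (rcis t \<alpha>)) * h t \<le> e * h R"
        using e0 h_nonneg[OF t] by (intro mult_mono) auto
      then have "ennreal (norm (d (rcis t \<alpha>)) * h t) \<le> ennreal (e * h R)" by (rule ennreal_leI)
      then show ?thesis using h_nonneg[OF t] True by (simp add: ennreal_mult add_increasing2)
    qed (simp add: add_increasing)
  qed
  also have "\<dots> = (\<integral>\<^sub>I t. ennreal (e * h R)) + (\<integral>\<^sub>I t. enorm (d (rcis t \<alpha>)) * ?H t)"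
    by (intro nn_integral_add borel_measurable_const borel_measurable_times_ennreal measurable_ray[OF d] measurable_h im)
  also have "(\<integral>\<^sub>I t. ennreal (e * h R)) = ennreal (e * h R)"
    by (simp add: emeasure_restrict_space space_unit_interval)
  also have "(\<integral>\<^sub>I t. enorm (d (rcis t \<alpha>)) * ?H t) \<le>
      epowr (\<integral>\<^sub>I t. epowr (enorm (d (rcis t \<alpha>))) p) (1 / p) * epowr (\<integral>\<^sub>I t. epowr (?H t) q) (1 / q)"
    by (rule nn_integral_Holder[OF qp measurable_ray[OF d] Hm])
  also have "\<dots> \<le> epowr A (1 / p) * epowr (\<integral>\<^sub>I t. epowr (?H t) q) (1 / q)"
    using pq by (intro mult_right_mono epowr_mono A) auto
  finally show ?thesis by (simp add: add_left_mono)
qed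

lemma in_Hardy_inf:
  assumes f: "f holomorphic_on ball 0 1" and fin: "Hardy_inf_norm (T_op g f) < \<infinity>"
  shows "T_op g f \<in> fspace Hardy_inf_norm"
  using T_op_holomorphic[OF f g] fin by (simp add: fspace_def)

text \<open>The locally uniform limit \<open>G\<close> is not placed in the space itself. By Fatou's
  lemma it inherits the ray bounds of the sequence, and these already make \<open>T_op g G\<close>
  bounded and allow the splitting for the differences.\<close>

lemma compact_if_energy_finite:
  assumes pq: "1 < p" "1 / p + 1 / q = 1" and C: "0 < C" and ray: "ray_bounded p X C" and E: "energy q < \<infinity>"
    and maps: "\<And>f. f \<in> fspace X \<Longrightarrow> T_op g f \<in> fspace Hardy_inf_norm"
  shows "compact_op X Hardy_inf_norm (T_op g)"
  unfolding compact_op_def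
proof (intro conjI ballI allI impI maps)
  have q: "1 < q" using conjugate_gt_1[OF pq] .
  fix F :: "nat \<Rightarrow> complex \<Rightarrow> complex" and M :: real
  assume FM: "\<forall>n. F n \<in> fspace X \<and> X (F n) \<le> ennreal M"
  then have hol: "F n holomorphic_on ball 0 1" for n by (auto dest: fspaceD)
  \<comment> \<open>A ray bound common to the whole sequence. \<open>ennreal M\<close> is 0 for
    negative \<open>M\<close>, hence the maximum.\<close>
  define A where "A = C * max M 0 powr p"
  have A0: "0 \<le> A" using C by (simp add: A_def)
  have rayF: "(\<integral>\<^sub>I t. epowr (enorm (F n (rcis t \<alpha>))) p) \<le> ennreal A" for n \<alpha>
  proof -
    have "(\<integral>\<^sub>I t. epowr (enorm (F n (rcis t \<alpha>))) p) \<le> ennreal C * epowr (X (F n)) p"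
      using ray FM by (simp add: ray_bounded_def)
    also have "\<dots> \<le> ennreal C * epowr (ennreal (max M 0)) p"
    proof (intro mult_left_mono epowr_mono)
      show "X (F n) \<le> ennreal (max M 0)"
        using FM by (meson ennreal_leI max.cobounded1 order_trans)
    qed (use pq in auto)
    also have "\<dots> = ennreal A" using C by (simp add: A_def epowr_ennreal ennreal_mult)
    finally show ?thesis .
  qed
  have locb: "\<exists>B. \<forall>f\<in>range F. \<forall>z\<in>K. norm (f z) \<le> B" if K: "compact K" "K \<subseteq> ball 0 1" for K
  proof (cases "K = {}")
    case False
    obtain \<rho> where \<rho>: "0 \<le> \<rho>" "\<rho> < 1" "\<And>z. z \<in> K \<Longrightarrow> norm z \<le> \<rho>"
    proof -
      obtain z0 where z0: "z0 \<in> K" "\<forall>z\<in>K. norm z \<le> norm z0"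
        using continuous_attains_sup[OF K(1) False, of norm] continuous_on_norm[OF continuous_on_id] by blast
      moreover have "norm z0 < 1" using z0 K by auto
      ultimately show ?thesis using that[of "norm z0"] by auto
    qed
    show ?thesis
    proof (intro exI ballI)
      fix f z assume "f \<in> range F" "z \<in> K"
      then show "norm (f z) \<le> 4 / (1 - \<rho>)\<^sup>2 * (1 + A)"
        using local_bound_from_rays[OF hol pq(1) A0 rayF \<rho>(1,2) \<rho>(3)] by auto
    qed
  qed simp
  obtain G s where G: "G holomorphic_on ball 0 1" and s: "strict_mono (s :: nat \<Rightarrow> nat)"
    and ptw: "\<And>z. z \<in> ball 0 1 \<Longrightarrow> (\<lambda>n. F (s n) z) \<longlonglongrightarrow> G z"
    and unif: "\<And>K. compact K \<Longrightarrow> K \<subseteq> ball 0 1 \<Longrightarrow> uniform_limit K (F \<circ> s) G sequentially"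
  proof (rule Montel[where S="ball 0 1" and \<H>="range F" and \<F>=F])
    show "\<And>f. f \<in> range F \<Longrightarrow> f holomorphic_on ball 0 1" using hol by auto
    show "\<And>K. compact K \<Longrightarrow> K \<subseteq> ball 0 1 \<Longrightarrow> \<exists>B. \<forall>f\<in>range F. \<forall>z\<in>K. norm (f z) \<le> B" by (rule locb)
  qed auto
  have mp: "(\<lambda>x. epowr x p) \<in> borel_measurable borel" by measurable
  have rayG: "(\<integral>\<^sub>I t. epowr (enorm (G (rcis t \<alpha>))) p) \<le> ennreal A" for \<alpha>
  proof (rule nn_integral_limit_le)
    show "(\<integral>\<^sub>I t. epowr (enorm (F (s n) (rcis t \<alpha>))) p) \<le> ennreal A" for n by (rule rayF)
    fix t assume "t \<in> space unit_interval"
    then have "rcis t \<alpha> \<in> ball 0 1" by (auto simp: space_unit_interval)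
    then show "(\<lambda>n. epowr (enorm (F (s n) (rcis t \<alpha>))) p) \<longlonglongrightarrow> epowr (enorm (G (rcis t \<alpha>))) p"
      using pq unfolding epowr_ennreal[OF norm_ge_zero]
      by (intro tendsto_ennrealI tendsto_powr2 tendsto_norm ptw tendsto_const always_eventually) auto
  qed (intro measurable_compose[OF measurable_ray[OF hol] mp])
  define D where "D = 2 powr p * (A + A)"
  have D0: "0 \<le> D" using A0 by (simp add: D_def)
  have rayd: "(\<integral>\<^sub>I t. epowr (enorm (F n (rcis t \<alpha>) - G (rcis t \<alpha>))) p) \<le> ennreal D" for n \<alpha>
  proof -
    note m = measurable_compose[OF measurable_ray[OF hol[of n], of \<alpha>] mp] measurable_compose[OF measurable_ray[OF G, of \<alpha>] mp]
    have "(\<integral>\<^sub>I t. epowr (enorm (F n (rcis t \<alpha>) - G (rcis t \<alpha>))) p) \<le>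
      (\<integral>\<^sub>I t. ennreal (2 powr p) * (epowr (enorm (F n (rcis t \<alpha>))) p + epowr (enorm (G (rcis t \<alpha>))) p))"
    proof (rule nn_integral_mono)
      fix t
      have "enorm (F n (rcis t \<alpha>) - G (rcis t \<alpha>)) \<le> enorm (F n (rcis t \<alpha>)) + enorm (G (rcis t \<alpha>))"
        using ennreal_leI[OF norm_triangle_ineq4[of "F n (rcis t \<alpha>)" "G (rcis t \<alpha>)"]] by simp
      then have "epowr (enorm (F n (rcis t \<alpha>) - G (rcis t \<alpha>))) p \<le> epowr (enorm (F n (rcis t \<alpha>)) + enorm (G (rcis t \<alpha>))) p"
        using pq by (intro epowr_mono) auto
      also have "\<dots> \<le> ennreal (2 powr p) * (epowr (enorm (F n (rcis t \<alpha>))) p + epowr (enorm (G (rcis t \<alpha>))) p)"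
        using pq by (intro epowr_add_le) simp
      finally show "epowr (enorm (F n (rcis t \<alpha>) - G (rcis t \<alpha>))) p \<le>
        ennreal (2 powr p) * (epowr (enorm (F n (rcis t \<alpha>))) p + epowr (enorm (G (rcis t \<alpha>))) p)" .
    qed
    also have "\<dots> = ennreal (2 powr p) * ((\<integral>\<^sub>I t. epowr (enorm (F n (rcis t \<alpha>))) p) + (\<integral>\<^sub>I t. epowr (enorm (G (rcis t \<alpha>))) p))"
      by (simp only: nn_integral_cmult[OF borel_measurable_add[OF m]] nn_integral_add[OF m])
    also have "\<dots> \<le> ennreal (2 powr p) * (ennreal A + ennreal A)"
      by (intro mult_left_mono add_mono rayF rayG) simp
    also have "\<dots> = ennreal D" by (simp only: D_def ennreal_mult[OF powr_ge_zero add_nonneg_nonneg[OF A0 A0]] ennreal_plus[OF A0 A0])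
    finally show ?thesis .
  qed
  have "Hardy_inf_norm (T_op g G) \<le> epowr (ennreal A) (1 / p) * epowr (energy q) (1 / q)"
    by (rule Hardy_inf_norm_T_op_le[OF pq G rayG])
  also have "\<dots> < \<infinity>"
    using E by (simp add: less_top[symmetric] ennreal_mult_eq_top_iff)
  finally have TG: "T_op g G \<in> fspace Hardy_inf_norm" by (rule in_Hardy_inf[OF G])
  have "(\<lambda>n. Hardy_inf_norm (\<lambda>z. T_op g (F (s n)) z - T_op g G z)) \<longlonglongrightarrow> 0"
  proof (rule ennreal_tendsto_0I)
    fix e :: real assume e: "0 < e"
    \<comment> \<open>\<open>a\<close> exceeds the \<open>p\<close>-th root of \<open>D\<close> and
      is positive even if \<open>D = 0\<close>; \<open>\<tau>\<close> is then chosen to make the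
      tail term at most \<open>e / 2\<close>.\<close>
    define a where "a = D powr (1 / p) + 1"
    have a: "0 < a" by (simp add: a_def add_nonneg_pos)
    define \<tau> where "\<tau> = (e / (2 * a)) powr q"
    have \<tau>: "0 < \<tau>" using e a by (simp add: \<tau>_def)
    obtain R where R: "0 < R" "R < 1" "(\<integral>\<^sub>I t. epowr (ennreal (h t) * indicator {R<..} t) q) \<le> ennreal \<tau>"
      using energy_tail[OF q E \<tau>] .
    have hR: "0 \<le> h R" using R by (intro h_nonneg) auto
    \<comment> \<open>Fixed only after \<open>R\<close>, as it has to outweigh \<open>h R\<close>;
      the summand 1 guards against \<open>h R = 0\<close>.\<close>
    define \<epsilon> where "\<epsilon> = e / (2 * (h R + 1))"
    have \<epsilon>: "0 < \<epsilon>" using e hR by (simp add: \<epsilon>_def)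
    have "cball 0 R \<subseteq> ball (0::complex) 1" using R by auto
    then have "uniform_limit (cball 0 R) (F \<circ> s) G sequentially" by (intro unif compact_cball)
    then have "eventually (\<lambda>n. \<forall>z\<in>cball 0 R. dist ((F \<circ> s) n z) (G z) < \<epsilon>) sequentially"
      using \<epsilon> by (rule uniform_limitD)
    then show "eventually (\<lambda>n. Hardy_inf_norm (\<lambda>z. T_op g (F (s n)) z - T_op g G z) \<le> ennreal e) sequentially"
    proof eventually_elim
      case (elim n)
      show ?case
      proof (rule Hardy_inf_norm_le)
        fix r \<alpha> :: real assume r: "0 < r" "r < 1"
        let ?d = "\<lambda>z. F (s n) z - G z"
        have "enorm (T_op g ?d (rcis r \<alpha>)) \<le> ennreal (\<epsilon> * h R) +
          epowr (ennreal D) (1 / p) * epowr (\<integral>\<^sub>I t. epowr (ennreal (h t) * indicator {R<..} t) q) (1 / q)"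
        proof (rule T_op_splitting[OF pq _ rayd R(1,2)])
          show "?d holomorphic_on ball 0 1" by (intro holomorphic_on_diff hol G)
          show "norm (?d z) \<le> \<epsilon>" if "norm z \<le> R" for z
            using elim that by (auto simp: dist_norm intro: less_imp_le)
        qed (use r in auto)
        also have "\<dots> \<le> ennreal (\<epsilon> * h R) + epowr (ennreal D) (1 / p) * epowr (ennreal \<tau>) (1 / q)"
          using q by (intro add_left_mono mult_left_mono epowr_mono R) auto
        also have "epowr (ennreal D) (1 / p) * epowr (ennreal \<tau>) (1 / q) = ennreal (D powr (1 / p) * (e / (2 * a)))"
        proof -
          have "epowr (ennreal \<tau>) (1 / q) = ennreal (e / (2 * a))"
            using e a q by (simp add: epowr_ennreal \<tau>_def powr_powr)
          moreover have "ennreal (D powr (1 / p)) * ennreal (e / (2 * a)) = ennreal (D powr (1 / p) * (e / (2 * a)))"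
            using e a by (intro ennreal_mult[symmetric]) auto
          ultimately show ?thesis by (simp only: epowr_ennreal[OF D0])
        qed
        also have "ennreal (\<epsilon> * h R) + ennreal (D powr (1 / p) * (e / (2 * a))) = ennreal (\<epsilon> * h R + D powr (1 / p) * (e / (2 * a)))"
          using \<epsilon> hR D0 e a by (intro ennreal_plus[symmetric]) auto
        also have "\<dots> \<le> ennreal e"
        proof (rule ennreal_leI)
          have "\<epsilon> * h R \<le> e / 2" using e hR by (simp add: \<epsilon>_def field_simps)
          moreover have "D powr (1 / p) * (e / (2 * a)) \<le> a * (e / (2 * a))"
            using e a by (intro mult_right_mono) (auto simp: a_def)
          moreover have "a * (e / (2 * a)) = e / 2" using a by simp
          ultimately show "\<epsilon> * h R + D powr (1 / p) * (e / (2 * a)) \<le> e" by linarith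
        qed
        finally show "enorm (T_op g (F (s n)) (rcis r \<alpha>) - T_op g G (rcis r \<alpha>)) \<le> ennreal e"
          using r by (subst T_op_diff[OF hol G, symmetric]) auto
      qed
    qed
  qed
  then show "\<exists>s h. strict_mono s \<and> h \<in> fspace Hardy_inf_norm \<and> (\<lambda>n. Hardy_inf_norm (\<lambda>z. T_op g (F (s n)) z - h z)) \<longlonglongrightarrow> 0"
    using s TG by blast
qed

end

section \<open>Norm estimates\<close>

text \<open>The threshold \<open>1 / C\<close> cancels the constant of \<open>test_bounded\<close>,
  so such test functions lie in the unit ball; it is the \<open>\<delta>\<close> used in
  \<open>energy_le_if_tests_bounded\<close>.\<close>

lemma test_function_in_space:
  assumes p: "1 < p" and C: "0 < C" and T: "test_bounded p X C"
    and phi: "continuous_on {0..1} \<phi>" "\<forall>t\<in>{0..1}. 0 \<le> \<phi> t"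
    and le: "(\<integral>\<^sub>I t. ennreal (\<phi> t powr p)) \<le> ennreal (1 / C)"
  shows "X (cauchy_transform \<phi>) \<le> 1" "cauchy_transform \<phi> \<in> fspace X"
proof -
  have "X (cauchy_transform \<phi>) \<le> epowr (ennreal C * (\<integral>\<^sub>I t. ennreal (\<phi> t powr p))) (1 / p)"
    using T phi by (simp add: test_bounded_def)
  also have "\<dots> \<le> epowr (ennreal C * ennreal (1 / C)) (1 / p)"
    using p by (intro epowr_mono mult_left_mono le) auto
  also have "ennreal C * ennreal (1 / C) = 1"
    using C by (subst ennreal_mult[symmetric]) auto
  finally show X: "X (cauchy_transform \<phi>) \<le> 1" by simp
  have "X (cauchy_transform \<phi>) < \<infinity>" using X by (rule order_le_less_trans) simp
  then show "cauchy_transform \<phi> \<in> fspace X"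
    using cauchy_transform_holomorphic[OF phi(1)] by (simp add: fspace_def)
qed

lemma Hardy_inf_norm_triangle:
  "Hardy_inf_norm f \<le> Hardy_inf_norm (\<lambda>z. f z - g z) + Hardy_inf_norm g"
  unfolding Hardy_inf_norm_def[of f]
proof (intro SUP_least)
  fix r \<theta> :: real assume "r \<in> {0<..<1}" "\<theta> \<in> {0..2 * pi}"
  then have r: "0 < r" "r < 1" "0 \<le> \<theta>" "\<theta> \<le> 2 * pi" by auto
  let ?z = "rcis r \<theta>"
  have "norm (f ?z) \<le> norm (f ?z - g ?z) + norm (g ?z)"
    using norm_triangle_ineq[of "f ?z - g ?z" "g ?z"] by simp
  then have "enorm (f ?z) \<le> ennreal (norm (f ?z - g ?z) + norm (g ?z))" by (rule ennreal_leI)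
  also have "\<dots> = enorm (f ?z - g ?z) + enorm (g ?z)" by simp
  also have "\<dots> \<le> Hardy_inf_norm (\<lambda>z. f z - g z) + Hardy_inf_norm g"
    using norm_le_Hardy_inf_norm[OF r, of "\<lambda>z. f z - g z"] norm_le_Hardy_inf_norm[OF r, of g] by (rule add_mono)
  finally show "enorm (f ?z) \<le> Hardy_inf_norm (\<lambda>z. f z - g z) + Hardy_inf_norm g" .
qed

context nonneg_symbol
begin

lemma Hardy_inf_norm_T_op_le_norm:
  assumes pq: "1 < p" "1 / p + 1 / q = 1" and C: "0 < C" and ray: "ray_bounded p X C" and f: "f \<in> fspace X"
  shows "Hardy_inf_norm (T_op g f) \<le> ennreal (C powr (1 / p)) * epowr (energy q) (1 / q) * X f"
proof -
  have "Hardy_inf_norm (T_op g f) \<le> epowr (ennreal C * epowr (X f) p) (1 / p) * epowr (energy q) (1 / q)"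
    using ray f by (intro Hardy_inf_norm_T_op_le[OF pq fspaceD[OF f]]) (simp add: ray_bounded_def)
  also have "epowr (ennreal C * epowr (X f) p) (1 / p) = ennreal (C powr (1 / p)) * X f"
    using pq C by (simp add: epowr_mult epowr_epowr epowr_ennreal)
  finally show ?thesis by (simp only: mult_ac)
qed

lemma bounded_if_energy_finite:
  assumes pq: "1 < p" "1 / p + 1 / q = 1" and C: "0 < C" and ray: "ray_bounded p X C" and E: "energy q < \<infinity>"
  shows "bounded_op X Hardy_inf_norm (T_op g)"
proof -
  let ?K = "ennreal (C powr (1 / p)) * epowr (energy q) (1 / q)"
  have K: "?K < \<infinity>" using E by (simp add: less_top[symmetric] ennreal_mult_eq_top_iff)
  then obtain c where c: "?K = ennreal c" by (cases ?K) auto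
  have le: "Hardy_inf_norm (T_op g f) \<le> ?K * X f" if "f \<in> fspace X" for f
    by (rule Hardy_inf_norm_T_op_le_norm[OF pq C ray that])
  have "T_op g f \<in> fspace Hardy_inf_norm" if f: "f \<in> fspace X" for f
  proof (rule in_Hardy_inf[OF fspaceD[OF f]])
    have "X f < \<infinity>" using f by (simp add: fspace_def)
    then have "?K * X f < \<infinity>" using K by (simp add: ennreal_mult_less_top)
    then show "Hardy_inf_norm (T_op g f) < \<infinity>" using le[OF f] by (rule order_le_less_trans[rotated])
  qed
  then show ?thesis using le unfolding bounded_op_def c by blast
qed

lemma op_norm_le_energy:
  assumes pq: "1 < p" "1 / p + 1 / q = 1" and C: "0 < C" and ray: "ray_bounded p X C"
  shows "op_norm X Hardy_inf_norm (T_op g) \<le> ennreal (C powr (1 / p)) * epowr (energy q) (1 / q)" (is "_ \<le> ?K")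
proof (cases "energy q < \<infinity>")
  case True
  have "Hardy_inf_norm (T_op g f) \<le> ?K" if f: "f \<in> {f \<in> fspace X. X f \<le> 1}" for f
  proof -
    have "Hardy_inf_norm (T_op g f) \<le> ?K * X f"
      using f by (intro Hardy_inf_norm_T_op_le_norm[OF pq C ray]) simp
    also have "\<dots> \<le> ?K * 1" using f by (intro mult_left_mono) auto
    finally show ?thesis by simp
  qed
  then show ?thesis
    using bounded_if_energy_finite[OF pq C ray True] by (auto simp: op_norm_def intro!: SUP_least)
next
  case False
  then have "energy q = top" by (simp add: less_top[symmetric])
  then have "?K = top" using C by (simp add: ennreal_mult_eq_top_iff)
  then show ?thesis by simp
qed

text \<open>Test functions with threshold \<open>1 / C\<close> lie in the unit ball, so a finite
  operator norm can serve as \<open>B\<close> in \<open>energy_le_if_tests_bounded\<close>. An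
  infinite one makes the right-hand side infinite, its constant being positive.\<close>

lemma energy_le_op_norm:
  assumes pq: "1 < p" "1 / p + 1 / q = 1" and C: "0 < C" and T: "test_bounded p X C"
  shows "energy q \<le> ennreal (2 powr q * C powr (q / p)) * epowr (op_norm X Hardy_inf_norm (T_op g)) q"
proof (cases "op_norm X Hardy_inf_norm (T_op g)")
  case (real B)
  then have bd: "bounded_op X Hardy_inf_norm (T_op g)"
    by (auto simp: op_norm_def split: if_splits)
  have "energy q \<le> ennreal ((2 * B) powr q * (1 / C) powr (- (q / p)))"
  proof (rule energy_le_if_tests_bounded[OF pq _ real(1)])
    show "0 < 1 / C" using C by simp
    fix \<phi> :: "real \<Rightarrow> real"
    assume phi: "continuous_on {0..1} \<phi>" "\<forall>t\<in>{0..1}. 0 \<le> \<phi> t"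
      "(\<integral>\<^sub>I t. ennreal (\<phi> t powr p)) \<le> ennreal (1 / C)"
    note t = test_function_in_space[OF pq(1) C T phi]
    have "Hardy_inf_norm (T_op g (cauchy_transform \<phi>)) \<le> (SUP f\<in>{f \<in> fspace X. X f \<le> 1}. Hardy_inf_norm (T_op g f))"
      using t by (intro SUP_upper) simp
    then show "Hardy_inf_norm (T_op g (cauchy_transform \<phi>)) \<le> ennreal B"
      using bd real(2) by (simp add: op_norm_def)
  qed
  also have "(2 * B) powr q * (1 / C) powr (- (q / p)) = 2 powr q * C powr (q / p) * B powr q"
    using C real(1) by (simp add: powr_mult powr_divide powr_minus field_simps)
  also have "ennreal \<dots> = ennreal (2 powr q * C powr (q / p)) * epowr (op_norm X Hardy_inf_norm (T_op g)) q"
    using real by (simp only: real(2) epowr_ennreal[OF real(1)]) (intro ennreal_mult; simp)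
  finally show ?thesis .
next
  case top
  then show ?thesis using C by (simp add: ennreal_mult_eq_top_iff)
qed

lemma energy_finite_if_bounded:
  assumes pq: "1 < p" "1 / p + 1 / q = 1" and C: "0 < C" and T: "test_bounded p X C"
    and bd: "bounded_op X Hardy_inf_norm (T_op g)"
  shows "energy q < \<infinity>"
proof -
  from bd obtain K :: real where K: "\<And>f. f \<in> fspace X \<Longrightarrow> Hardy_inf_norm (T_op g f) \<le> ennreal K * X f"
    unfolding bounded_op_def by blast
  have "op_norm X Hardy_inf_norm (T_op g) \<le> ennreal K"
  proof -
    have "Hardy_inf_norm (T_op g f) \<le> ennreal K" if f: "f \<in> {f \<in> fspace X. X f \<le> 1}" for f
    proof -
      have "Hardy_inf_norm (T_op g f) \<le> ennreal K * X f" using f by (intro K) simp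
      also have "\<dots> \<le> ennreal K * 1" using f by (intro mult_left_mono) auto
      finally show ?thesis by simp
    qed
    then show ?thesis using bd by (auto simp: op_norm_def intro!: SUP_least)
  qed
  then have "op_norm X Hardy_inf_norm (T_op g) \<noteq> top" by (auto simp: top_unique)
  then have "ennreal (2 powr q * C powr (q / p)) * epowr (op_norm X Hardy_inf_norm (T_op g)) q < \<infinity>"
    by (simp add: less_top[symmetric] ennreal_mult_eq_top_iff)
  then show ?thesis using energy_le_op_norm[OF pq C T] by (rule order_le_less_trans[rotated])
qed

text \<open>Argued on the test functions, since passing from the unit ball to
  \<open>bounded_op\<close> would call for homogeneity of \<open>X\<close>. If their images were
  unbounded, a sequence with image norms above \<open>n\<close> would have a subsequence converging
  to a function of finite norm, against the triangle inequality.\<close>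

lemma energy_finite_if_compact:
  assumes pq: "1 < p" "1 / p + 1 / q = 1" and C: "0 < C" and T: "test_bounded p X C"
    and cp: "compact_op X Hardy_inf_norm (T_op g)"
  shows "energy q < \<infinity>"
proof -
  define tests where "tests = {\<phi>. continuous_on {0..1} \<phi> \<and> (\<forall>t\<in>{0..1}. 0 \<le> \<phi> t) \<and>
      (\<integral>\<^sub>I t. ennreal (\<phi> t powr p)) \<le> ennreal (1 / C)}"
  have "\<exists>n::nat. \<forall>\<phi>\<in>tests. Hardy_inf_norm (T_op g (cauchy_transform \<phi>)) \<le> ennreal (real n)"
  proof (rule ccontr)
    assume "\<not> ?thesis"
    then have "\<forall>n::nat. \<exists>\<phi>\<in>tests. ennreal (real n) < Hardy_inf_norm (T_op g (cauchy_transform \<phi>))"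
      by (auto simp: not_le)
    then obtain \<phi> where \<phi>: "\<And>n. \<phi> n \<in> tests" "\<And>n. ennreal (real n) < Hardy_inf_norm (T_op g (cauchy_transform (\<phi> n)))"
      by metis
    have "cauchy_transform (\<phi> n) \<in> fspace X \<and> X (cauchy_transform (\<phi> n)) \<le> ennreal 1" for n
      using test_function_in_space[OF pq(1) C T, of "\<phi> n"] \<phi>(1)[of n] by (simp add: tests_def)
    then obtain s h where s: "strict_mono (s :: nat \<Rightarrow> nat)" and h: "h \<in> fspace Hardy_inf_norm"
      and lim: "(\<lambda>n. Hardy_inf_norm (\<lambda>z. T_op g (cauchy_transform (\<phi> (s n))) z - h z)) \<longlonglongrightarrow> 0"
      using cp[unfolded compact_op_def, THEN conjunct2, rule_format, of "\<lambda>n. cauchy_transform (\<phi> n)" 1] by blast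
    have "Hardy_inf_norm h < \<infinity>" using h by (simp add: fspace_def)
    then obtain c where c: "Hardy_inf_norm h = ennreal c" "0 \<le> c" by (cases "Hardy_inf_norm h") auto
    have "eventually (\<lambda>n. Hardy_inf_norm (\<lambda>z. T_op g (cauchy_transform (\<phi> (s n))) z - h z) < 1) sequentially"
      using lim by (rule order_tendstoD(2)) simp
    then obtain N where N: "\<And>n. n \<ge> N \<Longrightarrow> Hardy_inf_norm (\<lambda>z. T_op g (cauchy_transform (\<phi> (s n))) z - h z) < 1"
      by (auto simp: eventually_sequentially)
    \<comment> \<open>From \<open>N\<close> on, the image norms are at most \<open>1 + c\<close>.
      They also exceed \<open>s n\<close>, and \<open>s n \<ge> n \<ge> 1 + c\<close>.\<close>
    define n where "n = max N (nat \<lceil>1 + c\<rceil>)"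
    have n: "n \<ge> N" "1 + c \<le> real n" by (simp_all add: n_def) linarith
    have "ennreal (real (s n)) < Hardy_inf_norm (T_op g (cauchy_transform (\<phi> (s n))))" by (rule \<phi>(2))
    also have "\<dots> \<le> Hardy_inf_norm (\<lambda>z. T_op g (cauchy_transform (\<phi> (s n))) z - h z) + Hardy_inf_norm h"
      by (rule Hardy_inf_norm_triangle)
    also have "\<dots> \<le> 1 + ennreal c" using N[OF n(1)] c by (intro add_mono) auto
    also have "\<dots> = ennreal (1 + c)" using c by simp
    also have "\<dots> \<le> ennreal (real (s n))"
      using n(2) seq_suble[OF s, of n] by (intro ennreal_leI) linarith
    finally show False by simp
  qed
  then obtain n :: nat where n: "\<And>\<phi>. \<phi> \<in> tests \<Longrightarrow> Hardy_inf_norm (T_op g (cauchy_transform \<phi>)) \<le> ennreal (real n)"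
    by blast
  have "energy q \<le> ennreal ((2 * real n) powr q * (1 / C) powr (- (q / p)))"
    using C by (intro energy_le_if_tests_bounded[OF pq] n) (auto simp: tests_def)
  then show ?thesis by (rule order_le_less_trans) simp
qed

end

theorem theorem1:
  fixes p p' :: real and X :: fnorm
  assumes "1 < p" and "1 / p + 1 / p' = 1"
    and "X \<in> {Hardy_norm p, Dirichlet_norm p, HL_norm p}"
  shows "(\<forall>g. g \<in> fspace Hardy_inf_norm \<and> (\<forall>n. maclaurin_coeff g n \<in> \<real>\<^sub>\<ge>\<^sub>0) \<longrightarrow>
            (bounded_op X Hardy_inf_norm (T_op g) \<longleftrightarrow> compact_op X Hardy_inf_norm (T_op g)) \<and>
            (bounded_op X Hardy_inf_norm (T_op g) \<longleftrightarrow> coeff_series p' g < \<infinity>)) \<and>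
         (\<exists>C::real. C > 0 \<and>
            (\<forall>g. g \<in> fspace Hardy_inf_norm \<and> (\<forall>n. maclaurin_coeff g n \<in> \<real>\<^sub>\<ge>\<^sub>0) \<longrightarrow>
               ennreal (1 / C) * coeff_series p' g \<le> epowr (op_norm X Hardy_inf_norm (T_op g)) p' \<and>
               epowr (op_norm X Hardy_inf_norm (T_op g)) p' \<le> ennreal C * coeff_series p' g))"
proof -
  note pq = assms(1,2)
  have q: "1 < p'" using conjugate_gt_1[OF pq] .
  obtain C where C: "0 < C" and ray: "ray_bounded p X C" using ray_bounded_spaces[OF assms(1,3)] by blast
  obtain D where D: "0 < D" and test: "test_bounded p X D" using test_bounded_spaces[OF assms(1,3)] by blast
  define K where "K = max_kernel_const p' 2"
  have K0: "0 \<le> K" using max_kernel_const_pos[OF q, of 2] by (simp add: K_def)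
  \<comment> \<open>\<open>cl\<close> composes the bound of the series by the energy with that of
    the energy by the operator norm. \<open>cu\<close> belongs to the reverse chain, with the ray
    constant \<open>C powr (1 / p)\<close> raised to \<open>p'\<close>.\<close>
  define cl where "cl = K * (2 powr p' * D powr (p' / p))"
  define cu where "cu = C powr (p' / p) * (2 powr p' * K)"
  have cc: "0 \<le> cl" "0 \<le> cu" using K0 by (auto simp: cl_def cu_def)
  \<comment> \<open>One constant for both directions; the summand 1 keeps it positive.\<close>
  define M where "M = cl + cu + 1"
  have M: "0 < M" "cl \<le> M" "cu \<le> M" using cc by (auto simp: M_def)
  have sym: "nonneg_symbol g" if "g \<in> fspace Hardy_inf_norm \<and> (\<forall>n. maclaurin_coeff g n \<in> \<real>\<^sub>\<ge>\<^sub>0)" for g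
    using that by unfold_locales (auto dest: fspaceD)
  have equiv: "(bounded_op X Hardy_inf_norm (T_op g) \<longleftrightarrow> compact_op X Hardy_inf_norm (T_op g)) \<and>
      (bounded_op X Hardy_inf_norm (T_op g) \<longleftrightarrow> coeff_series p' g < \<infinity>)" if "nonneg_symbol g" for g
  proof -
    interpret nonneg_symbol g by fact
    have fin: "coeff_series p' g < \<infinity> \<longleftrightarrow> energy p' < \<infinity>"
    proof
      assume "coeff_series p' g < \<infinity>"
      then have "ennreal (2 powr p' * max_kernel_const p' 2) * coeff_series p' g < \<infinity>"
        by (simp add: ennreal_mult_less_top)
      then show "energy p' < \<infinity>" using energy_le_coeff_series[OF q] by (rule order_le_less_trans[rotated])
    next
      assume "energy p' < \<infinity>"
      then have "ennreal (max_kernel_const p' 2) * energy p' < \<infinity>" by (simp add: ennreal_mult_less_top)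
      then show "coeff_series p' g < \<infinity>" using coeff_series_le_energy[OF q] by (rule order_le_less_trans[rotated])
    qed
    have b_e: "bounded_op X Hardy_inf_norm (T_op g) \<longleftrightarrow> energy p' < \<infinity>"
      using bounded_if_energy_finite[OF pq C ray] energy_finite_if_bounded[OF pq D test] by blast
    have "compact_op X Hardy_inf_norm (T_op g)" if E: "energy p' < \<infinity>"
    proof (rule compact_if_energy_finite[OF pq C ray E])
      show "T_op g f \<in> fspace Hardy_inf_norm" if "f \<in> fspace X" for f
        using bounded_if_energy_finite[OF pq C ray E] that by (simp add: bounded_op_def)
    qed
    then show ?thesis
      using b_e fin energy_finite_if_compact[OF pq D test] by blast
  qed
  have lower: "ennreal (1 / M) * coeff_series p' g \<le> epowr (op_norm X Hardy_inf_norm (T_op g)) p'" if "nonneg_symbol g" for g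
  proof -
    interpret nonneg_symbol g by fact
    let ?N = "epowr (op_norm X Hardy_inf_norm (T_op g)) p'"
    have "coeff_series p' g \<le> ennreal K * energy p'" unfolding K_def by (rule coeff_series_le_energy[OF q])
    also have "\<dots> \<le> ennreal K * (ennreal (2 powr p' * D powr (p' / p)) * ?N)"
      by (intro mult_left_mono energy_le_op_norm[OF pq D test]) simp
    also have "\<dots> = ennreal cl * ?N" using K0 by (simp add: cl_def ennreal_mult mult.assoc)
    also have "\<dots> \<le> ennreal M * ?N" using M by (intro mult_right_mono ennreal_leI) auto
    finally have "ennreal (1 / M) * coeff_series p' g \<le> ennreal (1 / M) * (ennreal M * ?N)"
      by (rule mult_left_mono) simp
    also have "\<dots> = (ennreal (1 / M) * ennreal M) * ?N" by (simp only: mult.assoc)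
    also have "ennreal (1 / M) * ennreal M = 1" using M by (subst ennreal_mult[symmetric]) auto
    finally show ?thesis by simp
  qed
  have upper: "epowr (op_norm X Hardy_inf_norm (T_op g)) p' \<le> ennreal M * coeff_series p' g" if "nonneg_symbol g" for g
  proof -
    interpret nonneg_symbol g by fact
    have "epowr (op_norm X Hardy_inf_norm (T_op g)) p' \<le> epowr (ennreal (C powr (1 / p)) * epowr (energy p') (1 / p')) p'"
      using q by (intro epowr_mono op_norm_le_energy[OF pq C ray]) auto
    also have "\<dots> = ennreal (C powr (p' / p)) * energy p'"
      using q by (simp add: epowr_mult epowr_epowr epowr_ennreal powr_powr)
    also have "\<dots> \<le> ennreal (C powr (p' / p)) * (ennreal (2 powr p' * K) * coeff_series p' g)"
      unfolding K_def by (intro mult_left_mono energy_le_coeff_series[OF q]) simp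
    also have "\<dots> = ennreal cu * coeff_series p' g" using K0 by (simp add: cu_def ennreal_mult mult.assoc)
    also have "\<dots> \<le> ennreal M * coeff_series p' g" using M by (intro mult_right_mono ennreal_leI) auto
    finally show ?thesis .
  qed
  show ?thesis
    using equiv lower upper sym M(1) by blast
qed

end
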